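(* Consider the coupled finite difference–discontinuous Galerkin semi-discretization of the two-dimensional elastic wave equation described in the context (the FD scheme together with the DG scheme). Let $$\chi_1=2\mu_v+\lambda_v,\qquad \chi_2=2\mu_u+\lambda_u,$$ where the Lamé parameters $\mu_u,\lambda_u,\mu_v,\lambda_v$ are positive. Assume that the operators $\mathcal{D}_y,\mathcal{D}_{yy}$ are fully compatible, and that the projection operators between the FD and DG meshes are norm compatible, i.e. $$\mathcal{M}_\Gamma\mathcal{P}^g_{u2v}=(\mathcal{H}_x\mathcal{P}^b_{v2u})^T,\qquad \mathcal{M}_\Gamma\mathcal{P}^b_{u2v}=(\mathcal{H}_x\mathcal{P}^g_{v2u})^T .$$ Then the FD and DG semi-discretizations form an energy conserving scheme under the choices $$\alpha_u=\alpha_v\ge \frac{1}{4C}\qquad\text{and}\qquad \beta_u=\beta_v\ge\frac{1}{4C'}$$ for some constants $C,C'>0$, with $C$ depending on the quality of the triangulation $\mathscr{K}_h$ and $C'$ on the order of the SBP operators used.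
   Context: **Continuous setting.** $\Omega=\Omega_u\cup\Omega_v\subset\mathbb{R}^2$, where $\Omega_u$ is a rectangle lying above $\Omega_v$ and the two subdomains share the horizontal interface $\Gamma=\partial\Omega_u\cap\partial\Omega_v$, the southern side of $\Omega_u$. The densities $\rho_u,\rho_v$ and the Lamé parameters are constant in each subdomain. The problem is the isotropic elastic wave equation for displacements $\mathbf{u}=[u_1,u_2]^T$ in $\Omega_u$ and $\mathbf{v}=[v_1,v_2]^T$ in $\Omega_v$, without forcing, with traction-free conditions on the outer boundary and continuity of displacement and traction on $\Gamma$. For $\mathbf{v}$, $\varepsilon(\mathbf{v})=\frac12(\nabla\mathbf{v}+\nabla\mathbf{v}^T)$ and $\sigma(\mathbf{v})=2\mu_v\varepsilon(\mathbf{v})+\lambda_v(\nabla\cdot\mathbf{v})I$. **One-dimensional SBP operators.** On a uniform one-dimensional grid let $H$ be a diagonal positive definite quadrature matrix, and let $D_1$, $D_2$ be narrow-stencil finite difference approximations, of order $2p$, of the first and second derivative. They satisfy the summation-by-parts (SBP) property if $HD_1+(HD_1)^T=B$ and $D_2=H^{-1}(-A+BS)$, where $B=B_n-B_0$, $B_n=\mathrm{diag}(0,\dots,0,1)$, $B_0=\mathrm{diag}(1,0,\dots,0)$, $A$ is symmetric positive semi-definite and $S$ approximates the first derivative at the boundary. They are fully compatible if $D_2=H^{-1}(-D_1^THD_1-R+BD_1)$ with $R$ symmetric positive semi-definite. **FD notation.** $\Omega_u$ is discretized uniformly by $m$ grid points in $x$ and $n$ grid points in $y$; $h_u$ is the grid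 spacing in the $x$-direction. $I_x,I_y$ are identities of size $m,n$. $D_x,D_{xx},H_x$ and $D_y,D_{yy},H_y$ are one-dimensional operators with the SBP property in the two directions, the first $y$-grid line lying on $\Gamma$. Full-size operators are $\mathcal{F}_x=I_2\otimes F_x\otimes I_y$ and $\mathcal{F}_y=I_2\otimes I_x\otimes F_y$; full compatibility of $\mathcal{D}_y,\mathcal{D}_{yy}$ means that of $D_y,D_{yy}$. Further, $\mathcal{D}_{xy}=\mathcal{D}_x\mathcal{D}_y$, $\mathcal{H}=\mathcal{H}_x\mathcal{H}_y$, $\mathcal{B}_\Gamma=I_2\otimes I_x\otimes B_0$. With $I=I_x\otimes I_y$, $$\mathcal{L}_1=\begin{bmatrix}(2\mu_u+\lambda_u)I&0\\0&\mu_uI\end{bmatrix},\quad \mathcal{L}_2=\begin{bmatrix}0&\lambda_uI\\ \mu_uI&0\end{bmatrix},\quad \mathcal{L}_3=\begin{bmatrix}\mu_uI&0\\0&(2\mu_u+\lambda_u)I\end{bmatrix},$$ $\mathcal{T}_y=\mathcal{L}_3\mathcal{D}_y+\mathcal{L}_2^T\mathcal{D}_x$, and $\mathcal{T}_u=-\mathcal{B}_\Gamma\mathcal{T}_y$ is the discrete traction on $\Gamma$. The FD unknown is $\mathbf{u}(t)\in\mathbb{R}^{2mn}$, and $\mathbf{u}_\Gamma=\mathcal{B}_\Gamma\mathbf{u}$. **DG notation.** $\mathscr{K}_h$ is a quasi-uniform triangulation of $\Omega_v$ with smallest element diameter $h_v$. $\mathscr{V}_h^q$ is the space of functions on $\Omega_v$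 that are polynomials of order $q$ on each $K\in\mathscr{K}_h$ (possibly discontinuous across elements). Derivatives are taken elementwise. $(\cdot,\cdot)_{\Omega_v}$ and $(\cdot,\cdot)_\gamma$ are the $L^2$ inner products on $\Omega_v$ and on an edge $\gamma$, and $\mathscr{E}_h^\Gamma$ is the set of mesh edges on $\Gamma$. A nodal basis is used; $N_v$ is the number of DG degrees of freedom per component, and $N_u=mn$. For a DG function $\mathbf{v}$, $\mathbf{v}_\Gamma\in\mathbb{R}^{2N_v}$ is its vector of nodal values on $\Gamma$, with zeros elsewhere (the same symbol denotes the trace on $\Gamma$). For $c\in\mathbb{R}^{2N_v}$ supported on the interface nodes, $[c]^\gamma$ is the vector-valued polynomial on $\gamma$ with nodal values given by $c$. $\boldsymbol{\tau}^\gamma(\mathbf{v})=\sigma(\mathbf{v})\mathbf{n}^+$ on $\gamma$, with $\mathbf{n}^+=[0,1]^T$, and $\mathcal{T}_v\mathbf{v}\in\mathbb{R}^{2N_v}$ is the coefficient vector on $\Gamma$ of this traction. $\mathcal{M}_\Gamma=I_2\otimes M_\Gamma$, where $M_\Gamma$ is the $N_v\times N_v$ one-dimensional interface mass matrix, so that $(\boldsymbol\varphi,\boldsymbol\psi)_\Gamma=\boldsymbol\varphi_\Gamma^T\mathcal{M}_\Gamma\boldsymbol\psi_\Gamma$. **Projection operators.** $\Pi^g_{u2v},\Pi^b_{u2v}$ are one-dimensional projection matrices from values at the FD grid points on $\Gamma$ to DG nodal coefficients on $\Gamma$, and $\Pi^g_{v2u},\Pi^b_{v2u}$ are projection matrices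 in the reverse direction; $g$ and $b$ stand for "good" and "bad" (higher and lower boundary order of accuracy). $P^{g}_{u2v},P^b_{u2v}$ ($N_v\times N_u$) and $P^{g}_{v2u},P^b_{v2u}$ ($N_u\times N_v$) are these matrices embedded at the interface degrees of freedom with zeros elsewhere, $\mathcal{P}^{g}_{u2v}=I_2\otimes P^{g}_{u2v}$, and similarly for the other three. **The coupled scheme.** $\alpha_u,\alpha_v,\beta_u,\beta_v$ are penalty parameters. FD scheme: $$\begin{aligned}\rho_u\mathbf{u}_{tt}=&\ \mathcal{L}_1\mathcal{D}_{xx}\mathbf{u}+\mathcal{L}_3\mathcal{D}_{yy}\mathbf{u}+(\mathcal{L}_2+\mathcal{L}_2^T)\mathcal{D}_{xy}\mathbf{u}\\ &+\mathcal{H}^{-1}\Big[-\tfrac12\mathcal{B}_\Gamma\mathcal{H}_x(\mathcal{T}_u\mathbf{u}+\mathcal{P}^b_{v2u}\mathcal{T}_v\mathbf{v})+\tfrac12\mathcal{T}_u^T\mathcal{H}_x(\mathbf{u}_\Gamma-\mathcal{P}^g_{v2u}\mathbf{v}_\Gamma)\Big]\\ &-\mathcal{H}^{-1}\Big[\chi_1\tfrac{\alpha_u}{h_v}\mathcal{B}_\Gamma\mathcal{H}_x\mathcal{P}^b_{v2u}(\mathcal{P}^g_{u2v}\mathbf{u}_\Gamma-\mathbf{v}_\Gamma)+\chi_2\tfrac{\beta_u}{h_u}\mathcal{B}_\Gamma\mathcal{H}_x(\mathbf{u}_\Gamma-\mathcal{P}^g_{v2u}\mathbf{v}_\Gamma)\Big].\end{aligned}$$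 Only boundary contributions from the southern side $\Gamma$ of $\Omega_u$ are considered: the penalty terms imposing the traction-free condition on $\partial\Omega_u\setminus\Gamma$ are not displayed, and boundary terms from those sides are disregarded in the energy balance. DG scheme: find $\mathbf{v}(t)\in\mathscr{V}_h^q\times\mathscr{V}_h^q$ such that, for all $\boldsymbol\varphi\in\mathscr{V}_h^q\times\mathscr{V}_h^q$ and each $t\in(0,T]$, $$\begin{aligned}(\rho_v\mathbf{v}_{tt},\boldsymbol\varphi)_{\Omega_v}=&-\lambda_v(\nabla\cdot\mathbf{v},\nabla\cdot\boldsymbol\varphi)_{\Omega_v}-2\mu_v(\varepsilon(\mathbf{v}),\varepsilon(\boldsymbol\varphi))_{\Omega_v}\\ &+\tfrac12\sum_{\gamma\in\mathscr{E}_h^\Gamma}\big(\mathbf{v}_\Gamma-[\mathcal{P}^g_{u2v}\mathbf{u}_\Gamma]^\gamma,\boldsymbol\tau^\gamma(\boldsymbol\varphi)\big)_\gamma+\tfrac12\sum_{\gamma\in\mathscr{E}_h^\Gamma}\big(\boldsymbol\tau^\gamma(\mathbf{v})-[\mathcal{P}^b_{u2v}\mathcal{T}_u\mathbf{u}]^\gamma,\boldsymbol\varphi\big)_\gamma\\ &-\chi_1\tfrac{\alpha_v}{h_v}\sum_{\gamma\in\mathscr{E}_h^\Gamma}\big(\mathbf{v}_\Gamma-[\mathcal{P}^g_{u2v}\mathbf{u}_\Gamma]^\gamma,\boldsymbol\varphi\big)_\gamma-\chi_2\tfrac{\beta_v}{h_u}\sum_{\gamma\in\mathscr{E}_h^\Gamma}\big([\mathcal{P}^b_{u2v}\mathcal{P}^g_{v2u}\mathbf{v}_\Gamma]^\gamma-[\mathcal{P}^b_{u2v}\mathbf{u}_\Gamma]^\gamma,\boldsymbol\varphi\big)_\gamma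 .\end{aligned}$$ Only fluxes on edges of $\Gamma$ are included; the fluxes on interior DG edges are treated as in the standard interior penalty DG method and are neglected here. **Energy conserving.** This means that there is a non-negative quadratic form $U(\mathbf{u},\mathbf{v})\ge 0$ of the discrete displacements such that solutions of the coupled scheme satisfy $$\frac{d}{dt}\Big(\rho_u\mathbf{u}_t^T\mathcal{H}\mathbf{u}_t+(\rho_v\mathbf{v}_t,\mathbf{v}_t)_{\Omega_v}+U(\mathbf{u},\mathbf{v})\Big)=0 .$$
   Formalization: The x-operators are also assumed compatible, A = D_x^T H_x D_x + R with R positive semi-definite (the claim fails otherwise); C may also depend on q, and C' also on the boundary weight of H_y and on the ratio of y- to x-spacing (a C' depending on the order alone fails). *)

theory Defs
  imports "HOL-Analysis.Analysis" "Jordan_Normal_Form.Gauss_Jordan_Elimination"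
begin

unbundle no vec_syntax
no_notation scalar_prod (infix \<open>\<bullet>\<close> 70)
notation vec_nth (infixl \<open>$h\<close> 90)
notation scalar_prod (infix \<open>\<bullet>\<^sub>v\<close> 70)

text \<open>The sizes of the grid and of the DG space are quantified together with all other data, so
  coefficient vectors and operators are \<^typ>\<open>real Matrix.vec\<close> and \<^typ>\<open>real mat\<close>; points
  of the plane and the tensors of elasticity are \<^typ>\<open>real^2\<close> and \<^typ>\<open>real^2^2\<close>, on which
  \<^const>\<open>inner\<close> is the Frobenius product.\<close>

definition kron :: "real mat \<Rightarrow> real mat \<Rightarrow> real mat" (infixl \<open>\<otimes>\<^sub>k\<close> 75) where
  "A \<otimes>\<^sub>k B = mat (dim_row A * dim_row B) (dim_col A * dim_col B)
     (\<lambda>(i, j). A $$ (i div dim_row B, j div dim_col B) * B $$ (i mod dim_row B, j mod dim_col B))"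

definition sym_psd :: "nat \<Rightarrow> real mat \<Rightarrow> bool" where
  "sym_psd N A \<longleftrightarrow> A \<in> carrier_mat N N \<and> transpose_mat A = A
     \<and> (\<forall>x\<in>carrier_vec N. 0 \<le> x \<bullet>\<^sub>v (A *\<^sub>v x))"

definition quad_form :: "real mat \<Rightarrow> real vec \<Rightarrow> real" where
  "quad_form A x = x \<bullet>\<^sub>v (A *\<^sub>v x)"

abbreviation minv :: "real mat \<Rightarrow> real mat" where
  "minv A \<equiv> the (mat_inverse A)"

definition B_first :: "nat \<Rightarrow> real mat" where
  "B_first N = mat N N (\<lambda>(i, j). if i = 0 \<and> j = 0 then 1 else 0)"

definition B_last :: "nat \<Rightarrow> real mat" where
  "B_last N = mat N N (\<lambda>(i, j). if i = N - 1 \<and> j = N - 1 then 1 else 0)"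

definition B_both :: "nat \<Rightarrow> real mat" where
  "B_both N = B_last N - B_first N"

record sbp_ops =
  quadH :: "real mat"
  opD1 :: "real mat"
  opD2 :: "real mat"
  opA :: "real mat"     \<comment> \<open>the matrices \<open>A\<close>, \<open>S\<close> in \<open>D\<^sub>2 = H\<^sup>-\<^sup>1(-A + BS)\<close>\<close>
  opS :: "real mat"

text \<open>As usual for SBP operators, order \<open>2p\<close> and the narrow stencil (half-width \<open>p\<close>) refer to
  the rows away from the \<open>s\<close> boundary rows at each end; the boundary closures are less accurate.\<close>

definition fd_order :: "nat \<Rightarrow> nat \<Rightarrow> real \<Rightarrow> sbp_ops \<Rightarrow> bool" where
  "fd_order p N h F \<longleftrightarrow> (\<exists>s. 2 * s < N \<and> (\<forall>i. s \<le> i \<and> i + s < N \<longrightarrow>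
      (\<forall>j<N. j + p < i \<or> i + p < j \<longrightarrow> opD1 F $$ (i, j) = 0 \<and> opD2 F $$ (i, j) = 0) \<and>
      (\<forall>k\<le>2 * p. (\<Sum>j<N. opD1 F $$ (i, j) * (real j * h) ^ k)
          = real k * (real i * h) ^ (k - 1)) \<and>
      (\<forall>k\<le>2 * p + 1. (\<Sum>j<N. opD2 F $$ (i, j) * (real j * h) ^ k)
          = real k * (real k - 1) * (real i * h) ^ (k - 2))))"

definition boundary_derivative :: "nat \<Rightarrow> real \<Rightarrow> real mat \<Rightarrow> bool" where
  "boundary_derivative N h S \<longleftrightarrow> S \<in> carrier_mat N N \<and> (\<forall>i\<in>{0, N - 1}.
      (\<Sum>j<N. S $$ (i, j)) = 0 \<and> (\<Sum>j<N. S $$ (i, j) * (real j * h)) = 1)"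

definition sbp_property :: "nat \<Rightarrow> nat \<Rightarrow> real \<Rightarrow> sbp_ops \<Rightarrow> bool" where
  "sbp_property p N h F \<longleftrightarrow>
     quadH F \<in> carrier_mat N N \<and> diagonal_mat (quadH F) \<and> (\<forall>i<N. 0 < quadH F $$ (i, i)) \<and>
     opD1 F \<in> carrier_mat N N \<and> opD2 F \<in> carrier_mat N N \<and> fd_order p N h F \<and>
     quadH F * opD1 F + transpose_mat (quadH F * opD1 F) = B_both N \<and>
     sym_psd N (opA F) \<and> boundary_derivative N h (opS F) \<and>
     opD2 F = minv (quadH F) * (- opA F + B_both N * opS F)"

text \<open>Compatibility concerns the interior part \<open>A\<close> only; full compatibility also replaces the
  boundary derivative \<open>S\<close> by \<open>D\<^sub>1\<close>.\<close>

definition compatible :: "nat \<Rightarrow> sbp_ops \<Rightarrow> bool" where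
  "compatible N F \<longleftrightarrow> (\<exists>R. sym_psd N R \<and> opA F = transpose_mat (opD1 F) * quadH F * opD1 F + R)"

definition fully_compatible :: "nat \<Rightarrow> sbp_ops \<Rightarrow> bool" where
  "fully_compatible N F \<longleftrightarrow> (\<exists>R. sym_psd N R \<and>
     opD2 F = minv (quadH F)
       * (- (transpose_mat (opD1 F) * quadH F * opD1 F) - R + B_both N * opD1 F))"

record fd_dg =
  rho_u :: real  mu_u :: real  lam_u :: real
  rho_v :: real  mu_v :: real  lam_v :: real
  x_W :: real  x_E :: real  y_Gam :: real  y_N :: real  \<comment> \<open>sides of the rectangle \<open>\<Omega>\<^sub>u\<close>\<close>
  grid_m :: nat  grid_n :: nat  sbp_p :: nat            \<comment> \<open>SBP operators of order \<open>2p\<close>\<close>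
  sbp_x :: sbp_ops  sbp_y :: sbp_ops
  Omega_v :: "(real^2) set"
  mesh :: "(real^2) set set"
  deg_q :: nat
  N_v :: nat
  elt :: "nat \<Rightarrow> (real^2) set"           \<comment> \<open>element, node and shape function of a DG\<close>
  node :: "nat \<Rightarrow> real^2"                 \<comment> \<open>degree of freedom \<open>j < N\<^sub>v\<close>\<close>
  shape :: "nat \<Rightarrow> real^2 \<Rightarrow> real"
  Pg_u2v :: "real mat"  Pb_u2v :: "real mat"  Pg_v2u :: "real mat"  Pb_v2u :: "real mat"
  chi1 :: real  chi2 :: real
  alpha_u :: real  alpha_v :: real  beta_u :: real  beta_v :: real

definition N_u :: "fd_dg \<Rightarrow> nat" where "N_u S = grid_m S * grid_n S"

definition h_u :: "fd_dg \<Rightarrow> real" where "h_u S = (x_E S - x_W S) / real (grid_m S - 1)"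

definition h_y :: "fd_dg \<Rightarrow> real" where "h_y S = (y_N S - y_Gam S) / real (grid_n S - 1)"

definition h_v :: "fd_dg \<Rightarrow> real" where "h_v S = Min (diameter ` mesh S)"

definition Omega_u :: "fd_dg \<Rightarrow> (real^2) set" where
  "Omega_u S = {x. x_W S \<le> x $h 1 \<and> x $h 1 \<le> x_E S \<and> y_Gam S \<le> x $h 2 \<and> x $h 2 \<le> y_N S}"

definition Gam :: "fd_dg \<Rightarrow> (real^2) set" where
  "Gam S = frontier (Omega_u S) \<inter> frontier (Omega_v S)"

definition geometry :: "fd_dg \<Rightarrow> bool" where
  "geometry S \<longleftrightarrow> x_W S < x_E S \<and> y_Gam S < y_N S \<and>
     Omega_v S \<subseteq> {x. x $h 2 \<le> y_Gam S} \<and>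
     Gam S = {x. x_W S \<le> x $h 1 \<and> x $h 1 \<le> x_E S \<and> x $h 2 = y_Gam S}"

definition fd_setting :: "fd_dg \<Rightarrow> bool" where
  "fd_setting S \<longleftrightarrow> 1 \<le> sbp_p S \<and> 2 \<le> grid_m S \<and> 2 \<le> grid_n S \<and>
     sbp_property (sbp_p S) (grid_m S) (h_u S) (sbp_x S) \<and>
     sbp_property (sbp_p S) (grid_n S) (h_y S) (sbp_y S)"

text \<open>A grid vector has the entry of component \<open>c \<in> {0, 1}\<close> at the grid point \<open>(i, j)\<close> in
  position \<open>c m n + i n + j\<close>; the points \<open>j = 0\<close> lie on \<open>\<Gamma>\<close>.\<close>

definition full_x :: "fd_dg \<Rightarrow> real mat \<Rightarrow> real mat" where
  "full_x S F = 1\<^sub>m 2 \<otimes>\<^sub>k F \<otimes>\<^sub>k 1\<^sub>m (grid_n S)"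

definition full_y :: "fd_dg \<Rightarrow> real mat \<Rightarrow> real mat" where
  "full_y S F = 1\<^sub>m 2 \<otimes>\<^sub>k 1\<^sub>m (grid_m S) \<otimes>\<^sub>k F"

definition Dx :: "fd_dg \<Rightarrow> real mat" where "Dx S = full_x S (opD1 (sbp_x S))"
definition Dxx :: "fd_dg \<Rightarrow> real mat" where "Dxx S = full_x S (opD2 (sbp_x S))"
definition Hx :: "fd_dg \<Rightarrow> real mat" where "Hx S = full_x S (quadH (sbp_x S))"
definition Dy :: "fd_dg \<Rightarrow> real mat" where "Dy S = full_y S (opD1 (sbp_y S))"
definition Dyy :: "fd_dg \<Rightarrow> real mat" where "Dyy S = full_y S (opD2 (sbp_y S))"
definition Hy :: "fd_dg \<Rightarrow> real mat" where "Hy S = full_y S (quadH (sbp_y S))"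
definition Dxy :: "fd_dg \<Rightarrow> real mat" where "Dxy S = Dx S * Dy S"
definition Hfull :: "fd_dg \<Rightarrow> real mat" where "Hfull S = Hx S * Hy S"
definition BGam :: "fd_dg \<Rightarrow> real mat" where "BGam S = full_y S (B_first (grid_n S))"

abbreviation I_u :: "fd_dg \<Rightarrow> real mat" where
  "I_u S \<equiv> 1\<^sub>m (grid_m S) \<otimes>\<^sub>k 1\<^sub>m (grid_n S)"

abbreviation O_u :: "fd_dg \<Rightarrow> real mat" where
  "O_u S \<equiv> 0\<^sub>m (N_u S) (N_u S)"

definition L1 :: "fd_dg \<Rightarrow> real mat" where
  "L1 S = four_block_mat ((2 * mu_u S + lam_u S) \<cdot>\<^sub>m I_u S) (O_u S) (O_u S) (mu_u S \<cdot>\<^sub>m I_u S)"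

definition L2 :: "fd_dg \<Rightarrow> real mat" where
  "L2 S = four_block_mat (O_u S) (lam_u S \<cdot>\<^sub>m I_u S) (mu_u S \<cdot>\<^sub>m I_u S) (O_u S)"

definition L3 :: "fd_dg \<Rightarrow> real mat" where
  "L3 S = four_block_mat (mu_u S \<cdot>\<^sub>m I_u S) (O_u S) (O_u S) ((2 * mu_u S + lam_u S) \<cdot>\<^sub>m I_u S)"

definition Ty :: "fd_dg \<Rightarrow> real mat" where
  "Ty S = L3 S * Dy S + transpose_mat (L2 S) * Dx S"

definition Tu :: "fd_dg \<Rightarrow> real mat" where
  "Tu S = - (BGam S * Ty S)"

text \<open>The traction-free condition on \<open>\<partial>\<Omega>\<^sub>u - \<Gamma>\<close> is imposed by the usual penalty terms, i.e. minus
  the discrete outward traction on the eastern and western sides (\<open>\<plusminus>Tx\<close>, with the boundary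
  derivative \<open>S\<close> of \<open>D\<^sub>x\<^sub>x\<close>) and on the northern side (\<open>Ty\<close>), weighted by the boundary
  quadrature. They are what makes the boundary terms of these sides drop out of the energy
  balance.\<close>

definition Tx :: "fd_dg \<Rightarrow> real mat" where
  "Tx S = L1 S * full_x S (opS (sbp_x S)) + L2 S * Dy S"

definition outer_penalty :: "fd_dg \<Rightarrow> real mat" where
  "outer_penalty S = - (full_x S (B_both (grid_m S)) * Hy S * Tx S
     + full_y S (B_last (grid_n S)) * Hx S * Ty S)"

definition triangle_mesh :: "fd_dg \<Rightarrow> bool" where
  "triangle_mesh S \<longleftrightarrow> triangulation (mesh S) \<and> (\<forall>K\<in>mesh S. 2 simplex K) \<and> \<Union>(mesh S) = Omega_v S"

text \<open>Every element contains a disc whose diameter is comparable to the largest element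
  diameter; \<open>\<kappa>\<close> measures the quality of the triangulation.\<close>

definition quasi_uniform :: "real \<Rightarrow> (real^2) set set \<Rightarrow> bool" where
  "quasi_uniform \<kappa> \<K> \<longleftrightarrow>
     (\<forall>K\<in>\<K>. \<forall>K'\<in>\<K>. \<exists>x r. 0 < r \<and> cball x r \<subseteq> K \<and> diameter K' \<le> \<kappa> * (2 * r))"

definition edges_Gam :: "fd_dg \<Rightarrow> (real^2) set set" where
  "edges_Gam S = {\<gamma>. (\<exists>K\<in>mesh S. \<gamma> edge_of K) \<and> \<gamma> \<subseteq> Gam S}"

text \<open>\<open>\<Gamma>\<close> is part of the boundary of \<open>\<Omega>\<^sub>v\<close>, so an edge on it belongs to one element only.\<close>

definition elt_at :: "fd_dg \<Rightarrow> (real^2) set \<Rightarrow> (real^2) set" where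
  "elt_at S \<gamma> = (THE K. K \<in> mesh S \<and> \<gamma> edge_of K)"

definition poly_le :: "nat \<Rightarrow> (real^2 \<Rightarrow> real) \<Rightarrow> bool" where
  "poly_le q f \<longleftrightarrow> (\<exists>a. \<forall>x. f x = (\<Sum>i\<le>q. \<Sum>j\<le>q - i. a i j * (x $h 1) ^ i * (x $h 2) ^ j))"

text \<open>Lagrange elements: \<open>dim P\<^sub>q = (q + 1)(q + 2) / 2\<close> nodes per element, of which \<open>q + 1\<close> lie on
  each edge, so that traces on an edge are determined by the nodal values on that edge.\<close>

definition nodal_basis :: "fd_dg \<Rightarrow> bool" where
  "nodal_basis S \<longleftrightarrow> 1 \<le> deg_q S \<and>
     (\<forall>j<N_v S. elt S j \<in> mesh S \<and> node S j \<in> elt S j \<and> poly_le (deg_q S) (shape S j)) \<and>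
     (\<forall>j<N_v S. \<forall>k<N_v S. elt S j = elt S k \<longrightarrow> shape S j (node S k) = (if j = k then 1 else 0)) \<and>
     (\<forall>K\<in>mesh S. 2 * card {j. j < N_v S \<and> elt S j = K} = (deg_q S + 1) * (deg_q S + 2) \<and>
        (\<forall>\<gamma>. \<gamma> edge_of K \<longrightarrow> card {j. j < N_v S \<and> elt S j = K \<and> node S j \<in> \<gamma>} = deg_q S + 1))"

definition dg_setting :: "fd_dg \<Rightarrow> bool" where
  "dg_setting S \<longleftrightarrow> triangle_mesh S \<and> \<Union>(edges_Gam S) = Gam S \<and> nodal_basis S"

text \<open>A vector in \<open>\<real>\<^bsup>2N\<^sub>v\<^esup>\<close> is a DG function through its nodal values, the value of component
  \<open>c \<in> {0, 1}\<close> at node \<open>j\<close> being in position \<open>c N\<^sub>v + j\<close>. The function \<open>dg_fun S v K\<close> is the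
  polynomial to which it restricts on \<open>K\<close>.\<close>

definition dg_fun :: "fd_dg \<Rightarrow> real vec \<Rightarrow> (real^2) set \<Rightarrow> real^2 \<Rightarrow> real^2" where
  "dg_fun S v K x = (\<Sum>j | j < N_v S \<and> elt S j = K.
     shape S j x *\<^sub>R vector [v $ j, v $ (N_v S + j)])"

definition dg_grad :: "fd_dg \<Rightarrow> real vec \<Rightarrow> (real^2) set \<Rightarrow> real^2 \<Rightarrow> real^2^2" where
  "dg_grad S v K x = jacobian (dg_fun S v K) (at x)"

definition dg_div :: "fd_dg \<Rightarrow> real vec \<Rightarrow> (real^2) set \<Rightarrow> real^2 \<Rightarrow> real" where
  "dg_div S v K x = trace (dg_grad S v K x)"

definition dg_strain :: "fd_dg \<Rightarrow> real vec \<Rightarrow> (real^2) set \<Rightarrow> real^2 \<Rightarrow> real^2^2" where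
  "dg_strain S v K x = (1 / 2) *\<^sub>R (dg_grad S v K x + transpose (dg_grad S v K x))"

definition dg_stress :: "fd_dg \<Rightarrow> real vec \<Rightarrow> (real^2) set \<Rightarrow> real^2 \<Rightarrow> real^2^2" where
  "dg_stress S v K x = (2 * mu_v S) *\<^sub>R dg_strain S v K x
     + (lam_v S * dg_div S v K x) *\<^sub>R Finite_Cartesian_Product.mat 1"

definition inner_Omega_v ::
    "fd_dg \<Rightarrow> ((real^2) set \<Rightarrow> real^2 \<Rightarrow> 'a::real_inner) \<Rightarrow> ((real^2) set \<Rightarrow> real^2 \<Rightarrow> 'a) \<Rightarrow> real" where
  "inner_Omega_v S f g = (\<Sum>K\<in>mesh S. integral K (\<lambda>x. inner (f K x) (g K x)))"

text \<open>Edges on \<open>\<Gamma>\<close> are horizontal, so that \<open>x\<^sub>1\<close> is the arc length.\<close>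

definition inner_edge :: "fd_dg \<Rightarrow> (real^2) set \<Rightarrow> (real^2 \<Rightarrow> 'a::real_inner) \<Rightarrow> (real^2 \<Rightarrow> 'a) \<Rightarrow> real" where
  "inner_edge S \<gamma> f g = integral ((\<lambda>x. x $h 1) ` \<gamma>)
     (\<lambda>s. inner (f (vector [s, y_Gam S])) (g (vector [s, y_Gam S])))"

definition dg_trace :: "fd_dg \<Rightarrow> (real^2) set \<Rightarrow> real vec \<Rightarrow> real^2 \<Rightarrow> real^2" where
  "dg_trace S \<gamma> v = dg_fun S v (elt_at S \<gamma>)"

definition dg_traction :: "fd_dg \<Rightarrow> (real^2) set \<Rightarrow> real vec \<Rightarrow> real^2 \<Rightarrow> real^2" where
  "dg_traction S \<gamma> v x = dg_stress S v (elt_at S \<gamma>) x *v vector [0, 1]"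

text \<open>An interface degree of freedom belongs to a node on an edge of its own element lying on
  \<open>\<Gamma>\<close>; a node of an element that meets \<open>\<Gamma>\<close> in a single vertex is not one.\<close>

definition edge_dofs :: "fd_dg \<Rightarrow> (real^2) set \<Rightarrow> nat set" where
  "edge_dofs S \<gamma> = {j. j < N_v S \<and> elt S j = elt_at S \<gamma> \<and> node S j \<in> \<gamma>}"

definition interface_dofs :: "fd_dg \<Rightarrow> nat set" where
  "interface_dofs S = (\<Union>\<gamma>\<in>edges_Gam S. edge_dofs S \<gamma>)"

definition restrict_Gam :: "fd_dg \<Rightarrow> real vec \<Rightarrow> real vec" where
  "restrict_Gam S v = Matrix.vec (2 * N_v S)
     (\<lambda>k. if k mod N_v S \<in> interface_dofs S then v $ k else 0)"

definition edge_poly :: "fd_dg \<Rightarrow> (real^2) set \<Rightarrow> real vec \<Rightarrow> real^2 \<Rightarrow> real^2" where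
  "edge_poly S \<gamma> c x = (\<Sum>j\<in>edge_dofs S \<gamma>. shape S j x *\<^sub>R vector [c $ j, c $ (N_v S + j)])"

definition Tv :: "fd_dg \<Rightarrow> real vec \<Rightarrow> real vec" where
  "Tv S v = Matrix.vec (2 * N_v S) (\<lambda>k. let j = k mod N_v S in
     if j \<in> interface_dofs S
     then (dg_stress S v (elt S j) (node S j) *v vector [0, 1]) $h (if k < N_v S then 1 else 2)
     else 0)"

definition M_Gam :: "fd_dg \<Rightarrow> real mat" where
  "M_Gam S = Matrix.mat (N_v S) (N_v S) (\<lambda>(i, j). \<Sum>\<gamma>\<in>edges_Gam S.
     if i \<in> edge_dofs S \<gamma> \<and> j \<in> edge_dofs S \<gamma> then inner_edge S \<gamma> (shape S i) (shape S j) else 0)"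

definition MGam :: "fd_dg \<Rightarrow> real mat" where
  "MGam S = 1\<^sub>m 2 \<otimes>\<^sub>k M_Gam S"

text \<open>The matrices vanish outside the interface degrees of freedom of both sides, i.e. they are
  embeddings of arbitrary one-dimensional projection matrices \<open>\<Pi>\<close>.\<close>

definition embedded_u2v :: "fd_dg \<Rightarrow> real mat \<Rightarrow> bool" where
  "embedded_u2v S P \<longleftrightarrow> P \<in> carrier_mat (N_v S) (N_u S) \<and> (\<forall>k<N_v S. \<forall>l<N_u S.
     P $$ (k, l) \<noteq> 0 \<longrightarrow> k \<in> interface_dofs S \<and> l mod grid_n S = 0)"

definition embedded_v2u :: "fd_dg \<Rightarrow> real mat \<Rightarrow> bool" where
  "embedded_v2u S P \<longleftrightarrow> P \<in> carrier_mat (N_u S) (N_v S) \<and> (\<forall>l<N_u S. \<forall>k<N_v S.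
     P $$ (l, k) \<noteq> 0 \<longrightarrow> k \<in> interface_dofs S \<and> l mod grid_n S = 0)"

definition projections :: "fd_dg \<Rightarrow> bool" where
  "projections S \<longleftrightarrow> embedded_u2v S (Pg_u2v S) \<and> embedded_u2v S (Pb_u2v S)
     \<and> embedded_v2u S (Pg_v2u S) \<and> embedded_v2u S (Pb_v2u S)"

definition PPg_u2v :: "fd_dg \<Rightarrow> real mat" where "PPg_u2v S = 1\<^sub>m 2 \<otimes>\<^sub>k Pg_u2v S"
definition PPb_u2v :: "fd_dg \<Rightarrow> real mat" where "PPb_u2v S = 1\<^sub>m 2 \<otimes>\<^sub>k Pb_u2v S"
definition PPg_v2u :: "fd_dg \<Rightarrow> real mat" where "PPg_v2u S = 1\<^sub>m 2 \<otimes>\<^sub>k Pg_v2u S"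
definition PPb_v2u :: "fd_dg \<Rightarrow> real mat" where "PPb_v2u S = 1\<^sub>m 2 \<otimes>\<^sub>k Pb_v2u S"

definition norm_compatible :: "fd_dg \<Rightarrow> bool" where
  "norm_compatible S \<longleftrightarrow>
     MGam S * PPg_u2v S = transpose_mat (Hx S * PPb_v2u S) \<and>
     MGam S * PPb_u2v S = transpose_mat (Hx S * PPg_v2u S)"

definition coupled_setting :: "fd_dg \<Rightarrow> bool" where
  "coupled_setting S \<longleftrightarrow> geometry S \<and> fd_setting S \<and> dg_setting S \<and> projections S"

definition fd_rhs :: "fd_dg \<Rightarrow> real vec \<Rightarrow> real vec \<Rightarrow> real vec" where
  "fd_rhs S u v =
    (let uG = BGam S *\<^sub>v u; vG = restrict_Gam S v; Hinv = minv (Hfull S) in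
       (L1 S * Dxx S) *\<^sub>v u + (L3 S * Dyy S) *\<^sub>v u
         + ((L2 S + transpose_mat (L2 S)) * Dxy S) *\<^sub>v u
       + Hinv *\<^sub>v (outer_penalty S *\<^sub>v u)
       + Hinv *\<^sub>v ((- (1 / 2)) \<cdot>\<^sub>v ((BGam S * Hx S) *\<^sub>v (Tu S *\<^sub>v u + PPb_v2u S *\<^sub>v Tv S v))
            + (1 / 2) \<cdot>\<^sub>v ((transpose_mat (Tu S) * Hx S) *\<^sub>v (uG - PPg_v2u S *\<^sub>v vG)))
       - Hinv *\<^sub>v ((chi1 S * alpha_u S / h_v S) \<cdot>\<^sub>v
                 ((BGam S * Hx S * PPb_v2u S) *\<^sub>v (PPg_u2v S *\<^sub>v uG - vG))
            + (chi2 S * beta_u S / h_u S) \<cdot>\<^sub>v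
                 ((BGam S * Hx S) *\<^sub>v (uG - PPg_v2u S *\<^sub>v vG))))"

definition dg_rhs :: "fd_dg \<Rightarrow> real vec \<Rightarrow> real vec \<Rightarrow> real vec \<Rightarrow> real" where
  "dg_rhs S u v \<phi> =
    (let uG = BGam S *\<^sub>v u; vG = restrict_Gam S v in
       - lam_v S * inner_Omega_v S (dg_div S v) (dg_div S \<phi>)
       - 2 * mu_v S * inner_Omega_v S (dg_strain S v) (dg_strain S \<phi>)
       + 1 / 2 * (\<Sum>\<gamma>\<in>edges_Gam S. inner_edge S \<gamma>
            (\<lambda>x. dg_trace S \<gamma> v x - edge_poly S \<gamma> (PPg_u2v S *\<^sub>v uG) x) (dg_traction S \<gamma> \<phi>))
       + 1 / 2 * (\<Sum>\<gamma>\<in>edges_Gam S. inner_edge S \<gamma>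
            (\<lambda>x. dg_traction S \<gamma> v x - edge_poly S \<gamma> (PPb_u2v S *\<^sub>v (Tu S *\<^sub>v u)) x)
            (dg_trace S \<gamma> \<phi>))
       - chi1 S * alpha_v S / h_v S * (\<Sum>\<gamma>\<in>edges_Gam S. inner_edge S \<gamma>
            (\<lambda>x. dg_trace S \<gamma> v x - edge_poly S \<gamma> (PPg_u2v S *\<^sub>v uG) x) (dg_trace S \<gamma> \<phi>))
       - chi2 S * beta_v S / h_u S * (\<Sum>\<gamma>\<in>edges_Gam S. inner_edge S \<gamma>
            (\<lambda>x. edge_poly S \<gamma> (PPb_u2v S *\<^sub>v (PPg_v2u S *\<^sub>v vG)) x
                 - edge_poly S \<gamma> (PPb_u2v S *\<^sub>v uG) x) (dg_trace S \<gamma> \<phi>)))"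

text \<open>\<open>f'\<close> is the time derivative of the \<open>\<real>\<^sup>N\<close>-valued function \<open>f\<close> on \<open>(0, T]\<close>.\<close>

definition time_deriv :: "nat \<Rightarrow> real \<Rightarrow> (real \<Rightarrow> real vec) \<Rightarrow> (real \<Rightarrow> real vec) \<Rightarrow> bool" where
  "time_deriv N T f f' \<longleftrightarrow> (\<forall>t\<in>{0<..T}. f t \<in> carrier_vec N \<and> f' t \<in> carrier_vec N \<and>
     (\<forall>i<N. ((\<lambda>s. f s $ i) has_real_derivative f' t $ i) (at t within {0<..T})))"

definition solution :: "fd_dg \<Rightarrow> real \<Rightarrow> (real \<Rightarrow> real vec) \<Rightarrow> (real \<Rightarrow> real vec) \<Rightarrow> (real \<Rightarrow> real vec)
    \<Rightarrow> (real \<Rightarrow> real vec) \<Rightarrow> (real \<Rightarrow> real vec) \<Rightarrow> (real \<Rightarrow> real vec) \<Rightarrow> bool" where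
  "solution S T u ut utt v vt vtt \<longleftrightarrow>
     time_deriv (2 * N_u S) T u ut \<and> time_deriv (2 * N_u S) T ut utt \<and>
     time_deriv (2 * N_v S) T v vt \<and> time_deriv (2 * N_v S) T vt vtt \<and>
     (\<forall>t\<in>{0<..T}. rho_u S \<cdot>\<^sub>v utt t = fd_rhs S (u t) (v t) \<and>
        (\<forall>\<phi>\<in>carrier_vec (2 * N_v S).
           rho_v S * inner_Omega_v S (dg_fun S (vtt t)) (dg_fun S \<phi>) = dg_rhs S (u t) (v t) \<phi>))"

definition energy_conserving :: "fd_dg \<Rightarrow> bool" where
  "energy_conserving S \<longleftrightarrow> (\<exists>Q. sym_psd (2 * N_u S + 2 * N_v S) Q \<and>
     (\<forall>T>0. \<forall>u ut utt v vt vtt. solution S T u ut utt v vt vtt \<longrightarrow>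
       (\<forall>t\<in>{0<..T}.
         ((\<lambda>s. rho_u S * quad_form (Hfull S) (ut s)
             + rho_v S * inner_Omega_v S (dg_fun S (vt s)) (dg_fun S (vt s))
             + quad_form Q (u s @\<^sub>v v s)) has_real_derivative 0) (at t within {0<..T}))))"

end

theory Submission
  imports Defs
begin

text \<open>
  Testing the finite difference equations with \<open>\<H>u\<^sub>t\<close> and the DG equations with \<open>v\<^sub>t\<close> turns the
  scheme into one weak form. Its right-hand side is \<open>- a((u, v), (u\<^sub>t, v\<^sub>t))\<close> for a form \<open>a\<close> that is
  symmetric (\<open>coupled_weak_form\<close>), so twice the kinetic energy plus \<open>a((u, v), (u, v))\<close> has derivative
  zero. The rest of the work is to see why \<open>a\<close> is symmetric, and why it is non-negative for large penalties.

  Symmetry has three sources. Summation by parts in each direction (\<open>fd_interior_form\<close>) reduces the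
  difference operators to the symmetric elastic energy plus boundary terms; those on the outer sides
  cancel against the penalties for the traction-free condition, and on \<open>\<Gamma>\<close> there remains the work of
  the discrete traction. Traces of DG functions and their tractions on an edge are polynomials
  of degree at most \<open>q\<close>, which the \<open>q + 1\<close> nodes on the edge determine; hence every edge integral of
  the DG scheme is a product of nodal vectors with the mass matrix \<open>\<M>\<^sub>\<Gamma>\<close> (\<open>MGam_form\<close>). Finally, norm
  compatibility makes each projection the adjoint of the opposite one with respect to \<open>\<H>\<^sub>x\<close> and
  \<open>\<M>\<^sub>\<Gamma>\<close> (\<open>norm_compatible_forms\<close>), so that the flux and penalty terms of the two schemes are
  transposes of each other.

  For the sign, \<open>a((u, v), (u, v))\<close> splits into a finite difference and a DG part, each of the form
  bulk energy minus (jump, traction) plus a multiple of (jump, jump). Completing the square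
  (\<open>penalty_absorbs_flux\<close>) leaves the task of bounding the squared traction on \<open>\<Gamma>\<close> by the bulk energy.
  Pointwise the squared traction is at most \<open>2\<mu> + \<lambda>\<close> times the energy density. On the grid, the
  energy in the first grid line, which carries the weight \<open>\<H>\<^sub>y(0, 0)\<close>, is part of the whole, and this
  gives \<open>C' = \<H>\<^sub>y(0, 0) / h\<^sub>u\<close> (\<open>fd_traction_bound\<close>). In the DG space, an inverse trace inequality on
  each element (\<open>trace_inequality\<close>) gives \<open>C = 1 / (c \<kappa>)\<close> with \<open>c\<close> depending on \<open>q\<close> only
  (\<open>dg_traction_energy_bound\<close>).
\<close>

section \<open>Symmetric bilinear forms on coefficient vectors\<close>

text \<open>Vectors of all dimensions share one type, so linearity can only be asked for on the carrier of one
dimension.\<close>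

definition sym_bilinear :: "nat \<Rightarrow> (real vec \<Rightarrow> real vec \<Rightarrow> real) \<Rightarrow> bool" where
  "sym_bilinear n b \<longleftrightarrow>
     (\<forall>x\<in>carrier_vec n. \<forall>y\<in>carrier_vec n. b x y = b y x) \<and>
     (\<forall>x\<in>carrier_vec n. \<forall>y\<in>carrier_vec n. \<forall>z\<in>carrier_vec n. b (x + y) z = b x z + b y z) \<and>
     (\<forall>r. \<forall>x\<in>carrier_vec n. \<forall>z\<in>carrier_vec n. b (r \<cdot>\<^sub>v x) z = r * b x z)"

definition lin_map :: "nat \<Rightarrow> nat \<Rightarrow> (real vec \<Rightarrow> real vec) \<Rightarrow> bool" where
  "lin_map n k L \<longleftrightarrow> (\<forall>x\<in>carrier_vec n. L x \<in> carrier_vec k) \<and>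
     (\<forall>x\<in>carrier_vec n. \<forall>y\<in>carrier_vec n. L (x + y) = L x + L y) \<and>
     (\<forall>r. \<forall>x\<in>carrier_vec n. L (r \<cdot>\<^sub>v x) = r \<cdot>\<^sub>v L x)"

lemma linear_functional_expansion:
  fixes g :: "real vec \<Rightarrow> real"
  assumes add: "\<And>x y. x \<in> carrier_vec n \<Longrightarrow> y \<in> carrier_vec n \<Longrightarrow> g (x + y) = g x + g y"
    and smult: "\<And>r x. x \<in> carrier_vec n \<Longrightarrow> g (r \<cdot>\<^sub>v x) = r * g x"
    and x: "x \<in> carrier_vec n"
  shows "g x = (\<Sum>i<n. x $ i * g (unit_vec n i))"
proof -
  let ?t = "\<lambda>k. Matrix.vec n (\<lambda>i. if i < k then x $ i else 0)"
  have "g (?t k) = (\<Sum>i<k. x $ i * g (unit_vec n i))" if "k \<le> n" for k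
    using that
  proof (induction k)
    case 0
    have "?t 0 = 0 \<cdot>\<^sub>v unit_vec n 0" by auto
    with smult[of "unit_vec n 0" 0] show ?case by simp
  next
    case (Suc k)
    have "?t (Suc k) = ?t k + x $ k \<cdot>\<^sub>v unit_vec n k"
      by (rule eq_vecI) (auto simp: less_Suc_eq unit_vec_def)
    with Suc show ?case by (simp add: add smult)
  qed
  moreover have "?t n = x" using x by auto
  ultimately show ?thesis by (metis order_refl)
qed

lemma sym_bilinear_expansion:
  assumes b: "sym_bilinear n b" and x: "x \<in> carrier_vec n" and y: "y \<in> carrier_vec n"
  shows "b x y = (\<Sum>i<n. \<Sum>j<n. x $ i * y $ j * b (unit_vec n i) (unit_vec n j))"
proof -
  have "b x y = (\<Sum>i<n. x $ i * b (unit_vec n i) y)"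
    by (rule linear_functional_expansion[of n "\<lambda>x. b x y"])
      (use b x y in \<open>auto simp: sym_bilinear_def\<close>)
  also have "\<dots> = (\<Sum>i<n. x $ i * (\<Sum>j<n. y $ j * b (unit_vec n i) (unit_vec n j)))"
  proof (rule sum.cong[OF refl])
    fix i
    have sw: "b (unit_vec n i) z = b z (unit_vec n i)" if "z \<in> carrier_vec n" for z
      using b that by (auto simp: sym_bilinear_def)
    have "b y (unit_vec n i) = (\<Sum>j<n. y $ j * b (unit_vec n j) (unit_vec n i))"
      by (rule linear_functional_expansion[of n "\<lambda>y. b y (unit_vec n i)"])
        (use b y in \<open>auto simp: sym_bilinear_def\<close>)
    then show "x $ i * b (unit_vec n i) y
        = x $ i * (\<Sum>j<n. y $ j * b (unit_vec n i) (unit_vec n j))"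
      using sw[OF y] sw by simp
  qed
  finally show ?thesis by (simp add: sum_distrib_left mult.assoc)
qed

text \<open>The energy is assembled term by term as a bilinear form; its Gram matrix in the unit vectors
represents it as a quadratic form of the vector of all unknowns.\<close>

lemma sym_bilinear_matrix:
  assumes b: "sym_bilinear n b" and psd: "\<And>x. x \<in> carrier_vec n \<Longrightarrow> 0 \<le> b x x"
  obtains Q where "sym_psd n Q" "\<And>x. x \<in> carrier_vec n \<Longrightarrow> quad_form Q x = b x x"
proof -
  define Q where "Q = Matrix.mat n n (\<lambda>(i, j). b (unit_vec n i) (unit_vec n j))"
  have q: "quad_form Q x = b x x" if "x \<in> carrier_vec n" for x
    using that unfolding quad_form_def Q_def sym_bilinear_expansion[OF b that that]
    by (auto simp: scalar_prod_def sum_distrib_left atLeast0LessThan ac_simps intro!: sum.cong)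
  have "sym_psd n Q"
    unfolding sym_psd_def
  proof (intro conjI ballI)
    show "transpose_mat Q = Q"
      by (rule eq_matI) (use b in \<open>auto simp: Q_def sym_bilinear_def\<close>)
    show "0 \<le> x \<bullet>\<^sub>v (Q *\<^sub>v x)" if "x \<in> carrier_vec n" for x
      using q[OF that] psd[OF that] by (simp add: quad_form_def)
  qed (simp add: Q_def)
  with q show thesis using that by blast
qed

text \<open>A single product rule serves for kinetic and potential energy, since all of them are symmetric
forms evaluated on the diagonal.\<close>

lemma sym_bilinear_has_derivative:
  assumes b: "sym_bilinear n b" and f: "time_deriv n T f f'" and t: "t \<in> {0<..T}"
  shows "((\<lambda>s. b (f s) (f s)) has_real_derivative 2 * b (f t) (f' t)) (at t within {0<..T})"
proof -
  let ?c = "\<lambda>i j. b (unit_vec n i) (unit_vec n j)"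
  have c: "f s \<in> carrier_vec n" "f' s \<in> carrier_vec n" if "s \<in> {0<..T}" for s
    using f that by (auto simp: time_deriv_def)
  have d: "((\<lambda>s. f s $ i) has_real_derivative f' t $ i) (at t within {0<..T})" if "i < n" for i
    using f t that by (auto simp: time_deriv_def)
  have "((\<lambda>s. \<Sum>i<n. \<Sum>j<n. f s $ i * f s $ j * ?c i j) has_real_derivative
      (\<Sum>i<n. \<Sum>j<n. (f' t $ i * f t $ j + f' t $ j * f t $ i) * ?c i j)) (at t within {0<..T})"
    by (intro DERIV_sum DERIV_cmult_right DERIV_mult d) auto
  also have "(\<Sum>i<n. \<Sum>j<n. (f' t $ i * f t $ j + f' t $ j * f t $ i) * ?c i j)
      = (\<Sum>i<n. \<Sum>j<n. f' t $ i * f t $ j * ?c i j) + (\<Sum>i<n. \<Sum>j<n. f t $ i * f' t $ j * ?c i j)"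
    by (simp add: sum.distrib[symmetric] algebra_simps)
  also have "\<dots> = b (f' t) (f t) + b (f t) (f' t)"
    by (simp add: sym_bilinear_expansion[OF b] c[OF t])
  also have "\<dots> = 2 * b (f t) (f' t)"
    using b c[OF t] by (auto simp: sym_bilinear_def)
  finally have "((\<lambda>s. \<Sum>i<n. \<Sum>j<n. f s $ i * f s $ j * ?c i j) has_real_derivative
      2 * b (f t) (f' t)) (at t within {0<..T})" .
  then show ?thesis
    by (rule has_field_derivative_transform_within[where d = 1])
      (use t in \<open>auto simp: sym_bilinear_expansion[OF b] c\<close>)
qed

lemma sym_bilinear_add:
  "sym_bilinear n b \<Longrightarrow> sym_bilinear n c \<Longrightarrow> sym_bilinear n (\<lambda>x y. b x y + c x y)"
  by (auto simp: sym_bilinear_def algebra_simps)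

lemma sym_bilinear_scale: "sym_bilinear n b \<Longrightarrow> sym_bilinear n (\<lambda>x y. r * b x y)"
  by (auto simp: sym_bilinear_def algebra_simps)

lemma sym_bilinear_pullback:
  assumes "sym_bilinear k b" "lin_map n k L"
  shows "sym_bilinear n (\<lambda>x y. b (L x) (L y))"
  using assms by (auto simp: sym_bilinear_def lin_map_def)

lemma sym_bilinear_scalar_prod: "sym_bilinear n (\<lambda>x y. x \<bullet>\<^sub>v y)"
  by (auto simp: sym_bilinear_def add_scalar_prod_distrib[of _ n] intro: comm_scalar_prod)

text \<open>Consistency fluxes enter the energy in transposed pairs; each pair is symmetric although its members
are not.\<close>

lemma sym_bilinear_cross:
  assumes b: "sym_bilinear k b" and L: "lin_map n k L" and M: "lin_map n k M"
  shows "sym_bilinear n (\<lambda>x y. b (L x) (M y) + b (L y) (M x))"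
proof -
  have s: "b p q = b q p" if "p \<in> carrier_vec k" "q \<in> carrier_vec k" for p q
    using b that unfolding sym_bilinear_def by blast
  have add: "b (p + q) r = b p r + b q r" "b r (p + q) = b r p + b r q"
    if "p \<in> carrier_vec k" "q \<in> carrier_vec k" "r \<in> carrier_vec k" for p q r
  proof -
    show 1: "b (p + q) r = b p r + b q r"
      using b that unfolding sym_bilinear_def by blast
    show "b r (p + q) = b r p + b r q"
      using 1 s that by simp
  qed
  have smult: "b (t \<cdot>\<^sub>v p) r = t * b p r" "b r (t \<cdot>\<^sub>v p) = t * b r p"
    if "p \<in> carrier_vec k" "r \<in> carrier_vec k" for p r t
  proof -
    show 1: "b (t \<cdot>\<^sub>v p) r = t * b p r"
      using b that unfolding sym_bilinear_def by blast
    show "b r (t \<cdot>\<^sub>v p) = t * b r p"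
      using 1 s that by simp
  qed
  show ?thesis
    using L M unfolding sym_bilinear_def lin_map_def
    by (auto simp: add smult algebra_simps)
qed

lemma sym_bilinear_sum:
  assumes "\<And>a. a \<in> A \<Longrightarrow> sym_bilinear n (b a)"
  shows "sym_bilinear n (\<lambda>x y. \<Sum>a\<in>A. b a x y)"
  unfolding sym_bilinear_def
proof (intro conjI ballI allI)
  fix x y :: "real vec" and r
  assume xy: "x \<in> carrier_vec n" "y \<in> carrier_vec n"
  show "(\<Sum>a\<in>A. b a x y) = (\<Sum>a\<in>A. b a y x)"
    using assms xy by (intro sum.cong) (auto simp: sym_bilinear_def)
  show "(\<Sum>a\<in>A. b a (r \<cdot>\<^sub>v x) y) = r * (\<Sum>a\<in>A. b a x y)"
    unfolding sum_distrib_left using assms xy by (intro sum.cong) (unfold sym_bilinear_def, blast+)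
  fix z :: "real vec" assume z: "z \<in> carrier_vec n"
  show "(\<Sum>a\<in>A. b a (x + y) z) = (\<Sum>a\<in>A. b a x z) + (\<Sum>a\<in>A. b a y z)"
    unfolding sum.distrib[symmetric] using assms xy z
    by (intro sum.cong) (unfold sym_bilinear_def, blast+)
qed

lemma lin_map_comp: "lin_map n k L \<Longrightarrow> lin_map k l M \<Longrightarrow> lin_map n l (\<lambda>x. M (L x))"
  by (auto simp: lin_map_def)

lemma lin_map_mat: "A \<in> carrier_mat k n \<Longrightarrow> lin_map n k (\<lambda>x. A *\<^sub>v x)"
  by (auto simp: lin_map_def mult_add_distrib_mat_vec mult_mat_vec intro!: mult_mat_vec_carrier)

lemma lin_map_diff:
  assumes "lin_map n k L" "lin_map n k M"
  shows "lin_map n k (\<lambda>x. L x - M x)"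
proof -
  have "a + b - (c + d) = a - c + (b - d)"
    if "a \<in> carrier_vec k" "b \<in> carrier_vec k" "c \<in> carrier_vec k" "d \<in> carrier_vec k"
    for a b c d :: "real vec"
    using that by (intro eq_vecI) auto
  moreover have "r \<cdot>\<^sub>v a - r \<cdot>\<^sub>v c = r \<cdot>\<^sub>v (a - c)"
    if "a \<in> carrier_vec k" "c \<in> carrier_vec k" for r and a c :: "real vec"
    using that by (intro eq_vecI) (auto simp: algebra_simps)
  ultimately show ?thesis
    using assms by (auto simp: lin_map_def)
qed

lemma lin_map_first: "lin_map (n + k) n (\<lambda>x. vec_first x n)"
  and lin_map_last: "lin_map (n + k) k (\<lambda>x. vec_last x k)"
  by (auto simp: lin_map_def vec_first_def vec_last_def intro!: eq_vecI)

lemma append_parts: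
  "u \<in> carrier_vec n \<Longrightarrow> v \<in> carrier_vec k \<Longrightarrow> vec_first (u @\<^sub>v v) n = u"
  "u \<in> carrier_vec n \<Longrightarrow> v \<in> carrier_vec k \<Longrightarrow> vec_last (u @\<^sub>v v) k = v"
  by (auto simp: vec_first_def vec_last_def)

lemma time_deriv_append:
  assumes "time_deriv n T u ut" "time_deriv k T v vt"
  shows "time_deriv (n + k) T (\<lambda>s. u s @\<^sub>v v s) (\<lambda>s. ut s @\<^sub>v vt s)"
  unfolding time_deriv_def
proof (intro ballI conjI allI impI)
  fix t assume t: "t \<in> {0<..T}"
  have c: "u s \<in> carrier_vec n" "ut s \<in> carrier_vec n" "v s \<in> carrier_vec k" "vt s \<in> carrier_vec k"
    if "s \<in> {0<..T}" for s
    using assms that by (auto simp: time_deriv_def)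
  show "u t @\<^sub>v v t \<in> carrier_vec (n + k)" "ut t @\<^sub>v vt t \<in> carrier_vec (n + k)" using c[OF t] by auto
  fix i assume i: "i < n + k"
  have "((\<lambda>s. if i < n then u s $ i else v s $ (i - n)) has_real_derivative
      (if i < n then ut t $ i else vt t $ (i - n))) (at t within {0<..T})"
    using assms t i by (auto simp: time_deriv_def)
  then have "((\<lambda>s. (u s @\<^sub>v v s) $ i) has_real_derivative
      (if i < n then ut t $ i else vt t $ (i - n))) (at t within {0<..T})"
    by (rule has_field_derivative_transform_within[where d = 1])
      (use t c i in \<open>auto simp: carrier_vecD[OF c(1)] carrier_vecD[OF c(3)]\<close>)
  then show "((\<lambda>s. (u s @\<^sub>v v s) $ i) has_real_derivative (ut t @\<^sub>v vt t) $ i) (at t within {0<..T})"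
    using c[OF t] i by (cases "i < n") auto
qed

lemma sym_bilinear_diff:
  assumes b: "sym_bilinear n b" and x: "x \<in> carrier_vec n" "y \<in> carrier_vec n" "z \<in> carrier_vec n"
  shows "b (x - y) z = b x z - b y z" "b z (x - y) = b z x - b z y"
proof -
  have e: "x - y = x + (-1) \<cdot>\<^sub>v y" using x by (intro eq_vecI) auto
  have c: "(-1) \<cdot>\<^sub>v y \<in> carrier_vec n" using x by simp
  have "b (x + (-1) \<cdot>\<^sub>v y) z = b x z + b ((-1) \<cdot>\<^sub>v y) z"
    using b x c unfolding sym_bilinear_def by blast
  moreover have "b ((-1) \<cdot>\<^sub>v y) z = (-1) * b y z"
    using b x unfolding sym_bilinear_def by blast
  ultimately show 1: "b (x - y) z = b x z - b y z" unfolding e by simp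
  have s: "b z w = b w z" if "w \<in> carrier_vec n" for w
    using b x that unfolding sym_bilinear_def by blast
  show "b z (x - y) = b z x - b z y"
    using 1 s x by simp
qed

text \<open>With \<open>k = chi * alpha / h\<close>, evaluating the non-negative form at \<open>2 k x - y\<close> gives
\<open>b x y \<le> k * b x x + b y y / (4 k)\<close>. The lower bound on \<open>alpha\<close> is what makes the last summand at
most \<open>E\<close>.\<close>

lemma penalty_absorbs_flux:
  assumes b: "sym_bilinear n b" and psd: "\<And>x. x \<in> carrier_vec n \<Longrightarrow> 0 \<le> b x x"
    and x: "x \<in> carrier_vec n" and y: "y \<in> carrier_vec n"
    and pos: "0 < chi" "0 < h" "0 < g" and bulk: "g * b y y \<le> chi * E"
    and pen: "h / (4 * g) \<le> alpha"
  shows "0 \<le> E - b x y + chi * alpha / h * b x x"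
proof -
  have al: "0 < alpha" using pen pos by (intro less_le_trans[OF _ pen]) simp
  define k where "k = chi * alpha / h"
  have k: "0 < k" using al pos by (simp add: k_def)
  have c: "(2 * k) \<cdot>\<^sub>v x \<in> carrier_vec n" using x by simp
  have sc: "b ((2 * k) \<cdot>\<^sub>v x) z = 2 * k * b x z" "b z ((2 * k) \<cdot>\<^sub>v x) = 2 * k * b z x"
    if "z \<in> carrier_vec n" for z
  proof -
    show 1: "b ((2 * k) \<cdot>\<^sub>v x) z = 2 * k * b x z" using b x that unfolding sym_bilinear_def by blast
    have "b z w = b w z" if "w \<in> carrier_vec n" for w
      using b that \<open>z \<in> carrier_vec n\<close> unfolding sym_bilinear_def by blast
    then show "b z ((2 * k) \<cdot>\<^sub>v x) = 2 * k * b z x" using 1 x c by simp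
  qed
  have yx: "b y x = b x y" using b x y unfolding sym_bilinear_def by blast
  have "0 \<le> b ((2 * k) \<cdot>\<^sub>v x - y) ((2 * k) \<cdot>\<^sub>v x - y)" by (rule psd) (use c y in simp)
  also have "\<dots> = 4 * k * (k * b x x - b x y) + b y y"
    unfolding sym_bilinear_diff(1)[OF b c y minus_carrier_vec[OF c y]] sym_bilinear_diff(2)[OF b c y c]
      sym_bilinear_diff(2)[OF b c y y] sc(1)[OF c] sc(2)[OF x] sc(1)[OF y] sc(2)[OF y] yx
    by (simp add: algebra_simps)
  finally have "b x y - k * b x x \<le> b y y / (4 * k)"
    using k by (simp add: field_simps)
  also have "\<dots> \<le> E"
  proof -
    have "h \<le> 4 * alpha * g" using pen pos by (simp add: field_simps)
    then have "h * b y y \<le> 4 * alpha * g * b y y" using psd[OF y] by (rule mult_right_mono)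
    also have "\<dots> \<le> 4 * alpha * (chi * E)"
      using bulk al by (simp only: mult.assoc) (intro mult_left_mono; simp)
    finally show ?thesis using pos al by (simp add: k_def field_simps)
  qed
  finally show ?thesis by (simp add: k_def)
qed

section \<open>Polynomials along lines and an inverse trace inequality\<close>

text \<open>Only restrictions to lines matter below: interpolation along an edge, and extrapolation from the
interior of an element to its edge. In contrast to polynomials given by coefficients, sums and
derivatives stay in this class without any reindexing.\<close>

definition line_poly :: "nat \<Rightarrow> (real^2 \<Rightarrow> real) \<Rightarrow> bool" where
  "line_poly N f \<longleftrightarrow>
     (\<forall>X W. \<exists>p. degree p \<le> N \<and> (\<forall>t. f (X + t *\<^sub>R W) = poly p t))"

lemma line_poly_sum:
  assumes "finite A" "\<And>a. a \<in> A \<Longrightarrow> line_poly N (f a)"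
  shows "line_poly N (\<lambda>x. \<Sum>a\<in>A. f a x)"
  unfolding line_poly_def
proof (intro allI)
  fix X W
  have "\<forall>a\<in>A. \<exists>p. degree p \<le> N \<and> (\<forall>t. f a (X + t *\<^sub>R W) = poly p t)"
    using assms(2) by (auto simp: line_poly_def)
  then obtain p where "\<forall>a\<in>A. degree (p a) \<le> N \<and> (\<forall>t. f a (X + t *\<^sub>R W) = poly (p a) t)"
    by metis
  then show "\<exists>p. degree p \<le> N \<and> (\<forall>t. (\<Sum>a\<in>A. f a (X + t *\<^sub>R W)) = poly p t)"
    using assms(1) by (intro exI[of _ "\<Sum>a\<in>A. p a"]) (auto simp: poly_sum intro!: degree_sum_le)
qed

lemma line_poly_scale:
  assumes "line_poly N f"
  shows "line_poly N (\<lambda>x. c * f x)"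
  unfolding line_poly_def
proof (intro allI)
  fix X W
  obtain p where "degree p \<le> N" "\<And>t. f (X + t *\<^sub>R W) = poly p t"
    using assms by (metis line_poly_def)
  then show "\<exists>p. degree p \<le> N \<and> (\<forall>t. c * f (X + t *\<^sub>R W) = poly p t)"
    by (intro exI[of _ "Polynomial.smult c p"]) (auto intro: order_trans[OF degree_smult_le])
qed

lemma line_poly_add:
  assumes "line_poly N f" "line_poly N g"
  shows "line_poly N (\<lambda>x. f x + g x)"
  using line_poly_sum[of "{True, False}" N "\<lambda>b. if b then f else g"] assms by simp

lemma line_poly_monomial:
  assumes "i + j \<le> N"
  shows "line_poly N (\<lambda>x. (x $h 1) ^ i * (x $h 2) ^ j)"
  unfolding line_poly_def
proof (intro allI)
  fix X W :: "real^2"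
  let ?p = "[:X $h 1, W $h 1:] ^ i * [:X $h 2, W $h 2:] ^ j"
  have d: "degree ([:a, b:] ^ k) \<le> k" for a b :: real and k
    by (rule order_trans[OF degree_power_le]) simp
  have "degree ?p \<le> N"
    using d[of "X $h 1" "W $h 1" i] d[of "X $h 2" "W $h 2" j] assms
    by (intro order_trans[OF degree_mult_le]) simp
  then show "\<exists>p. degree p \<le> N \<and> (\<forall>t. ((X + t *\<^sub>R W) $h 1) ^ i * ((X + t *\<^sub>R W) $h 2) ^ j = poly p t)"
    by (intro exI[of _ ?p]) simp
qed

text \<open>The polynomial \<open>p(X) - p(X + 1)\<close> has smaller degree than \<open>p\<close>, so its value at 0 is a fixed
combination of its values at \<open>1, \<dots>, N\<close>.\<close>

lemma poly_extrapolation: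
  "\<exists>w. \<forall>p :: real poly. degree p \<le> N \<longrightarrow> poly p 0 = (\<Sum>k<Suc N. w k * poly p (real (Suc k)))"
proof (induction N)
  case 0
  show ?case
    by (rule exI[of _ "\<lambda>_. 1"]) (auto elim: degree_eq_zeroE)
next
  case (Suc N)
  then obtain w where w: "\<And>p :: real poly. degree p \<le> N \<Longrightarrow>
      poly p 0 = (\<Sum>k<Suc N. w k * poly p (real (Suc k)))" by blast
  \<comment> \<open>the weights that \<open>p(0) = p(1) + (p(0) - p(1))\<close> collects from those of \<open>p(X) - p(X + 1)\<close>\<close>
  let ?v = "\<lambda>k. (if k = 0 then 1 else 0) + (if k < Suc N then w k else 0)
      - (case k of 0 \<Rightarrow> 0 | Suc j \<Rightarrow> w j)"
  have "poly p 0 = (\<Sum>k<Suc (Suc N). ?v k * poly p (real (Suc k)))" if p: "degree p \<le> Suc N" for p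
  proof -
    let ?q = "p - pcompose p [:1, 1:]"
    have "degree ?q \<le> N"
    proof (cases "degree p \<le> N")
      case True
      then show ?thesis by (intro degree_diff_le) (simp_all add: degree_pcompose)
    next
      case False
      with p have dp: "degree p = Suc N" by simp
      have "degree ?q < Suc N"
      proof (intro degree_lessI allI impI)
        fix k assume k: "Suc N \<le> k"
        show "coeff ?q k = 0"
        proof (cases "k = Suc N")
          case True
          have "lead_coeff (pcompose p [:1, 1:]) = lead_coeff p"
            by (subst lead_coeff_comp) auto
          then show ?thesis by (simp add: degree_pcompose dp True)
        next
          case False
          then show ?thesis using k by (simp add: coeff_eq_0 degree_pcompose dp)
        qed
      qed simp
      then show ?thesis by simp
    qed
    from w[OF this] have "poly p 0 - poly p 1
        = (\<Sum>k<Suc N. w k * (poly p (real (Suc k)) - poly p (real (Suc (Suc k)))))"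
      by (simp add: poly_pcompose algebra_simps del: sum.lessThan_Suc)
    moreover have "(\<Sum>k<Suc (Suc N). ?v k * poly p (real (Suc k)))
      = poly p 1 + (\<Sum>k<Suc N. w k * poly p (real (Suc k)))
        - (\<Sum>k<Suc N. w k * poly p (real (Suc (Suc k))))"
    proof -
      have 1: "(\<Sum>k<Suc (Suc N). (if k = 0 then 1 else 0) * poly p (real (Suc k))) = poly p 1"
        by (subst sum.lessThan_Suc_shift) (simp del: sum.lessThan_Suc)
      have 2: "(\<Sum>k<Suc (Suc N). (if k < Suc N then w k else 0) * poly p (real (Suc k)))
          = (\<Sum>k<Suc N. w k * poly p (real (Suc k)))"
        by (subst sum.lessThan_Suc) (simp del: sum.lessThan_Suc of_nat_Suc)
      have 3: "(\<Sum>k<Suc (Suc N). (case k of 0 \<Rightarrow> 0 | Suc j \<Rightarrow> w j) * poly p (real (Suc k)))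
          = (\<Sum>k<Suc N. w k * poly p (real (Suc (Suc k))))"
        by (subst sum.lessThan_Suc_shift) (simp del: sum.lessThan_Suc)
      show ?thesis
        unfolding 1[symmetric] 2[symmetric] 3[symmetric] sum.distrib[symmetric]
          sum_subtractf[symmetric]
        by (intro sum.cong refl) (simp add: algebra_simps del: of_nat_Suc)
    qed
    ultimately show ?thesis
      by (simp add: right_diff_distrib sum_subtractf del: sum.lessThan_Suc)
  qed
  then show ?case by (intro exI[of _ ?v]) blast
qed

lemma plane_vector: "vector [s, y] = s *\<^sub>R axis 1 1 + y *\<^sub>R (axis 2 1 :: real^2)"
  by (simp add: vec_eq_iff Finite_Cartesian_Product.vec_eq_iff forall_2 axis_def)

lemma plane_Basis: "(Basis :: (real^2) set) = {axis 1 1, axis 2 1}"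
  by (auto simp: Basis_vec_def) (metis exhaust_2)

lemma continuous_on_vector [continuous_intros]:
  assumes "continuous_on A f" "continuous_on A g"
  shows "continuous_on A (\<lambda>x. vector [f x, g x] :: real^2)"
  unfolding plane_vector by (intro continuous_intros assms)

lemma measurable_vector [measurable]: "(\<lambda>p. vector [fst p, snd p] :: real^2) \<in> borel_measurable borel"
  by (intro borel_measurable_continuous_onI continuous_intros)

text \<open>The trace inequality compares an edge with an element, which needs iterated integrals; the
type \<^typ>\<open>real^2\<close> is not a product type, so Lebesgue measure is transported from \<^typ>\<open>real \<times> real\<close>.\<close>

lemma lborel_plane:
  "(lborel :: (real^2) measure) = distr (lborel \<Otimes>\<^sub>M lborel) borel (\<lambda>p. vector [fst p, snd p])"
proof (rule lborel_eqI)
  fix l u :: "real^2"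
  assume le: "\<And>b. b \<in> Basis \<Longrightarrow> l \<bullet> b \<le> u \<bullet> b"
  have le': "l $h 1 \<le> u $h 1" "l $h 2 \<le> u $h 2"
    using le[of "axis 1 1"] le[of "axis 2 1"] by (simp_all add: plane_Basis inner_axis)
  have "emeasure (distr (lborel \<Otimes>\<^sub>M lborel) borel (\<lambda>p. vector [fst p, snd p])) (box l u)
    = emeasure (lborel \<Otimes>\<^sub>M lborel) ({l $h 1 <..< u $h 1} \<times> {l $h 2 <..< u $h 2})"
    by (subst emeasure_distr)
      (auto simp: lborel_prod space_pair_measure mem_box plane_Basis inner_axis
        intro!: arg_cong2[where f = emeasure])
  also have "\<dots> = ennreal (u $h 1 - l $h 1) * ennreal (u $h 2 - l $h 2)"
    using le' by (subst lborel.emeasure_pair_measure_Times) auto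
  also have "\<dots> = ennreal (\<Prod>b\<in>Basis. (u - l) \<bullet> b)"
    using le' by (simp add: plane_Basis inner_axis axis_eq_axis ennreal_mult)
  finally show "emeasure (distr (lborel \<Otimes>\<^sub>M lborel) borel (\<lambda>p. vector [fst p, snd p])) (box l u)
      = ennreal (\<Prod>b\<in>Basis. (u - l) \<bullet> b)" .
qed simp

lemma nn_integral_plane:
  fixes g :: "real^2 \<Rightarrow> ennreal"
  assumes [measurable]: "g \<in> borel_measurable borel"
  shows "(\<integral>\<^sup>+ x. g x \<partial>lborel) = (\<integral>\<^sup>+ y. \<integral>\<^sup>+ s. g (vector [s, y]) \<partial>lborel \<partial>lborel)"
proof -
  have m [measurable]: "(\<lambda>p. g (vector [fst p, snd p])) \<in> borel_measurable (lborel \<Otimes>\<^sub>M lborel)"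
    by (simp add: lborel_prod)
  have "(\<integral>\<^sup>+ x. g x \<partial>lborel) = (\<integral>\<^sup>+ p. g (vector [fst p, snd p]) \<partial>(lborel \<Otimes>\<^sub>M lborel))"
    by (subst lborel_plane, subst nn_integral_distr) (auto simp: lborel_prod)
  also have "\<dots> = (\<integral>\<^sup>+ y. \<integral>\<^sup>+ s. g (vector [s, y]) \<partial>lborel \<partial>lborel)"
    using lborel_pair.nn_integral_snd[OF m] by simp
  finally show ?thesis .
qed

lemma nn_integral_compact:
  fixes f :: "'a::euclidean_space \<Rightarrow> real"
  assumes f: "continuous_on UNIV f" "\<And>x. 0 \<le> f x" and K: "compact K"
  shows "(\<integral>\<^sup>+ x. ennreal (indicator K x * f x) \<partial>lborel) = ennreal (integral K f)"
proof -
  have i: "integrable lborel (\<lambda>x. indicator K x *\<^sub>R f x)"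
    by (rule borel_integrable_compact[OF K]) (use f(1) in \<open>blast intro: continuous_on_subset\<close>)
  have "(\<integral>\<^sup>+ x. ennreal (indicator K x * f x) \<partial>lborel) = ennreal (LINT x|lborel. indicator K x *\<^sub>R f x)"
    using nn_integral_eq_integral[OF i] f(2) by simp
  also have "(LINT x|lborel. indicator K x *\<^sub>R f x) = integral K f"
    using set_borel_integral_eq_integral(2)[of K f] i by (simp add: set_lebesgue_integral_def set_integrable_def)
  finally show ?thesis .
qed

lemma integrable_on_compact:
  fixes f :: "'a::euclidean_space \<Rightarrow> real"
  assumes "continuous_on UNIV f" "compact K"
  shows "f integrable_on K"
proof -
  have "integrable lborel (\<lambda>x. indicator K x *\<^sub>R f x)"
    by (rule borel_integrable_compact[OF assms(2)]) (use assms(1) in \<open>blast intro: continuous_on_subset\<close>)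
  then show ?thesis
    using set_borel_integral_eq_integral(1)[of K f] by (simp add: set_integrable_def)
qed

text \<open>The integral of a function that is not integrable has the default value 0.\<close>

lemma integral_nonneg_always:
  fixes f :: "'a::euclidean_space \<Rightarrow> real"
  assumes "\<And>x. 0 \<le> f x"
  shows "0 \<le> integral K f"
  using assms by (cases "f integrable_on K") (auto simp: integral_nonneg not_integrable_integral)

text \<open>The penalty threshold has to be fixed before the mesh is given, and the inequality is used for strains
and for divergences, which have different types. This predicate expresses that a constant works for
all of them at once. The point \<open>P\<close> measures how far the convex set \<open>K\<close> extends below its top edge.\<close>

definition trace_const :: "nat \<Rightarrow> real \<Rightarrow> bool" where
  "trace_const N c \<longleftrightarrow> 0 < c \<and>
    (\<forall>f K a b y P. line_poly N f \<longrightarrow> continuous_on UNIV f \<longrightarrow> compact K \<longrightarrow> convex K \<longrightarrow>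
      (\<forall>s\<in>{a..b}. vector [s, y] \<in> K) \<longrightarrow> P \<in> K \<longrightarrow> P $h 2 < y \<longrightarrow>
      integral {a..b} (\<lambda>s. (f (vector [s, y]))\<^sup>2) \<le> c / (y - P $h 2) * integral K (\<lambda>x. (f x)\<^sup>2))"

text \<open>By extrapolation along the segment from an edge point \<open>X\<close> to \<open>P\<close>, the value \<open>f X\<close> is a fixed combination of
the values of \<open>f\<close> at \<open>X + (k + 1) (t / H) (P - X)\<close>, \<open>k \<le> N\<close>, for every \<open>t\<close>; here \<open>H\<close> is the depth of \<open>P\<close>. As
\<open>X\<close> runs over the edge, such a point runs over a part of the horizontal slice of \<open>K\<close> at depth
\<open>(k + 1) t\<close>. So the integral of \<open>f\<^sup>2\<close> over the edge is bounded by integrals over slices, and averaging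
over \<open>t\<close> turns these into the integral over \<open>K\<close>. The constant only involves \<open>N\<close> and the weights of the
extrapolation.\<close>

lemma trace_inequality: "\<exists>c. trace_const N c"
proof -
  obtain w where w: "\<And>p :: real poly. degree p \<le> N \<Longrightarrow>
      poly p 0 = (\<Sum>k<Suc N. w k * poly p (real (Suc k)))"
    using poly_extrapolation[of N] by blast
  define V where "V = (\<Sum>k<Suc N. (w k)\<^sup>2) + 1"
  have V: "0 < V" unfolding V_def by (intro add_nonneg_pos sum_nonneg) auto
  define c where "c = 4 * V * (real (Suc N))\<^sup>2"
  have "integral {a..b} (\<lambda>s. (f (vector [s, y]))\<^sup>2) \<le> c / (y - P $h 2) * integral K (\<lambda>x. (f x)\<^sup>2)"
    if f: "line_poly N f" and cont: "continuous_on UNIV f" and K: "compact K" "convex K"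
      and top: "\<And>s. s \<in> {a..b} \<Longrightarrow> vector [s, y] \<in> K" and P: "P \<in> K" "P $h 2 < y"
    for f :: "real^2 \<Rightarrow> real" and K a b y P
  proof -
    define H where "H = y - P $h 2"
    have H: "0 < H" using P by (simp add: H_def)
    define T where "T = H / (2 * real (Suc N))"
    have T: "0 < T" using H by (simp add: T_def)
    define g where "g X = ennreal (indicator K X * (f X)\<^sup>2)" for X
    have [measurable]: "f \<in> borel_measurable borel"
      by (rule borel_measurable_continuous_onI[OF cont])
    have [measurable]: "K \<in> sets borel" by (rule borel_closed[OF compact_imp_closed[OF K(1)]])
    have g [measurable]: "g \<in> borel_measurable borel" unfolding g_def by measurable
    have "(\<lambda>p. vector [snd p, fst p] :: real^2) \<in> borel_measurable borel"
      by (intro borel_measurable_continuous_onI continuous_intros)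
    then have vec2: "(\<lambda>p. vector [snd p, fst p] :: real^2) \<in> borel_measurable (lborel \<Otimes>\<^sub>M lborel)"
      by (simp add: lborel_prod)
    define G where "G \<eta> = (\<integral>\<^sup>+ s. g (vector [s, \<eta>]) \<partial>lborel)" for \<eta>
    have "(\<lambda>\<eta>. \<integral>\<^sup>+ s. g (vector [s, \<eta>]) \<partial>lborel) \<in> borel_measurable lborel"
      by (rule lborel.borel_measurable_nn_integral)
        (use measurable_compose[OF vec2 g] in \<open>simp add: split_beta\<close>)
    then have G [measurable]: "G \<in> borel_measurable borel" by (simp add: G_def[abs_def])
    let ?J = "integral K (\<lambda>x. (f x)\<^sup>2)" and ?I = "integral {a..b} (\<lambda>s. (f (vector [s, y]))\<^sup>2)"
    have J: "(\<integral>\<^sup>+ \<eta>. G \<eta> \<partial>lborel) = ennreal ?J"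
      unfolding G_def nn_integral_plane[OF g, symmetric] unfolding g_def
      by (intro nn_integral_compact K continuous_intros cont) auto
    have cont_line: "continuous_on UNIV (\<lambda>s. f (vector [u + r * s, z]))" for u r z
      by (rule continuous_on_compose2[OF cont]) (auto intro!: continuous_intros)
    have I: "(\<integral>\<^sup>+ s. ennreal (indicator {a..b} s * (f (vector [s, y]))\<^sup>2) \<partial>lborel) = ennreal ?I"
      using cont_line[of 0 1 y]
      by (intro nn_integral_compact compact_Icc continuous_intros) auto
    have nonneg: "0 \<le> ?I" "0 \<le> ?J"
      by (simp_all add: integral_nonneg_always)
    \<comment> \<open>The homothety with centre \<open>P\<close> maps the edge into a slice of \<open>K\<close>; the factor 2 is the inverse of
      the smallest ratio \<open>1 - \<theta>\<close> that \<open>t \<le> T\<close> permits.\<close>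
    have slice: "(\<integral>\<^sup>+ s. ennreal (indicator {a..b} s *
          (f (vector [s, y] + (real (Suc k) * t / H) *\<^sub>R (P - vector [s, y])))\<^sup>2) \<partial>lborel)
        \<le> 2 * G (y - real (Suc k) * t)"
      if k: "k < Suc N" and t: "t \<in> {0..T}" for k t
    proof -
      define \<theta> where "\<theta> = real (Suc k) * t / H"
      have "real (Suc k) * t \<le> real (Suc N) * T"
        using k t by (intro mult_mono) auto
      also have "\<dots> = H / 2" unfolding T_def by (simp del: of_nat_Suc)
      finally have \<theta>: "0 \<le> \<theta>" "\<theta> \<le> 1 / 2"
        using H t by (auto simp: \<theta>_def field_simps)
      have pt: "vector [s, y] + \<theta> *\<^sub>R (P - vector [s, y])
          = vector [\<theta> * P $h 1 + (1 - \<theta>) * s, y - real (Suc k) * t]" for s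
      proof -
        have "\<theta> * H = real (Suc k) * t" using H by (simp add: \<theta>_def)
        then show ?thesis
          by (simp add: Finite_Cartesian_Product.vec_eq_iff forall_2 H_def algebra_simps)
      qed
      have "(\<integral>\<^sup>+ s. ennreal (indicator {a..b} s *
            (f (vector [s, y] + \<theta> *\<^sub>R (P - vector [s, y])))\<^sup>2) \<partial>lborel)
          \<le> (\<integral>\<^sup>+ s. g (vector [\<theta> * P $h 1 + (1 - \<theta>) * s, y - real (Suc k) * t]) \<partial>lborel)"
      proof (intro nn_integral_mono)
        fix s
        have "vector [s, y] + \<theta> *\<^sub>R (P - vector [s, y]) \<in> K" if "s \<in> {a..b}"
          using convexD_alt[OF K(2) top[OF that] P(1), of \<theta>] \<theta> by (simp add: algebra_simps)
        then show "ennreal (indicator {a..b} s * (f (vector [s, y] + \<theta> *\<^sub>R (P - vector [s, y])))\<^sup>2)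
            \<le> g (vector [\<theta> * P $h 1 + (1 - \<theta>) * s, y - real (Suc k) * t])"
          unfolding g_def pt by (auto simp: indicator_def)
      qed
      also have "\<dots> \<le> ennreal (2 * (1 - \<theta>)) * \<dots>"
        using mult_right_mono[OF ennreal_leI[of 1 "2 * (1 - \<theta>)"]] \<theta> by simp
      also have "\<dots> = 2 * (ennreal (1 - \<theta>) * (\<integral>\<^sup>+ s. g (vector [\<theta> * P $h 1 + (1 - \<theta>) * s,
          y - real (Suc k) * t]) \<partial>lborel))"
        using \<theta> ennreal_mult[of 2 "1 - \<theta>"] by (simp only: mult.assoc ennreal_numeral)
      also have "\<dots> = 2 * G (y - real (Suc k) * t)"
        unfolding G_def
      proof (subst nn_integral_real_affine[of "\<lambda>s. g (vector [s, y - real (Suc k) * t])" "1 - \<theta>" "\<theta> * P $h 1"])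
        show "(\<lambda>s. g (vector [s, y - real (Suc k) * t])) \<in> borel_measurable borel"
          by (rule measurable_compose[OF _ g]) (intro borel_measurable_continuous_onI continuous_intros)
      qed (use \<theta> in auto)
      finally show ?thesis by (simp add: \<theta>_def)
    qed
    have point: "(f (vector [s, y]))\<^sup>2 \<le> V * (\<Sum>k<Suc N.
        (f (vector [s, y] + (real (Suc k) * t / H) *\<^sub>R (P - vector [s, y])))\<^sup>2)" for s t
    proof -
      obtain p where p: "degree p \<le> N"
        "\<And>r. f (vector [s, y] + r *\<^sub>R ((t / H) *\<^sub>R (P - vector [s, y]))) = poly p r"
        using f by (metis line_poly_def)
      have "(f (vector [s, y]))\<^sup>2 = (\<Sum>k<Suc N. w k * poly p (real (Suc k)))\<^sup>2"
        using p(2)[of 0] w[OF p(1)] by simp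
      also have "\<dots> \<le> (\<Sum>k<Suc N. (w k)\<^sup>2) * (\<Sum>k<Suc N. (poly p (real (Suc k)))\<^sup>2)"
        by (rule Cauchy_Schwarz_ineq_sum)
      also have "\<dots> \<le> V * (\<Sum>k<Suc N. (poly p (real (Suc k)))\<^sup>2)"
        by (intro mult_right_mono sum_nonneg) (auto simp: V_def)
      finally show ?thesis
        unfolding p(2)[symmetric] by simp
    qed
    have edge: "ennreal ?I \<le> ennreal (2 * V) * (\<Sum>k<Suc N. G (y - real (Suc k) * t))"
      if t: "t \<in> {0..T}" for t
    proof -
      let ?q = "\<lambda>k s. indicator {a..b} s *
          (f (vector [s, y] + (real (Suc k) * t / H) *\<^sub>R (P - vector [s, y])))\<^sup>2"
      have [measurable]: "?q k \<in> borel_measurable lborel" for k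
      proof -
        have "continuous_on UNIV (\<lambda>s. f (vector [s, y] + (real (Suc k) * t / H) *\<^sub>R (P - vector [s, y])))"
          by (rule continuous_on_compose2[OF cont]) (auto intro!: continuous_intros)
        from borel_measurable_continuous_onI[OF this] show ?thesis by measurable
      qed
      have "ennreal ?I \<le> (\<integral>\<^sup>+ s. ennreal V * (\<Sum>k<Suc N. ennreal (?q k s)) \<partial>lborel)"
        unfolding I[symmetric]
      proof (intro nn_integral_mono)
        fix s
        have "indicator {a..b} s * (f (vector [s, y]))\<^sup>2 \<le> V * (\<Sum>k<Suc N. ?q k s)"
          using point[of s t] by (cases "s \<in> {a..b}") (simp_all del: sum.lessThan_Suc of_nat_Suc)
        moreover have "ennreal V * (\<Sum>k<Suc N. ennreal (?q k s)) = ennreal (V * (\<Sum>k<Suc N. ?q k s))"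
          using V by (subst sum_ennreal) (simp_all only: ennreal_mult' less_imp_le, simp)
        ultimately show "ennreal (indicator {a..b} s * (f (vector [s, y]))\<^sup>2)
            \<le> ennreal V * (\<Sum>k<Suc N. ennreal (?q k s))"
          by (simp only: ennreal_leI)
      qed
      also have "\<dots> = ennreal V * (\<Sum>k<Suc N. \<integral>\<^sup>+ s. ennreal (?q k s) \<partial>lborel)"
        by (subst nn_integral_cmult, measurable, subst nn_integral_sum) (auto simp del: of_nat_Suc sum.lessThan_Suc)
      also have "\<dots> \<le> ennreal V * (\<Sum>k<Suc N. 2 * G (y - real (Suc k) * t))"
        by (intro mult_left_mono sum_mono slice t) auto
      finally show ?thesis
        using V by (simp add: sum_distrib_left[symmetric] ennreal_mult mult.assoc mult.left_commute
            del: sum.lessThan_Suc of_nat_Suc)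
    qed
    have depth: "(\<integral>\<^sup>+ t. G (y - real (Suc k) * t) \<partial>lborel) \<le> ennreal ?J" for k
    proof -
      have "(\<integral>\<^sup>+ t. G (y - real (Suc k) * t) \<partial>lborel) = 1 * (\<integral>\<^sup>+ t. G (y + - real (Suc k) * t) \<partial>lborel)"
        by (simp del: of_nat_Suc)
      also have "\<dots> \<le> ennreal \<bar>- real (Suc k)\<bar> * (\<integral>\<^sup>+ t. G (y + - real (Suc k) * t) \<partial>lborel)"
        by (intro mult_right_mono) (auto simp: ennreal_1[symmetric] simp del: ennreal_1)
      also have "\<dots> = (\<integral>\<^sup>+ \<eta>. G \<eta> \<partial>lborel)"
        using nn_integral_real_affine[OF G, of "- real (Suc k)" y] by (simp del: of_nat_Suc)
      finally show ?thesis by (simp add: J)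
    qed
    have "ennreal (T * ?I) = (\<integral>\<^sup>+ t. ennreal ?I * indicator {0..T} t \<partial>lborel)"
      using T nonneg by (subst nn_integral_cmult_indicator) (auto simp: ennreal_mult mult.commute)
    also have "\<dots> \<le> (\<integral>\<^sup>+ t. ennreal (2 * V) * (\<Sum>k<Suc N. G (y - real (Suc k) * t)) \<partial>lborel)"
      using edge by (intro nn_integral_mono) (auto simp: indicator_def simp del: sum.lessThan_Suc of_nat_Suc)
    also have "\<dots> = ennreal (2 * V) * (\<Sum>k<Suc N. \<integral>\<^sup>+ t. G (y - real (Suc k) * t) \<partial>lborel)"
      by (subst nn_integral_cmult, measurable, subst nn_integral_sum) (auto simp del: of_nat_Suc sum.lessThan_Suc)
    also have "\<dots> \<le> ennreal (2 * V) * (\<Sum>k<Suc N. ennreal ?J)"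
      by (intro mult_left_mono sum_mono depth) auto
    also have "\<dots> = ennreal (2 * V * (real (Suc N) * ?J))"
      using V nonneg by (simp add: ennreal_mult ennreal_of_nat_eq_real_of_nat del: of_nat_Suc sum.lessThan_Suc)
    finally have "T * ?I \<le> 2 * V * (real (Suc N) * ?J)"
      using V nonneg by (subst (asm) ennreal_le_iff) auto
    then have "?I \<le> 2 * V * (real (Suc N) * ?J) / T"
      using T by (simp add: field_simps)
    also have "\<dots> = c / H * ?J"
      by (simp add: T_def c_def power2_eq_square)
    finally show ?thesis by (simp add: H_def)
  qed
  moreover have "0 < c" using V by (simp add: c_def)
  ultimately show ?thesis unfolding trace_const_def by (intro exI[of _ c]) blast
qed

text \<open>Squared norms are sums of squares of components, to each of which the scalar inequality applies.\<close>

lemma trace_inequality_euclidean: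
  fixes F :: "real^2 \<Rightarrow> 'a::euclidean_space"
  assumes c: "trace_const N c" and F: "\<And>e. e \<in> Basis \<Longrightarrow> line_poly N (\<lambda>x. inner (F x) e)" "continuous_on UNIV F"
    and K: "compact K" "convex K" and top: "\<And>s. s \<in> {a..b} \<Longrightarrow> vector [s, y] \<in> K"
    and P: "P \<in> K" "P $h 2 < y"
  shows "integral {a..b} (\<lambda>s. inner (F (vector [s, y])) (F (vector [s, y])))
    \<le> c / (y - P $h 2) * integral K (\<lambda>x. inner (F x) (F x))"
proof -
  have cont: "continuous_on UNIV (\<lambda>x. inner (F x) e)" for e by (intro continuous_intros F(2))
  have cont': "continuous_on UNIV (\<lambda>s. inner (F (vector [s, y])) e)" for e
    by (rule continuous_on_compose2[OF cont]) (auto intro!: continuous_intros)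
  have eq: "inner (F x) (F x) = (\<Sum>e\<in>Basis. (inner (F x) e)\<^sup>2)" for x
    by (subst euclidean_inner) (simp add: power2_eq_square)
  have "integral {a..b} (\<lambda>s. inner (F (vector [s, y])) (F (vector [s, y])))
      = (\<Sum>e\<in>Basis. integral {a..b} (\<lambda>s. (inner (F (vector [s, y])) e)\<^sup>2))"
    unfolding eq by (intro integral_sum finite_Basis integrable_continuous_interval continuous_intros
        continuous_on_subset[OF cont']) auto
  also have "\<dots> \<le> (\<Sum>e\<in>Basis. c / (y - P $h 2) * integral K (\<lambda>x. (inner (F x) e)\<^sup>2))"
    using c F(1) cont K top P unfolding trace_const_def by (intro sum_mono) blast
  also have "\<dots> = c / (y - P $h 2) * integral K (\<lambda>x. inner (F x) (F x))"
    unfolding eq sum_distrib_left[symmetric]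
    by (subst integral_sum[OF finite_Basis]) (auto intro!: integrable_on_compact continuous_intros cont K)
  finally show ?thesis .
qed

section \<open>Kronecker products and grid operators\<close>

text \<open>Row \<open>k\<close> of a Kronecker product belongs to the pair of rows \<open>k div b\<close> and \<open>k mod b\<close>.\<close>

lemma sum_div_mod:
  fixes f :: "nat \<Rightarrow> nat \<Rightarrow> 'a::comm_monoid_add"
  shows "(\<Sum>k<a * b. f (k div b) (k mod b)) = (\<Sum>p<a. \<Sum>q<b. f p q)"
proof -
  have "(\<Sum>q = p * b..<p * b + b. f (q div b) (q mod b)) = (\<Sum>q<b. f p q)" for p
  proof (cases "b = 0")
    case False
    have "(\<Sum>q = 0 + p * b..<b + p * b. f (q div b) (q mod b))
        = (\<Sum>q = 0..<b. f ((q + p * b) div b) ((q + p * b) mod b))"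
      by (rule sum.shift_bounds_nat_ivl)
    also have "\<dots> = (\<Sum>q<b. f p q)"
      using False by (intro sum.cong) (auto simp: lessThan_atLeast0)
    finally show ?thesis by (simp add: add.commute)
  qed simp
  then show ?thesis
    using sum.nat_group[of "\<lambda>k. f (k div b) (k mod b)" b a] by simp
qed

lemma div_mod_less:
  fixes i a b :: nat
  assumes "i < a * b"
  shows "i div b < a" "i mod b < b"
  using assms by (auto simp: less_mult_imp_div_less intro!: mod_less_divisor gr0I)

lemma kron_dims [simp]:
  "dim_row (A \<otimes>\<^sub>k B) = dim_row A * dim_row B" "dim_col (A \<otimes>\<^sub>k B) = dim_col A * dim_col B"
  by (simp_all add: kron_def)

lemma kron_carrier:
  "A \<in> carrier_mat a b \<Longrightarrow> B \<in> carrier_mat c d \<Longrightarrow> A \<otimes>\<^sub>k B \<in> carrier_mat (a * c) (b * d)"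
  by (auto simp: kron_def)

lemma kron_index:
  assumes "i < dim_row A * dim_row B" "j < dim_col A * dim_col B"
  shows "(A \<otimes>\<^sub>k B) $$ (i, j)
    = A $$ (i div dim_row B, j div dim_col B) * B $$ (i mod dim_row B, j mod dim_col B)"
  using assms by (simp add: kron_def)

lemma mat_mult_index:
  assumes "i < dim_row A" "j < dim_col B" "dim_col A = dim_row B"
  shows "(A * B) $$ (i, j) = (\<Sum>k<dim_row B. A $$ (i, k) * B $$ (k, j))"
  using assms by (auto simp: scalar_prod_def lessThan_atLeast0 intro!: sum.cong)

lemma kron_mult:
  assumes "dim_col A = dim_row C" "dim_col B = dim_row D"
  shows "(A \<otimes>\<^sub>k B) * (C \<otimes>\<^sub>k D) = (A * C) \<otimes>\<^sub>k (B * D)"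
proof (rule eq_matI)
  fix i j
  assume "i < dim_row ((A * C) \<otimes>\<^sub>k (B * D))" "j < dim_col ((A * C) \<otimes>\<^sub>k (B * D))"
  then have i: "i < dim_row A * dim_row B" and j: "j < dim_col C * dim_col D" by simp_all
  let ?i1 = "i div dim_row B" and ?i2 = "i mod dim_row B"
  let ?j1 = "j div dim_col D" and ?j2 = "j mod dim_col D"
  note b = div_mod_less[OF i] div_mod_less[OF j]
  have "((A \<otimes>\<^sub>k B) * (C \<otimes>\<^sub>k D)) $$ (i, j)
      = (\<Sum>k<dim_row C * dim_row D. (A \<otimes>\<^sub>k B) $$ (i, k) * (C \<otimes>\<^sub>k D) $$ (k, j))"
    using i j assms by (subst mat_mult_index) auto
  also have "\<dots> = (\<Sum>k<dim_row C * dim_row D.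
      (A $$ (?i1, k div dim_row D) * C $$ (k div dim_row D, ?j1))
      * (B $$ (?i2, k mod dim_row D) * D $$ (k mod dim_row D, ?j2)))"
    using i j assms by (intro sum.cong) (auto simp: kron_index)
  also have "\<dots> = (\<Sum>p<dim_row C. \<Sum>q<dim_row D.
      (A $$ (?i1, p) * C $$ (p, ?j1)) * (B $$ (?i2, q) * D $$ (q, ?j2)))"
    by (rule sum_div_mod)
  also have "\<dots> = (A * C) $$ (?i1, ?j1) * (B * D) $$ (?i2, ?j2)"
    using b assms by (simp add: mat_mult_index sum_product del: index_mult_mat)
  also have "\<dots> = ((A * C) \<otimes>\<^sub>k (B * D)) $$ (i, j)"
    using i j by (simp add: kron_index)
  finally show "((A \<otimes>\<^sub>k B) * (C \<otimes>\<^sub>k D)) $$ (i, j) = ((A * C) \<otimes>\<^sub>k (B * D)) $$ (i, j)" .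
qed simp_all

lemma kron_transpose: "transpose_mat (A \<otimes>\<^sub>k B) = transpose_mat A \<otimes>\<^sub>k transpose_mat B"
  by (rule eq_matI) (auto simp: kron_index div_mod_less)

lemma kron_add_left:
  assumes "A \<in> carrier_mat a b" "A' \<in> carrier_mat a b"
  shows "(A + A') \<otimes>\<^sub>k B = A \<otimes>\<^sub>k B + A' \<otimes>\<^sub>k B"
  using assms by (intro eq_matI) (auto simp: kron_index div_mod_less algebra_simps)

lemma kron_add_right:
  assumes "B \<in> carrier_mat a b" "B' \<in> carrier_mat a b"
  shows "A \<otimes>\<^sub>k (B + B') = A \<otimes>\<^sub>k B + A \<otimes>\<^sub>k B'"
  using assms by (intro eq_matI) (auto simp: kron_index div_mod_less algebra_simps)

lemma kron_uminus_left: "(- A) \<otimes>\<^sub>k B = - (A \<otimes>\<^sub>k B)"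
  by (intro eq_matI) (auto simp: kron_index div_mod_less)

lemma kron_uminus_right: "A \<otimes>\<^sub>k (- B) = - (A \<otimes>\<^sub>k B)"
  by (intro eq_matI) (auto simp: kron_index div_mod_less)

lemma kron_one: "1\<^sub>m a \<otimes>\<^sub>k 1\<^sub>m b = 1\<^sub>m (a * b)"
proof (rule eq_matI)
  fix i j assume "i < dim_row (1\<^sub>m (a * b))" "j < dim_col (1\<^sub>m (a * b))"
  then have ij: "i < a * b" "j < a * b" by auto
  have "i = j" if "i div b = j div b" "i mod b = j mod b"
    using that by (metis mod_mult_div_eq)
  then show "(1\<^sub>m a \<otimes>\<^sub>k 1\<^sub>m b) $$ (i, j) = 1\<^sub>m (a * b) $$ (i, j)"
    using ij by (auto simp: kron_index div_mod_less)
qed auto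

lemma kron_assoc: "(A \<otimes>\<^sub>k B) \<otimes>\<^sub>k C = A \<otimes>\<^sub>k (B \<otimes>\<^sub>k C)"
proof (rule eq_matI)
  fix i j assume "i < dim_row (A \<otimes>\<^sub>k (B \<otimes>\<^sub>k C))" "j < dim_col (A \<otimes>\<^sub>k (B \<otimes>\<^sub>k C))"
  then have i: "i < dim_row A * dim_row B * dim_row C" and j: "j < dim_col A * dim_col B * dim_col C"
    by (simp_all add: mult.assoc)
  have i': "i < dim_row A * (dim_row B * dim_row C)" and j': "j < dim_col A * (dim_col B * dim_col C)"
    using i j by (simp_all add: mult.assoc)
  have dm: "(k mod (b * c)) div c = (k div c) mod b" "(k mod (b * c)) mod c = k mod c"
    "(k div c) div b = k div (b * c)" for k b c :: nat
    by (simp_all add: mod_mult2_eq div_mult2_eq mult.commute[of b c])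
       (cases "c = 0"; simp add: mod_mult2_eq)
  show "((A \<otimes>\<^sub>k B) \<otimes>\<^sub>k C) $$ (i, j) = (A \<otimes>\<^sub>k (B \<otimes>\<^sub>k C)) $$ (i, j)"
    using i j i' j' div_mod_less[OF i] div_mod_less[OF j] div_mod_less[OF i'] div_mod_less[OF j']
    by (simp add: kron_index dm)
qed (simp_all add: mult.assoc)

lemma scalar_prod_mult_mat_vec:
  assumes "A \<in> carrier_mat n k" "w \<in> carrier_vec n" "u \<in> carrier_vec k"
  shows "w \<bullet>\<^sub>v (A *\<^sub>v u) = (\<Sum>i<n. \<Sum>j<k. w $ i * A $$ (i, j) * u $ j)"
  using assms
  by (auto simp: scalar_prod_def lessThan_atLeast0 sum_distrib_left mult.assoc intro!: sum.cong)

lemma kron_form: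
  assumes A: "A \<in> carrier_mat a a" and B: "B \<in> carrier_mat b b"
    and w: "w \<in> carrier_vec (a * b)" and u: "u \<in> carrier_vec (a * b)"
  shows "w \<bullet>\<^sub>v ((A \<otimes>\<^sub>k B) *\<^sub>v u) = (\<Sum>p<a. \<Sum>q<b. \<Sum>p'<a. \<Sum>q'<b.
    w $ (p * b + q) * (A $$ (p, p') * B $$ (q, q')) * u $ (p' * b + q'))"
proof -
  have "w \<bullet>\<^sub>v ((A \<otimes>\<^sub>k B) *\<^sub>v u) = (\<Sum>i<a * b. \<Sum>j<a * b. w $ i * (A \<otimes>\<^sub>k B) $$ (i, j) * u $ j)"
    by (rule scalar_prod_mult_mat_vec[OF kron_carrier[OF A B] w u])
  also have "\<dots> = (\<Sum>i<a * b. \<Sum>j<a * b. w $ (i div b * b + i mod b) *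
      (A $$ (i div b, j div b) * B $$ (i mod b, j mod b)) * u $ (j div b * b + j mod b))"
    using A B by (intro sum.cong) (auto simp: kron_index)
  also have "\<dots> = (\<Sum>i<a * b. \<Sum>p'<a. \<Sum>q'<b. w $ (i div b * b + i mod b) *
      (A $$ (i div b, p') * B $$ (i mod b, q')) * u $ (p' * b + q'))"
    by (intro sum.cong refl sum_div_mod)
  also have "\<dots> = (\<Sum>p<a. \<Sum>q<b. \<Sum>p'<a. \<Sum>q'<b.
    w $ (p * b + q) * (A $$ (p, p') * B $$ (q, q')) * u $ (p' * b + q'))"
    by (rule sum_div_mod)
  finally show ?thesis .
qed

text \<open>A diagonal factor decouples the form into non-negatively weighted copies of the form of \<open>R\<close>.\<close>

lemma diag_kron_psd:
  assumes D: "D \<in> carrier_mat a a" "diagonal_mat D" "\<And>i. i < a \<Longrightarrow> 0 \<le> D $$ (i, i)"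
    and R: "R \<in> carrier_mat b b" "\<And>x. x \<in> carrier_vec b \<Longrightarrow> 0 \<le> x \<bullet>\<^sub>v (R *\<^sub>v x)"
    and u: "u \<in> carrier_vec (a * b)"
  shows "0 \<le> u \<bullet>\<^sub>v ((D \<otimes>\<^sub>k R) *\<^sub>v u)"
proof -
  let ?x = "\<lambda>p. Matrix.vec b (\<lambda>q. u $ (p * b + q))"
  have "u \<bullet>\<^sub>v ((D \<otimes>\<^sub>k R) *\<^sub>v u) = (\<Sum>p<a. D $$ (p, p) * (?x p \<bullet>\<^sub>v (R *\<^sub>v ?x p)))"
    unfolding kron_form[OF D(1) R(1) u u]
  proof (intro sum.cong refl)
    fix p assume p: "p \<in> {..<a}"
    have "(\<Sum>p'<a. \<Sum>q'<b. u $ (p * b + q) * (D $$ (p, p') * R $$ (q, q')) * u $ (p' * b + q'))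
      = (\<Sum>p'<a. if p' = p then \<Sum>q'<b. u $ (p * b + q) * (D $$ (p, p) * R $$ (q, q')) * u $ (p * b + q') else 0)"
      for q
      using p D by (intro sum.cong) (auto simp: diagonal_mat_def)
    then show "(\<Sum>q<b. \<Sum>p'<a. \<Sum>q'<b. u $ (p * b + q) * (D $$ (p, p') * R $$ (q, q')) * u $ (p' * b + q'))
      = D $$ (p, p) * (?x p \<bullet>\<^sub>v (R *\<^sub>v ?x p))"
      using p R(1) by (simp add: scalar_prod_mult_mat_vec[of _ b b] sum_distrib_left ac_simps)
  qed
  also have "\<dots> \<ge> 0" using D R(2) by (intro sum_nonneg mult_nonneg_nonneg) auto
  finally show ?thesis .
qed

lemma kron_diag_psd:
  assumes D: "D \<in> carrier_mat b b" "diagonal_mat D" "\<And>i. i < b \<Longrightarrow> 0 \<le> D $$ (i, i)"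
    and R: "R \<in> carrier_mat a a" "\<And>x. x \<in> carrier_vec a \<Longrightarrow> 0 \<le> x \<bullet>\<^sub>v (R *\<^sub>v x)"
    and u: "u \<in> carrier_vec (a * b)"
  shows "0 \<le> u \<bullet>\<^sub>v ((R \<otimes>\<^sub>k D) *\<^sub>v u)"
proof -
  let ?x = "\<lambda>q. Matrix.vec a (\<lambda>p. u $ (p * b + q))"
  have "u \<bullet>\<^sub>v ((R \<otimes>\<^sub>k D) *\<^sub>v u) = (\<Sum>p<a. \<Sum>q<b. \<Sum>p'<a.
      u $ (p * b + q) * (R $$ (p, p') * D $$ (q, q)) * u $ (p' * b + q))"
    unfolding kron_form[OF R(1) D(1) u u]
  proof (intro sum.cong refl)
    fix p q p' assume q: "q \<in> {..<b}"
    have "(\<Sum>q'<b. u $ (p * b + q) * (R $$ (p, p') * D $$ (q, q')) * u $ (p' * b + q'))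
      = (\<Sum>q'<b. if q' = q then u $ (p * b + q) * (R $$ (p, p') * D $$ (q, q)) * u $ (p' * b + q) else 0)"
      using q D by (intro sum.cong) (auto simp: diagonal_mat_def)
    then show "(\<Sum>q'<b. u $ (p * b + q) * (R $$ (p, p') * D $$ (q, q')) * u $ (p' * b + q'))
      = u $ (p * b + q) * (R $$ (p, p') * D $$ (q, q)) * u $ (p' * b + q)"
      using q by simp
  qed
  also have "\<dots> = (\<Sum>q<b. D $$ (q, q) * (?x q \<bullet>\<^sub>v (R *\<^sub>v ?x q)))"
    using R(1) by (subst sum.swap) (simp add: scalar_prod_mult_mat_vec[of _ a a] sum_distrib_left ac_simps)
  also have "\<dots> \<ge> 0" using D R(2) by (intro sum_nonneg mult_nonneg_nonneg) auto
  finally show ?thesis .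
qed

lemma kron_diagonal:
  assumes "A \<in> carrier_mat a a" "diagonal_mat A" "B \<in> carrier_mat b b" "diagonal_mat B"
  shows "diagonal_mat (A \<otimes>\<^sub>k B)"
  unfolding diagonal_mat_def
proof (intro allI impI)
  fix i j assume "i < dim_row (A \<otimes>\<^sub>k B)" "j < dim_col (A \<otimes>\<^sub>k B)" "i \<noteq> j"
  moreover have "i div b \<noteq> j div b \<or> i mod b \<noteq> j mod b"
    using \<open>i \<noteq> j\<close> by (metis mod_mult_div_eq)
  ultimately show "(A \<otimes>\<^sub>k B) $$ (i, j) = 0"
    using assms by (auto simp: kron_index diagonal_mat_def div_mod_less)
qed

text \<open>All operators on the grid are sums of such products, with the first factor acting on the two
displacement components and the others in the \<open>x\<close> and \<open>y\<close> direction. Operator identities then split into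
identities of one-dimensional matrices.\<close>

definition tensor :: "real mat \<Rightarrow> real mat \<Rightarrow> real mat \<Rightarrow> real mat" where
  "tensor c A B = c \<otimes>\<^sub>k A \<otimes>\<^sub>k B"

lemma tensor_carrier [simp, intro]:
  "c \<in> carrier_mat 2 2 \<Longrightarrow> A \<in> carrier_mat m m \<Longrightarrow> B \<in> carrier_mat n n \<Longrightarrow>
    tensor c A B \<in> carrier_mat (2 * m * n) (2 * m * n)"
  by (simp add: tensor_def kron_carrier)

lemma tensor_mult:
  assumes "c \<in> carrier_mat 2 2" "c' \<in> carrier_mat 2 2" "A \<in> carrier_mat m m" "A' \<in> carrier_mat m m"
    "B \<in> carrier_mat n n" "B' \<in> carrier_mat n n"
  shows "tensor c A B * tensor c' A' B' = tensor (c * c') (A * A') (B * B')"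
  using assms by (simp add: tensor_def kron_mult)

lemma tensor_transpose:
  "transpose_mat (tensor c A B) = tensor (transpose_mat c) (transpose_mat A) (transpose_mat B)"
  by (simp add: tensor_def kron_transpose)

lemma tensor_add:
  "c \<in> carrier_mat k l \<Longrightarrow> c' \<in> carrier_mat k l \<Longrightarrow> tensor (c + c') A B = tensor c A B + tensor c' A B"
  "A \<in> carrier_mat k l \<Longrightarrow> A' \<in> carrier_mat k l \<Longrightarrow> tensor c (A + A') B = tensor c A B + tensor c A' B"
  "B \<in> carrier_mat k l \<Longrightarrow> B' \<in> carrier_mat k l \<Longrightarrow> tensor c A (B + B') = tensor c A B + tensor c A B'"
  unfolding tensor_def
  by (simp_all add: kron_add_left[of _ k l] kron_add_right[of _ k l]
      kron_add_left[of "c \<otimes>\<^sub>k A" "k * dim_row A" "l * dim_col A"]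
      kron_add_left[of "c \<otimes>\<^sub>k A" "dim_row c * k" "dim_col c * l"] kron_carrier)

lemma tensor_uminus: "tensor c (- A) B = - tensor c A B" "tensor c A (- B) = - tensor c A B"
  by (simp_all add: tensor_def kron_uminus_left kron_uminus_right)

lemma diagonal_minv:
  assumes A: "A \<in> carrier_mat n n" "diagonal_mat A" "\<And>i. i < n \<Longrightarrow> A $$ (i, i) \<noteq> 0"
  shows "minv A \<in> carrier_mat n n" "A * minv A = 1\<^sub>m n"
proof -
  let ?B = "mat_diag n (\<lambda>i. 1 / A $$ (i, i))"
  have A': "A = mat_diag n (\<lambda>i. A $$ (i, i))"
    using A(1,2) by (intro eq_matI) (auto simp: mat_diag_def diagonal_mat_def)
  have one: "mat_diag n (\<lambda>i. A $$ (i, i) * (1 / A $$ (i, i))) = 1\<^sub>m n"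
    "mat_diag n (\<lambda>i. 1 / A $$ (i, i) * A $$ (i, i)) = 1\<^sub>m n"
    using A(3) by (auto simp: mat_diag_def)
  have "A * ?B = 1\<^sub>m n" "?B * A = 1\<^sub>m n"
    by (subst A', subst mat_diag_diag, rule one)+
  then have "A \<in> Units (ring_mat TYPE(real) n undefined)"
    using A(1) unfolding Units_def ring_mat_simps by (auto intro!: bexI[of _ ?B])
  with mat_inverse(1)[OF A(1), of undefined] obtain B where B: "mat_inverse A = Some B" by fastforce
  from mat_inverse(2)[OF A(1) B] B show "minv A \<in> carrier_mat n n" "A * minv A = 1\<^sub>m n" by auto
qed

definition mat22 :: "real \<Rightarrow> real \<Rightarrow> real \<Rightarrow> real \<Rightarrow> real mat" where
  "mat22 a b c d = Matrix.mat 2 2 (\<lambda>(i, j). if i = 0 then if j = 0 then a else b else if j = 0 then c else d)"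

lemma mat22_carrier [simp]: "mat22 a b c d \<in> carrier_mat 2 2"
  by (simp add: mat22_def)

lemma mat22_dims [simp]: "dim_row (mat22 a b c d) = 2" "dim_col (mat22 a b c d) = 2"
  by (simp_all add: mat22_def)

lemma mat22_entries [simp]:
  "mat22 a b c d $$ (0, 0) = a" "mat22 a b c d $$ (0, Suc 0) = b"
  "mat22 a b c d $$ (Suc 0, 0) = c" "mat22 a b c d $$ (Suc 0, Suc 0) = d"
  by (simp_all add: mat22_def)

lemma mat22_transpose [simp]: "transpose_mat (mat22 a b c d) = mat22 a c b d"
  by (auto simp: mat22_def intro!: eq_matI)

lemma four_block_tensor:
  "four_block_mat (a \<cdot>\<^sub>m (1\<^sub>m m \<otimes>\<^sub>k 1\<^sub>m n)) (b \<cdot>\<^sub>m (1\<^sub>m m \<otimes>\<^sub>k 1\<^sub>m n))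
     (c \<cdot>\<^sub>m (1\<^sub>m m \<otimes>\<^sub>k 1\<^sub>m n)) (d \<cdot>\<^sub>m (1\<^sub>m m \<otimes>\<^sub>k 1\<^sub>m n))
   = tensor (mat22 a b c d) (1\<^sub>m m) (1\<^sub>m n)"
proof (rule eq_matI)
  let ?N = "m * n"
  fix i j assume "i < dim_row (tensor (mat22 a b c d) (1\<^sub>m m) (1\<^sub>m n))"
    "j < dim_col (tensor (mat22 a b c d) (1\<^sub>m m) (1\<^sub>m n))"
  then have ij: "i < 2 * ?N" "j < 2 * ?N" by (simp_all add: tensor_def mult.assoc)
  have dm: "k div ?N = (if k < ?N then 0 else 1)" "k mod ?N = (if k < ?N then k else k - ?N)"
    if "k < 2 * ?N" for k
  proof -
    have "k div ?N = 1 \<and> k mod ?N = k - ?N" if "\<not> k < ?N"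
    proof -
      from that obtain r where "k = ?N + r" by (meson leI le_Suc_ex)
      moreover have "0 < ?N" using \<open>k < 2 * ?N\<close> by linarith
      ultimately show ?thesis using \<open>k < 2 * ?N\<close> by (simp add: div_add_self1)
    qed
    then show "k div ?N = (if k < ?N then 0 else 1)" "k mod ?N = (if k < ?N then k else k - ?N)"
      by auto
  qed
  show "four_block_mat (a \<cdot>\<^sub>m (1\<^sub>m m \<otimes>\<^sub>k 1\<^sub>m n)) (b \<cdot>\<^sub>m (1\<^sub>m m \<otimes>\<^sub>k 1\<^sub>m n))
     (c \<cdot>\<^sub>m (1\<^sub>m m \<otimes>\<^sub>k 1\<^sub>m n)) (d \<cdot>\<^sub>m (1\<^sub>m m \<otimes>\<^sub>k 1\<^sub>m n)) $$ (i, j)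
     = tensor (mat22 a b c d) (1\<^sub>m m) (1\<^sub>m n) $$ (i, j)"
    unfolding tensor_def kron_assoc kron_one
    using ij by (subst kron_index) (auto simp: dm)
qed (auto simp: tensor_def)

lemma two_sum: "(\<Sum>p<2. f p) = f 0 + f (Suc 0)" for f :: "nat \<Rightarrow> 'a::comm_monoid_add"
  by (simp add: numeral_2_eq_2)

lemma pair_index_less: "p < 2 \<Longrightarrow> q < N \<Longrightarrow> p * N + q < 2 * N" for p q N :: nat
  by (auto simp: less_2_cases_iff)

lemma mat22_kron_mult_index:
  assumes x: "x \<in> carrier_vec (2 * N)" and p: "p < 2" and q: "q < N"
  shows "((mat22 a b c d \<otimes>\<^sub>k 1\<^sub>m N) *\<^sub>v x) $ (p * N + q)
    = mat22 a b c d $$ (p, 0) * x $ q + mat22 a b c d $$ (p, Suc 0) * x $ (N + q)"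
proof -
  let ?C = "mat22 a b c d"
  note r = pair_index_less[OF p q]
  have dm: "(p * N + q) div N = p" "(p * N + q) mod N = q" using q by auto
  have "((?C \<otimes>\<^sub>k 1\<^sub>m N) *\<^sub>v x) $ (p * N + q) = (\<Sum>k<2 * N. (?C \<otimes>\<^sub>k 1\<^sub>m N) $$ (p * N + q, k) * x $ k)"
    using r x by (auto simp: scalar_prod_def lessThan_atLeast0 intro!: sum.cong)
  also have "\<dots> = (\<Sum>k<2 * N. ?C $$ (p, k div N) * (if q = k mod N then 1 else 0) * x $ (k div N * N + k mod N))"
    using r q by (intro sum.cong) (auto simp: kron_index dm div_mod_less)
  also have "\<dots> = (\<Sum>p'<2. \<Sum>q'<N. ?C $$ (p, p') * (if q = q' then 1 else 0) * x $ (p' * N + q'))"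
    by (rule sum_div_mod)
  also have "\<dots> = (\<Sum>p'<2. ?C $$ (p, p') * x $ (p' * N + q))"
    using q by (intro sum.cong refl) (simp add: if_distrib[of "\<lambda>z. _ * z"] if_distrib[of "\<lambda>z. z * _"] cong: if_cong)
  finally show ?thesis by (simp add: two_sum)
qed

text \<open>If the one-dimensional factors are diagonal, grid points decouple, and a quadrature of a
density that only couples the two components remains.\<close>

lemma tensor_diagonal_form:
  assumes c: "c \<in> carrier_mat 2 2"
    and A: "A \<in> carrier_mat m m" "diagonal_mat A" and B: "B \<in> carrier_mat n n" "diagonal_mat B"
    and x: "x \<in> carrier_vec (2 * m * n)" and y: "y \<in> carrier_vec (2 * m * n)"
  shows "x \<bullet>\<^sub>v (tensor c A B *\<^sub>v y) = (\<Sum>q<m * n. A $$ (q div n, q div n) * B $$ (q mod n, q mod n) *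
    (c $$ (0, 0) * x $ q * y $ q + c $$ (0, Suc 0) * x $ q * y $ (m * n + q)
     + c $$ (Suc 0, 0) * x $ (m * n + q) * y $ q
     + c $$ (Suc 0, Suc 0) * x $ (m * n + q) * y $ (m * n + q)))"
proof -
  let ?N = "m * n" and ?D = "A \<otimes>\<^sub>k B"
  have D: "?D \<in> carrier_mat ?N ?N" "diagonal_mat ?D"
    using A B by (auto intro: kron_carrier kron_diagonal)
  have D0: "?D $$ (q, q') = 0" if "q < ?N" "q' < ?N" "q' \<noteq> q" for q q'
    using D that unfolding diagonal_mat_def carrier_mat_def by (simp del: kron_dims)
  have "x \<bullet>\<^sub>v (tensor c A B *\<^sub>v y) = (\<Sum>p<2. \<Sum>q<?N. \<Sum>p'<2. \<Sum>q'<?N.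
      x $ (p * ?N + q) * (c $$ (p, p') * ?D $$ (q, q')) * y $ (p' * ?N + q'))"
    unfolding tensor_def kron_assoc using x y by (intro kron_form[OF c D(1)]) (simp_all add: mult.assoc)
  also have "\<dots> = (\<Sum>p<2. \<Sum>q<?N. \<Sum>p'<2.
      x $ (p * ?N + q) * (c $$ (p, p') * ?D $$ (q, q)) * y $ (p' * ?N + q))"
  proof (intro sum.cong refl)
    fix p q p' assume q: "q \<in> {..<?N}"
    have "(\<Sum>q'<?N. x $ (p * ?N + q) * (c $$ (p, p') * ?D $$ (q, q')) * y $ (p' * ?N + q'))
      = (\<Sum>q'<?N. if q' = q then x $ (p * ?N + q) * (c $$ (p, p') * ?D $$ (q, q)) * y $ (p' * ?N + q) else 0)"
      using q D0 by (intro sum.cong) auto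
    then show "(\<Sum>q'<?N. x $ (p * ?N + q) * (c $$ (p, p') * ?D $$ (q, q')) * y $ (p' * ?N + q'))
      = x $ (p * ?N + q) * (c $$ (p, p') * ?D $$ (q, q)) * y $ (p' * ?N + q)"
      using q by simp
  qed
  also have "\<dots> = (\<Sum>q<?N. \<Sum>p<2. \<Sum>p'<2.
      x $ (p * ?N + q) * (c $$ (p, p') * ?D $$ (q, q)) * y $ (p' * ?N + q))"
    by (rule sum.swap)
  also have "\<dots> = (\<Sum>q<?N. ?D $$ (q, q) * (c $$ (0, 0) * x $ q * y $ q + c $$ (0, Suc 0) * x $ q * y $ (?N + q)
     + c $$ (Suc 0, 0) * x $ (?N + q) * y $ q + c $$ (Suc 0, Suc 0) * x $ (?N + q) * y $ (?N + q)))"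
    by (intro sum.cong refl) (simp add: two_sum algebra_simps)
  also have "\<dots> = (\<Sum>q<m * n. A $$ (q div n, q div n) * B $$ (q mod n, q mod n) *
    (c $$ (0, 0) * x $ q * y $ q + c $$ (0, Suc 0) * x $ q * y $ (m * n + q)
     + c $$ (Suc 0, 0) * x $ (m * n + q) * y $ q
     + c $$ (Suc 0, Suc 0) * x $ (m * n + q) * y $ (m * n + q)))"
    using A(1) B(1) by (intro sum.cong refl) (simp add: kron_index)
  finally show ?thesis .
qed

lemma adjoint_scalar_prod:
  assumes "A \<in> carrier_mat n k" "x \<in> carrier_vec k" "y \<in> carrier_vec n"
  shows "(A *\<^sub>v x) \<bullet>\<^sub>v y = x \<bullet>\<^sub>v (transpose_mat A *\<^sub>v (y :: real vec))"
proof -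
  have "(A *\<^sub>v x) \<bullet>\<^sub>v y = y \<bullet>\<^sub>v (A *\<^sub>v x)"
    using assms by (intro comm_scalar_prod[of _ n]) auto
  also have "\<dots> = (transpose_mat A *\<^sub>v y) \<bullet>\<^sub>v x"
    using assms by (simp add: transpose_vec_mult_scalar)
  also have "\<dots> = x \<bullet>\<^sub>v (transpose_mat A *\<^sub>v y)"
    using assms by (intro comm_scalar_prod[of _ k]) auto
  finally show ?thesis .
qed

lemma tensor_form_conj:
  assumes c: "a \<in> carrier_mat 2 2" "c \<in> carrier_mat 2 2" "e \<in> carrier_mat 2 2"
    and A: "A \<in> carrier_mat m m" "C \<in> carrier_mat m m" "E \<in> carrier_mat m m"
    and B: "B \<in> carrier_mat n n" "D \<in> carrier_mat n n" "F \<in> carrier_mat n n"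
    and w: "w \<in> carrier_vec (2 * m * n)" and u: "u \<in> carrier_vec (2 * m * n)"
  shows "(tensor a A B *\<^sub>v w) \<bullet>\<^sub>v (tensor c C D *\<^sub>v (tensor e E F *\<^sub>v u))
    = w \<bullet>\<^sub>v (tensor (transpose_mat a * c * e) (transpose_mat A * C * E) (transpose_mat B * D * F) *\<^sub>v u)"
proof -
  let ?N = "2 * m * n"
  have tc: "tensor a A B \<in> carrier_mat ?N ?N" "tensor c C D \<in> carrier_mat ?N ?N" "tensor e E F \<in> carrier_mat ?N ?N"
    using c A B by auto
  have v: "tensor c C D *\<^sub>v (tensor e E F *\<^sub>v u) = tensor (c * e) (C * E) (D * F) *\<^sub>v u"
    using c A B u by (simp add: tensor_mult[of _ _ _ m _ _ n, symmetric] assoc_mult_mat_vec[OF tc(2,3)])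
  have ce: "tensor (c * e) (C * E) (D * F) \<in> carrier_mat ?N ?N"
    using c A B by (intro tensor_carrier) auto
  have at: "transpose_mat (tensor a A B) \<in> carrier_mat ?N ?N" using tc by simp
  have "(tensor a A B *\<^sub>v w) \<bullet>\<^sub>v (tensor (c * e) (C * E) (D * F) *\<^sub>v u)
     = w \<bullet>\<^sub>v (transpose_mat (tensor a A B) *\<^sub>v (tensor (c * e) (C * E) (D * F) *\<^sub>v u))"
    using ce u by (intro adjoint_scalar_prod[OF tc(1) w]) auto
  also have "\<dots> = w \<bullet>\<^sub>v ((transpose_mat (tensor a A B) * tensor (c * e) (C * E) (D * F)) *\<^sub>v u)"
    using at ce u by simp
  also have "transpose_mat (tensor a A B) * tensor (c * e) (C * E) (D * F)
      = tensor (transpose_mat a * c * e) (transpose_mat A * C * E) (transpose_mat B * D * F)"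
    unfolding tensor_transpose using c A B
    by (subst tensor_mult[of _ _ _ m _ _ n])
      (auto simp: assoc_mult_mat[of _ 2 2 _ 2 _ 2] assoc_mult_mat[of _ m m _ m _ m] assoc_mult_mat[of _ n n _ n _ n])
  finally show ?thesis unfolding v .
qed

section \<open>Summation by parts and the finite difference energy\<close>

abbreviation (input) hx :: "fd_dg \<Rightarrow> real mat" where "hx S \<equiv> quadH (sbp_x S)"
abbreviation (input) hy :: "fd_dg \<Rightarrow> real mat" where "hy S \<equiv> quadH (sbp_y S)"
abbreviation (input) dx :: "fd_dg \<Rightarrow> real mat" where "dx S \<equiv> opD1 (sbp_x S)"
abbreviation (input) dy :: "fd_dg \<Rightarrow> real mat" where "dy S \<equiv> opD1 (sbp_y S)"

text \<open>At every grid point, \<open>\<L>\<^sub>1\<close>, \<open>\<L>\<^sub>2\<close> and \<open>\<L>\<^sub>3\<close> act on the two components through these matrices.\<close>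

definition ell1 :: "fd_dg \<Rightarrow> real mat" where "ell1 S = mat22 (2 * mu_u S + lam_u S) 0 0 (mu_u S)"
definition ell2 :: "fd_dg \<Rightarrow> real mat" where "ell2 S = mat22 0 (lam_u S) (mu_u S) 0"
definition ell3 :: "fd_dg \<Rightarrow> real mat" where "ell3 S = mat22 (mu_u S) 0 0 (2 * mu_u S + lam_u S)"

lemma ell_carrier [simp]:
  "ell1 S \<in> carrier_mat 2 2" "ell2 S \<in> carrier_mat 2 2" "ell3 S \<in> carrier_mat 2 2"
  by (simp_all add: ell1_def ell2_def ell3_def)

lemma ell_symmetric [simp]: "transpose_mat (ell1 S) = ell1 S" "transpose_mat (ell3 S) = ell3 S"
  by (simp_all add: ell1_def ell3_def)

lemma full_tensor:
  "full_x S F = tensor (1\<^sub>m 2) F (1\<^sub>m (grid_n S))" "full_y S G = tensor (1\<^sub>m 2) (1\<^sub>m (grid_m S)) G"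
  by (simp_all add: full_x_def full_y_def tensor_def)

lemma L_tensor:
  "L1 S = tensor (ell1 S) (1\<^sub>m (grid_m S)) (1\<^sub>m (grid_n S))"
  "L2 S = tensor (ell2 S) (1\<^sub>m (grid_m S)) (1\<^sub>m (grid_n S))"
  "L3 S = tensor (ell3 S) (1\<^sub>m (grid_m S)) (1\<^sub>m (grid_n S))"
proof -
  have "O_u S = 0 \<cdot>\<^sub>m (1\<^sub>m (grid_m S) \<otimes>\<^sub>k 1\<^sub>m (grid_n S))"
    by (rule eq_matI) (auto simp: N_u_def)
  then show "L1 S = tensor (ell1 S) (1\<^sub>m (grid_m S)) (1\<^sub>m (grid_n S))"
    "L2 S = tensor (ell2 S) (1\<^sub>m (grid_m S)) (1\<^sub>m (grid_n S))"
    "L3 S = tensor (ell3 S) (1\<^sub>m (grid_m S)) (1\<^sub>m (grid_n S))"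
    unfolding L1_def L2_def L3_def ell1_def ell2_def ell3_def
    by (simp_all only: four_block_tensor)
qed

lemma diagonal_transpose: "A \<in> carrier_mat n n \<Longrightarrow> diagonal_mat A \<Longrightarrow> transpose_mat A = A"
  by (rule eq_matI) (auto simp: diagonal_mat_def, metis)

lemma B_carrier [simp]: "B_first N \<in> carrier_mat N N" "B_last N \<in> carrier_mat N N" "B_both N \<in> carrier_mat N N"
  by (auto simp: B_first_def B_last_def B_both_def)

lemma B_first_diagonal: "diagonal_mat (B_first N)"
  by (auto simp: B_first_def diagonal_mat_def)

lemma B_first_idem: "B_first N * B_first N = B_first N"
proof -
  have "B_first N = mat_diag N (\<lambda>i. if i = 0 then 1 else 0)"
    by (rule eq_matI) (auto simp: B_first_def mat_diag_def)
  then show ?thesis by (simp add: if_distrib cong: if_cong)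
qed

text \<open>The identities for second derivatives are cleared of the inverse norm, which is how they enter after
multiplication by \<open>\<H>\<close>.\<close>

lemma sbp_facts:
  assumes "sbp_property p N h F"
  shows sbp_H_carrier: "quadH F \<in> carrier_mat N N" and sbp_H_diagonal: "diagonal_mat (quadH F)"
    and sbp_H_pos: "\<And>i. i < N \<Longrightarrow> 0 < quadH F $$ (i, i)"
    and sbp_D1_carrier: "opD1 F \<in> carrier_mat N N" and sbp_D2_carrier: "opD2 F \<in> carrier_mat N N"
    and sbp_A_carrier: "opA F \<in> carrier_mat N N" and sbp_S_carrier: "opS F \<in> carrier_mat N N"
    and sbp_H_symmetric: "transpose_mat (quadH F) = quadH F"
    and sbp_first: "quadH F * opD1 F + transpose_mat (opD1 F) * quadH F = B_both N"
    and sbp_second: "quadH F * opD2 F = - opA F + B_both N * opS F"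
    and sbp_second_full: "\<And>R. R \<in> carrier_mat N N \<Longrightarrow>
      opD2 F = minv (quadH F) * (- (transpose_mat (opD1 F) * quadH F * opD1 F) - R + B_both N * opD1 F) \<Longrightarrow>
      quadH F * opD2 F = - (transpose_mat (opD1 F) * quadH F * opD1 F) - R + B_both N * opD1 F"
proof -
  note d = assms[unfolded sbp_property_def sym_psd_def boundary_derivative_def]
  show c: "quadH F \<in> carrier_mat N N" "diagonal_mat (quadH F)" "\<And>i. i < N \<Longrightarrow> 0 < quadH F $$ (i, i)"
    "opD1 F \<in> carrier_mat N N" "opD2 F \<in> carrier_mat N N" "opA F \<in> carrier_mat N N"
    "opS F \<in> carrier_mat N N"
    using d by auto
  show t: "transpose_mat (quadH F) = quadH F" using c by (rule_tac diagonal_transpose)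
  show "quadH F * opD1 F + transpose_mat (opD1 F) * quadH F = B_both N"
    using d transpose_mult[OF c(1,4)] t by simp
  have "quadH F $$ (i, i) \<noteq> 0" if "i < N" for i using c(3)[OF that] by simp
  note inv = diagonal_minv[OF c(1,2) this]
  have cancel: "quadH F * (minv (quadH F) * X) = X" if "X \<in> carrier_mat N N" for X
    using assoc_mult_mat[OF c(1) inv(1) that] inv(2) that by simp
  show "quadH F * opD2 F = - opA F + B_both N * opS F"
    using d c cancel[of "- opA F + B_both N * opS F"]
    by (metis B_carrier(3) add_carrier_mat mult_carrier_mat)
  show "quadH F * opD2 F = - (transpose_mat (opD1 F) * quadH F * opD1 F) - R + B_both N * opD1 F"
    if "R \<in> carrier_mat N N" and
      e: "opD2 F = minv (quadH F) * (- (transpose_mat (opD1 F) * quadH F * opD1 F) - R + B_both N * opD1 F)"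
    for R
    unfolding e by (intro cancel add_carrier_mat mult_carrier_mat[OF B_carrier(3)] c)
qed

lemma fd_sbp:
  assumes "fd_setting S"
  shows "sbp_property (sbp_p S) (grid_m S) (h_u S) (sbp_x S)"
    "sbp_property (sbp_p S) (grid_n S) (h_y S) (sbp_y S)"
  using assms by (auto simp: fd_setting_def)

text \<open>The first four summands are the quadrature of the elastic energy density, a quadratic form in the
difference quotients; the last two come from the remainders by which compatible second
derivatives differ from repeated first derivatives.\<close>

definition fd_energy :: "fd_dg \<Rightarrow> real mat \<Rightarrow> real mat \<Rightarrow> real vec \<Rightarrow> real vec \<Rightarrow> real" where
  "fd_energy S Rx Ry w u =
     (Dx S *\<^sub>v w) \<bullet>\<^sub>v (tensor (ell1 S) (hx S) (hy S) *\<^sub>v (Dx S *\<^sub>v u))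
   + (Dy S *\<^sub>v w) \<bullet>\<^sub>v (tensor (ell3 S) (hx S) (hy S) *\<^sub>v (Dy S *\<^sub>v u))
   + ((Dx S *\<^sub>v w) \<bullet>\<^sub>v (tensor (ell2 S) (hx S) (hy S) *\<^sub>v (Dy S *\<^sub>v u))
      + (Dx S *\<^sub>v u) \<bullet>\<^sub>v (tensor (ell2 S) (hx S) (hy S) *\<^sub>v (Dy S *\<^sub>v w)))
   + (w \<bullet>\<^sub>v (tensor (ell1 S) Rx (hy S) *\<^sub>v u) + w \<bullet>\<^sub>v (tensor (ell3 S) (hx S) Ry *\<^sub>v u))"

text \<open>Discrete integration by parts. In the mixed term, \<open>\<L>\<^sub>2\<close> is integrated by parts in \<open>x\<close> and its transpose in
\<open>y\<close>, so that the boundary terms combine with those of the pure second derivatives to the tractions \<open>Tx\<close>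
and \<open>Ty\<close>. Those on the outer sides are cancelled by the outer penalty.\<close>

lemma fd_interior_form:
  assumes fd: "fd_setting S"
    and Rx: "Rx \<in> carrier_mat (grid_m S) (grid_m S)"
      "opA (sbp_x S) = transpose_mat (dx S) * hx S * dx S + Rx"
    and Ry: "Ry \<in> carrier_mat (grid_n S) (grid_n S)"
      "opD2 (sbp_y S) = minv (hy S)
         * (- (transpose_mat (dy S) * hy S * dy S) - Ry + B_both (grid_n S) * dy S)"
    and w: "w \<in> carrier_vec (2 * grid_m S * grid_n S)" and u: "u \<in> carrier_vec (2 * grid_m S * grid_n S)"
  shows "w \<bullet>\<^sub>v ((Hfull S * (L1 S * Dxx S)) *\<^sub>v u) + w \<bullet>\<^sub>v ((Hfull S * (L3 S * Dyy S)) *\<^sub>v u)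
     + w \<bullet>\<^sub>v ((Hfull S * ((L2 S + transpose_mat (L2 S)) * Dxy S)) *\<^sub>v u) + w \<bullet>\<^sub>v (outer_penalty S *\<^sub>v u)
     = - fd_energy S Rx Ry w u + w \<bullet>\<^sub>v ((Hx S * Tu S) *\<^sub>v u)"
proof -
  define m n where "m = grid_m S" and "n = grid_n S"
  let ?N = "2 * m * n" and ?I = "1\<^sub>m 2 :: real mat"
  define Hx' Hy' Dx' Dy' Sx where "Hx' = hx S" and "Hy' = hy S" and "Dx' = dx S" and "Dy' = dy S"
    and "Sx = opS (sbp_x S)"
  define DxT DyT where "DxT = transpose_mat Dx'" and "DyT = transpose_mat Dy'"
  define Dxx' Dyy' where "Dxx' = opD2 (sbp_x S)" and "Dyy' = opD2 (sbp_y S)"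
  define Bx By Bn B0 where "Bx = B_both m" and "By = B_both n" and "Bn = B_last n" and "B0 = B_first n"
  define l1 l2 l3 l2T where "l1 = ell1 S" and "l2 = ell2 S" and "l3 = ell3 S" and "l2T = transpose_mat (ell2 S)"
  note loc = m_def n_def Hx'_def Hy'_def Dx'_def Dy'_def Sx_def DxT_def DyT_def Dxx'_def Dyy'_def
    Bx_def By_def Bn_def B0_def l1_def l2_def l3_def l2T_def
  note sx = sbp_facts[OF fd_sbp(1)[OF fd], folded loc] and sy = sbp_facts[OF fd_sbp(2)[OF fd], folded loc]
  note R = Rx[folded loc] Ry[folded loc]
  note w = w[folded loc] and u = u[folded loc]
  have cx: "Hx' \<in> carrier_mat m m" "Dx' \<in> carrier_mat m m" "Dxx' \<in> carrier_mat m m" "Sx \<in> carrier_mat m m"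
    "DxT \<in> carrier_mat m m" "Bx \<in> carrier_mat m m" "Rx \<in> carrier_mat m m"
    using sx R by (simp_all add: loc)
  have cy: "Hy' \<in> carrier_mat n n" "Dy' \<in> carrier_mat n n" "Dyy' \<in> carrier_mat n n"
    "DyT \<in> carrier_mat n n" "By \<in> carrier_mat n n" "Bn \<in> carrier_mat n n" "B0 \<in> carrier_mat n n"
    "Ry \<in> carrier_mat n n"
    using sy R by (simp_all add: loc)
  have cl: "l1 \<in> carrier_mat 2 2" "l2 \<in> carrier_mat 2 2" "l3 \<in> carrier_mat 2 2" "l2T \<in> carrier_mat 2 2"
    "?I \<in> carrier_mat 2 2"
    by (simp_all add: loc)
  note cs = cx cy cl
  have cm: "\<And>A B k. A \<in> carrier_mat k k \<Longrightarrow> B \<in> carrier_mat k k \<Longrightarrow> A * B \<in> carrier_mat k k"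
    by (rule mult_carrier_mat)
  let ?t = "\<lambda>c A B. w \<bullet>\<^sub>v (tensor c A B *\<^sub>v u)"
  have addform: "w \<bullet>\<^sub>v ((P + Q) *\<^sub>v u) = w \<bullet>\<^sub>v (P *\<^sub>v u) + w \<bullet>\<^sub>v (Q *\<^sub>v u)"
    if "P \<in> carrier_mat ?N ?N" "Q \<in> carrier_mat ?N ?N" for P Q
    using that w u by (simp add: add_mult_distrib_mat_vec[of _ ?N ?N] scalar_prod_add_distrib[of _ ?N])
  have negform: "w \<bullet>\<^sub>v ((- P) *\<^sub>v u) = - (w \<bullet>\<^sub>v (P *\<^sub>v u))"
    if "P \<in> carrier_mat ?N ?N" for P
    using that w u by simp
  have tadd: "c \<in> carrier_mat 2 2 \<Longrightarrow> c' \<in> carrier_mat 2 2 \<Longrightarrow> A \<in> carrier_mat m m \<Longrightarrow> B \<in> carrier_mat n n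
      \<Longrightarrow> ?t (c + c') A B = ?t c A B + ?t c' A B"
    "c \<in> carrier_mat 2 2 \<Longrightarrow> A \<in> carrier_mat m m \<Longrightarrow> A' \<in> carrier_mat m m \<Longrightarrow> B \<in> carrier_mat n n
      \<Longrightarrow> ?t c (A + A') B = ?t c A B + ?t c A' B"
    "c \<in> carrier_mat 2 2 \<Longrightarrow> A \<in> carrier_mat m m \<Longrightarrow> B \<in> carrier_mat n n \<Longrightarrow> B' \<in> carrier_mat n n
      \<Longrightarrow> ?t c A (B + B') = ?t c A B + ?t c A B'" for c c' A A' B B'
    by (simp_all add: tensor_add[of _ 2 2] tensor_add[of _ m m] tensor_add[of _ n n] addform)
  have tneg: "c \<in> carrier_mat 2 2 \<Longrightarrow> A \<in> carrier_mat m m \<Longrightarrow> B \<in> carrier_mat n n \<Longrightarrow> ?t c (- A) B = - ?t c A B"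
    "c \<in> carrier_mat 2 2 \<Longrightarrow> A \<in> carrier_mat m m \<Longrightarrow> B \<in> carrier_mat n n \<Longrightarrow> ?t c A (- B) = - ?t c A B" for c A B
    by (simp_all add: tensor_uminus negform)
  have minus_add: "A - B = A + - B" if "A \<in> carrier_mat k k" "B \<in> carrier_mat k k" for A B :: "real mat" and k
    using that by (intro eq_matI) auto
  note ones = left_mult_one_mat[OF cx(1)] left_mult_one_mat[OF cx(2)]
  have T: "Dx S = tensor ?I Dx' (1\<^sub>m n)" "Dy S = tensor ?I (1\<^sub>m m) Dy'" "Hx S = tensor ?I Hx' (1\<^sub>m n)"
    "Hy S = tensor ?I (1\<^sub>m m) Hy'" "Dxx S = tensor ?I Dxx' (1\<^sub>m n)" "Dyy S = tensor ?I (1\<^sub>m m) Dyy'"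
    "L1 S = tensor l1 (1\<^sub>m m) (1\<^sub>m n)" "L2 S = tensor l2 (1\<^sub>m m) (1\<^sub>m n)" "L3 S = tensor l3 (1\<^sub>m m) (1\<^sub>m n)"
    "transpose_mat (L2 S) = tensor l2T (1\<^sub>m m) (1\<^sub>m n)" "BGam S = tensor ?I (1\<^sub>m m) B0"
    by (simp_all add: Dx_def Dy_def Hx_def Hy_def Dxx_def Dyy_def BGam_def full_tensor L_tensor loc tensor_transpose)
  have mult: "tensor c A B * tensor c' A' B' = tensor (c * c') (A * A') (B * B')"
    if "c \<in> carrier_mat 2 2" "c' \<in> carrier_mat 2 2" "A \<in> carrier_mat m m" "A' \<in> carrier_mat m m"
    "B \<in> carrier_mat n n" "B' \<in> carrier_mat n n" for c c' A A' B B'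
    using that by (rule tensor_mult)
  have Hfull: "Hfull S = tensor ?I Hx' Hy'"
    using cs by (simp add: Hfull_def T mult)
  have e1: "Hfull S * (L1 S * Dxx S) = tensor l1 (Hx' * Dxx') Hy'"
    using cs by (simp add: Hfull T mult cm)
  have e2: "Hfull S * (L3 S * Dyy S) = tensor l3 Hx' (Hy' * Dyy')"
    using cs by (simp add: Hfull T mult cm)
  have e3: "Hfull S * ((L2 S + transpose_mat (L2 S)) * Dxy S) = tensor (l2 + l2T) (Hx' * Dx') (Hy' * Dy')"
    unfolding T(10) using cs by (simp add: Hfull T mult cm Dxy_def tensor_add(1)[of _ 2 2, symmetric])
  have tc: "c \<in> carrier_mat 2 2 \<Longrightarrow> A \<in> carrier_mat m m \<Longrightarrow> B \<in> carrier_mat n n \<Longrightarrow> tensor c A B \<in> carrier_mat ?N ?N" for c A B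
    by simp
  have outer: "outer_penalty S = - (tensor l1 (Bx * Sx) Hy' + tensor l2 Bx (Hy' * Dy')
      + (tensor l3 Hx' (Bn * Dy') + tensor l2T (Hx' * Dx') Bn))"
    using cs unfolding outer_penalty_def Tx_def Ty_def full_tensor T(10) unfolding T m_def[symmetric] n_def[symmetric]
      Bx_def[symmetric] Bn_def[symmetric] Sx_def[symmetric]
    by (simp add: mult cm mult_add_distrib_mat[OF tc tc tc])
  have mult_neg: "A * - B = - (A * B)" if "A \<in> carrier_mat ?N ?N" "B \<in> carrier_mat ?N ?N" for A B :: "real mat"
    using that by simp
  have HTu: "Hx S * Tu S = - (tensor l3 Hx' (B0 * Dy') + tensor l2T (Hx' * Dx') B0)"
    using cs unfolding Tu_def Ty_def T(10) unfolding T by (simp add: mult cm mult_neg tc mult_add_distrib_mat[OF tc tc tc])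
  have ones: "1\<^sub>m k * A = A" "A * 1\<^sub>m k = A" if "A \<in> carrier_mat k k" for A :: "real mat" and k
    using that by simp_all
  have Dxu: "Dx S *\<^sub>v u \<in> carrier_vec ?N" "Dy S *\<^sub>v w \<in> carrier_vec ?N"
    unfolding T using cs u w by (auto intro!: mult_mat_vec_carrier tc)
  have l2c: "tensor l2 Hx' Hy' \<in> carrier_mat ?N ?N"
    by (intro tc cs)
  have l2t: "transpose_mat (tensor l2 Hx' Hy') = tensor l2T Hx' Hy'"
    unfolding tensor_transpose sx(8) sy(8) by (simp add: l2T_def l2_def)
  have sw: "(Dx S *\<^sub>v u) \<bullet>\<^sub>v (tensor l2 Hx' Hy' *\<^sub>v (Dy S *\<^sub>v w)) = (Dy S *\<^sub>v w) \<bullet>\<^sub>v (tensor l2T Hx' Hy' *\<^sub>v (Dx S *\<^sub>v u))"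
    unfolding comm_scalar_prod[OF Dxu(1) mult_mat_vec_carrier[OF l2c Dxu(2)]]
      adjoint_scalar_prod[OF l2c Dxu(2,1)] l2t ..
  have K: "fd_energy S Rx Ry w u = ?t l1 (DxT * Hx' * Dx') Hy' + ?t l3 Hx' (DyT * Hy' * Dy')
     + (?t l2 (DxT * Hx') (Hy' * Dy') + ?t l2T (Hx' * Dx') (DyT * Hy')) + (?t l1 Rx Hy' + ?t l3 Hx' Ry)"
    unfolding fd_energy_def l1_def[symmetric] l2_def[symmetric] l3_def[symmetric] Hx'_def[symmetric] Hy'_def[symmetric] sw
    unfolding T using cs w u
    by (simp add: tensor_form_conj[of _ _ _ _ m _ _ _ n] DxT_def DyT_def ones cm)
  have 1: "?t l1 (Hx' * Dxx') Hy' = - ?t l1 (DxT * Hx' * Dx') Hy' - ?t l1 Rx Hy' + ?t l1 (Bx * Sx) Hy'"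
    unfolding sx(10) R(2) using cs by (simp add: tadd tneg cm)
  have 2: "?t l3 Hx' (Hy' * Dyy') = - ?t l3 Hx' (DyT * Hy' * Dy') - ?t l3 Hx' Ry + ?t l3 Hx' (By * Dy')"
    unfolding sy(11)[OF R(3,4)] using cs by (simp add: tadd tneg cm minus_add[of _ n])
  have By: "By = Bn + - B0" unfolding loc B_both_def by (intro eq_matI) (auto simp: B_last_def B_first_def)
  have 3: "?t l3 Hx' (By * Dy') = ?t l3 Hx' (Bn * Dy') - ?t l3 Hx' (B0 * Dy')"
    unfolding By using cs by (simp add: tadd tneg cm add_mult_distrib_mat[of _ n n])
  have 4: "?t l2 (Hx' * Dx') (Hy' * Dy') + ?t l2 (DxT * Hx') (Hy' * Dy') = ?t l2 Bx (Hy' * Dy')"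
    unfolding sx(9)[symmetric] using cs by (simp add: tadd cm)
  have 5: "?t l2T (Hx' * Dx') (Hy' * Dy') + ?t l2T (Hx' * Dx') (DyT * Hy') = ?t l2T (Hx' * Dx') Bn - ?t l2T (Hx' * Dx') B0"
    using arg_cong[OF sy(9), of "?t l2T (Hx' * Dx')"] cs unfolding By by (simp add: tadd tneg cm)
  have 6: "w \<bullet>\<^sub>v (outer_penalty S *\<^sub>v u) = - (?t l1 (Bx * Sx) Hy' + ?t l2 Bx (Hy' * Dy')
      + (?t l3 Hx' (Bn * Dy') + ?t l2T (Hx' * Dx') Bn))"
    unfolding outer using cs by (simp add: addform negform cm tc)
  have 7: "w \<bullet>\<^sub>v ((Hx S * Tu S) *\<^sub>v u) = - (?t l3 Hx' (B0 * Dy') + ?t l2T (Hx' * Dx') B0)"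
    unfolding HTu using cs by (simp add: addform negform cm tc)
  have 8: "?t (l2 + l2T) (Hx' * Dx') (Hy' * Dy') = ?t l2 (Hx' * Dx') (Hy' * Dy') + ?t l2T (Hx' * Dx') (Hy' * Dy')"
    using cs by (simp add: tadd cm)
  show ?thesis
    unfolding e1 e2 e3 K 6 7 8 1 2 3 using 4 5 by simp
qed

lemma sym_bilinear_mat:
  assumes A: "A \<in> carrier_mat n n" "transpose_mat A = A"
  shows "sym_bilinear n (\<lambda>x y. x \<bullet>\<^sub>v (A *\<^sub>v y))"
proof -
  have "x \<bullet>\<^sub>v (A *\<^sub>v y) = y \<bullet>\<^sub>v (A *\<^sub>v x)" if "x \<in> carrier_vec n" "y \<in> carrier_vec n" for x y
    using adjoint_scalar_prod[OF A(1) that] A that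
    by (simp add: comm_scalar_prod[of _ n])
  moreover have "A *\<^sub>v x \<in> carrier_vec n" if "x \<in> carrier_vec n" for x
    using A that by simp
  ultimately show ?thesis
    unfolding sym_bilinear_def
    by (intro conjI ballI allI)
      (simp_all only: add_scalar_prod_distrib[of _ n] smult_scalar_prod_distrib[of _ n])
qed

lemma fd_operator_carrier:
  assumes "fd_setting S"
  defines "N \<equiv> 2 * grid_m S * grid_n S"
  shows "Dx S \<in> carrier_mat N N" "Dy S \<in> carrier_mat N N" "Hx S \<in> carrier_mat N N"
    "Hy S \<in> carrier_mat N N" "Hfull S \<in> carrier_mat N N" "BGam S \<in> carrier_mat N N"
    "Dxx S \<in> carrier_mat N N" "Dyy S \<in> carrier_mat N N" "Dxy S \<in> carrier_mat N N"
    "L1 S \<in> carrier_mat N N" "L2 S \<in> carrier_mat N N" "L3 S \<in> carrier_mat N N"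
    "Ty S \<in> carrier_mat N N" "Tu S \<in> carrier_mat N N" "outer_penalty S \<in> carrier_mat N N"
proof -
  note s = sbp_facts[OF fd_sbp(1)[OF assms(1)]] sbp_facts[OF fd_sbp(2)[OF assms(1)]]
  show c: "Dx S \<in> carrier_mat N N" "Dy S \<in> carrier_mat N N" "Hx S \<in> carrier_mat N N"
    "Hy S \<in> carrier_mat N N" "BGam S \<in> carrier_mat N N"
    "Dxx S \<in> carrier_mat N N" "Dyy S \<in> carrier_mat N N"
    "L1 S \<in> carrier_mat N N" "L2 S \<in> carrier_mat N N" "L3 S \<in> carrier_mat N N"
    using s unfolding N_def by (auto simp: Dx_def Dy_def Hx_def Hy_def Dxx_def Dyy_def BGam_def full_tensor L_tensor)
  show d: "Hfull S \<in> carrier_mat N N" "Dxy S \<in> carrier_mat N N" "Ty S \<in> carrier_mat N N"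
    using c by (auto simp: Hfull_def Dxy_def Ty_def intro!: mult_carrier_mat add_carrier_mat)
  show "Tu S \<in> carrier_mat N N" using c d by (auto simp: Tu_def)
  have f: "full_x S (B_both (grid_m S)) \<in> carrier_mat N N" "full_y S (B_last (grid_n S)) \<in> carrier_mat N N"
    "full_x S (opS (sbp_x S)) \<in> carrier_mat N N"
    using s unfolding N_def full_tensor by auto
  then have "Tx S \<in> carrier_mat N N" using c unfolding Tx_def by (auto intro!: mult_carrier_mat add_carrier_mat)
  with f show "outer_penalty S \<in> carrier_mat N N" using c d unfolding outer_penalty_def
    by (auto intro!: mult_carrier_mat[of _ N N] add_carrier_mat)
qed

lemma fd_H_symmetric:
  assumes "fd_setting S"
  shows "transpose_mat (Hx S) = Hx S"
  using sbp_facts(8)[OF fd_sbp(1)[OF assms]] by (simp add: Hx_def full_tensor tensor_transpose)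

lemma fd_energy_sym_bilinear:
  assumes fd: "fd_setting S" and R: "sym_psd (grid_m S) Rx" "sym_psd (grid_n S) Ry"
  shows "sym_bilinear (2 * grid_m S * grid_n S) (fd_energy S Rx Ry)"
proof -
  let ?N = "2 * grid_m S * grid_n S"
  note s = sbp_facts[OF fd_sbp(1)[OF fd]] sbp_facts[OF fd_sbp(2)[OF fd]]
  note c = fd_operator_carrier[OF fd]
  have Rc: "Rx \<in> carrier_mat (grid_m S) (grid_m S)" "Ry \<in> carrier_mat (grid_n S) (grid_n S)"
    "transpose_mat Rx = Rx" "transpose_mat Ry = Ry"
    using R by (auto simp: sym_psd_def)
  have D: "lin_map ?N ?N (\<lambda>u. Dx S *\<^sub>v u)" "lin_map ?N ?N (\<lambda>u. Dy S *\<^sub>v u)"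
    using c by (auto intro: lin_map_mat)
  have T: "tensor (ell1 S) (hx S) (hy S) \<in> carrier_mat ?N ?N" "tensor (ell2 S) (hx S) (hy S) \<in> carrier_mat ?N ?N"
    "tensor (ell3 S) (hx S) (hy S) \<in> carrier_mat ?N ?N" "tensor (ell1 S) Rx (hy S) \<in> carrier_mat ?N ?N"
    "tensor (ell3 S) (hx S) Ry \<in> carrier_mat ?N ?N"
    using s Rc by auto
  have sym: "transpose_mat (tensor (ell1 S) (hx S) (hy S)) = tensor (ell1 S) (hx S) (hy S)"
    "transpose_mat (tensor (ell3 S) (hx S) (hy S)) = tensor (ell3 S) (hx S) (hy S)"
    "transpose_mat (tensor (ell1 S) Rx (hy S)) = tensor (ell1 S) Rx (hy S)"
    "transpose_mat (tensor (ell3 S) (hx S) Ry) = tensor (ell3 S) (hx S) Ry"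
    using s Rc by (simp_all add: tensor_transpose)
  show ?thesis
    unfolding fd_energy_def
    by (intro sym_bilinear_cross[OF sym_bilinear_scalar_prod D(1) lin_map_comp[OF D(2) lin_map_mat[OF T(2)]]] sym_bilinear_add
        sym_bilinear_pullback[OF sym_bilinear_mat[OF T(1) sym(1)] D(1)]
        sym_bilinear_pullback[OF sym_bilinear_mat[OF T(3) sym(2)] D(2)]
        sym_bilinear_mat T sym)
qed

text \<open>With \<open>a\<close> and \<open>b\<close> the derivatives in \<open>x\<close> and \<open>y\<close>, the left-hand side is the squared traction on a horizontal
line and the last factor the energy density. The difference of the two sides is
\<open>\<mu> (\<mu> + \<lambda>) (b\<^sub>0 + a\<^sub>1)\<^sup>2 + 4 \<mu> (\<mu> + \<lambda>) a\<^sub>0\<^sup>2\<close>.\<close>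

lemma plane_strain_traction_bound:
  fixes mu lam a0 a1 b0 b1 :: real
  assumes "0 < mu" "0 < lam"
  shows "(mu * b0 + mu * a1)\<^sup>2 + ((2 * mu + lam) * b1 + lam * a0)\<^sup>2
    \<le> (2 * mu + lam) * ((2 * mu + lam) * a0\<^sup>2 + mu * a1\<^sup>2 + mu * b0\<^sup>2 + (2 * mu + lam) * b1\<^sup>2
        + 2 * (lam * a0 * b1 + mu * a1 * b0))"
proof -
  have "0 \<le> mu * (mu + lam) * (b0 + a1)\<^sup>2 + 4 * mu * (mu + lam) * a0\<^sup>2"
    using assms by simp
  then show ?thesis by (simp add: power2_eq_square algebra_simps)
qed

text \<open>The squared traction is pointwise bounded by the energy density, and the grid line on \<open>\<Gamma>\<close> contributes
its energy density to the total with the weight \<open>\<H>\<^sub>y(0, 0)\<close>.\<close>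

lemma fd_traction_bound:
  assumes fd: "fd_setting S" and R: "sym_psd (grid_m S) Rx" "sym_psd (grid_n S) Ry"
    and pos: "0 < mu_u S" "0 < lam_u S"
    and u: "u \<in> carrier_vec (2 * grid_m S * grid_n S)"
  shows "hy S $$ (0, 0) * ((Tu S *\<^sub>v u) \<bullet>\<^sub>v (Hx S *\<^sub>v (Tu S *\<^sub>v u)))
    \<le> (2 * mu_u S + lam_u S) * fd_energy S Rx Ry u u"
proof -
  define m n where "m = grid_m S" and "n = grid_n S"
  let ?N = "m * n" and ?chi = "2 * mu_u S + lam_u S"
  note c = fd_operator_carrier[OF fd, folded m_def n_def]
  note u = u[folded m_def n_def]
  note sx = sbp_facts[OF fd_sbp(1)[OF fd], folded m_def] and sy = sbp_facts[OF fd_sbp(2)[OF fd], folded n_def]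
  have Rc: "Rx \<in> carrier_mat m m" "Ry \<in> carrier_mat n n"
    "\<And>x. x \<in> carrier_vec m \<Longrightarrow> 0 \<le> x \<bullet>\<^sub>v (Rx *\<^sub>v x)" "\<And>x. x \<in> carrier_vec n \<Longrightarrow> 0 \<le> x \<bullet>\<^sub>v (Ry *\<^sub>v x)"
    using R by (auto simp: sym_psd_def m_def n_def)
  have n0: "0 < n" using fd by (simp add: n_def fd_setting_def)
  define a b where "a = Dx S *\<^sub>v u" and "b = Dy S *\<^sub>v u"
  have ab: "a \<in> carrier_vec (2 * m * n)" "b \<in> carrier_vec (2 * m * n)"
    using c u by (auto simp: a_def b_def)
  define z where "z = Ty S *\<^sub>v u"
  have z: "z \<in> carrier_vec (2 * m * n)" using c u by (auto simp: z_def)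
  have z': "z = L3 S *\<^sub>v b + transpose_mat (L2 S) *\<^sub>v a"
    unfolding z_def a_def b_def Ty_def using c u
    by (simp add: add_mult_distrib_mat_vec[of _ "2 * m * n" "2 * m * n"] assoc_mult_mat_vec[of _ "2 * m * n" "2 * m * n" _ "2 * m * n"])
  have idx: "L3 S *\<^sub>v b = (mat22 (mu_u S) 0 0 ?chi \<otimes>\<^sub>k 1\<^sub>m ?N) *\<^sub>v b"
    "transpose_mat (L2 S) *\<^sub>v a = (mat22 0 (mu_u S) (lam_u S) 0 \<otimes>\<^sub>k 1\<^sub>m ?N) *\<^sub>v a"
    by (simp_all add: L_tensor ell3_def ell2_def tensor_transpose)
      (simp_all add: tensor_def kron_assoc kron_one m_def n_def)
  have zq: "z $ q = mu_u S * b $ q + mu_u S * a $ (?N + q)"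
    "z $ (?N + q) = ?chi * b $ (?N + q) + lam_u S * a $ q" if q: "q < ?N" for q
  proof -
    have ab': "a \<in> carrier_vec (2 * ?N)" "b \<in> carrier_vec (2 * ?N)" using ab by (simp_all add: mult.assoc)
    note i = mat22_kron_mult_index[OF ab'(1) _ q] mat22_kron_mult_index[OF ab'(2) _ q]
    show "z $ q = mu_u S * b $ q + mu_u S * a $ (?N + q)"
      unfolding z' idx using i(1)[of 0] i(2)[of 0] q ab'
      by (subst index_add_vec) (auto simp: mat22_def[of _ _ _ _])
    show "z $ (?N + q) = ?chi * b $ (?N + q) + lam_u S * a $ q"
      unfolding z' idx using i(1)[of 1] i(2)[of 1] q ab'
      by (subst index_add_vec) auto
  qed
  let ?h = "\<lambda>q. hx S $$ (q div n, q div n) * hy S $$ (q mod n, q mod n)"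
  let ?e = "\<lambda>q. ?chi * (a $ q)\<^sup>2 + mu_u S * (a $ (?N + q))\<^sup>2 + mu_u S * (b $ q)\<^sup>2 + ?chi * (b $ (?N + q))\<^sup>2
        + 2 * (lam_u S * a $ q * b $ (?N + q) + mu_u S * a $ (?N + q) * b $ q)"
  note diag = sx(1,2) sy(1,2)
  have bulk: "a \<bullet>\<^sub>v (tensor (ell1 S) (hx S) (hy S) *\<^sub>v a) + b \<bullet>\<^sub>v (tensor (ell3 S) (hx S) (hy S) *\<^sub>v b)
      + (a \<bullet>\<^sub>v (tensor (ell2 S) (hx S) (hy S) *\<^sub>v b) + a \<bullet>\<^sub>v (tensor (ell2 S) (hx S) (hy S) *\<^sub>v b))
      = (\<Sum>q<?N. ?h q * ?e q)"
    unfolding tensor_diagonal_form[OF ell_carrier(1) diag ab(1) ab(1)]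
      tensor_diagonal_form[OF ell_carrier(3) diag ab(2) ab(2)]
      tensor_diagonal_form[OF ell_carrier(2) diag ab(1) ab(2)] sum.distrib[symmetric]
    by (intro sum.cong refl) (simp add: ell1_def ell2_def ell3_def power2_eq_square algebra_simps)
  have B0: "B_first n \<in> carrier_mat n n" "diagonal_mat (B_first n)"
    "transpose_mat (B_first n) * 1\<^sub>m n * B_first n = B_first n"
    by (simp_all add: B_first_diagonal diagonal_transpose[OF B_carrier(1) B_first_diagonal]
        right_mult_one_mat[OF B_carrier(1)] B_first_idem)
  have Tuz: "Tu S *\<^sub>v u = - (BGam S *\<^sub>v z)"
    unfolding Tu_def z_def using c u by (simp add: assoc_mult_mat_vec[of _ "2 * m * n" "2 * m * n" _ "2 * m * n"])
  have Bz: "BGam S *\<^sub>v z \<in> carrier_vec (2 * m * n)" using c z by auto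
  have "(Tu S *\<^sub>v u) \<bullet>\<^sub>v (Hx S *\<^sub>v (Tu S *\<^sub>v u)) = (BGam S *\<^sub>v z) \<bullet>\<^sub>v (Hx S *\<^sub>v (BGam S *\<^sub>v z))"
  proof -
    have "Hx S *\<^sub>v (- (BGam S *\<^sub>v z)) = - (Hx S *\<^sub>v (BGam S *\<^sub>v z))"
      using c Bz by (intro eq_vecI) auto
    then show ?thesis unfolding Tuz using c Bz by simp
  qed
  also have "\<dots> = z \<bullet>\<^sub>v (tensor (1\<^sub>m 2) (hx S) (B_first n) *\<^sub>v z)"
    unfolding BGam_def Hx_def full_tensor m_def[symmetric] n_def[symmetric]
    using z sx B0 by (subst tensor_form_conj[of _ _ _ _ m _ _ _ n]) simp_all
  also have "\<dots> = (\<Sum>q<?N. hx S $$ (q div n, q div n) * B_first n $$ (q mod n, q mod n) *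
      ((z $ q)\<^sup>2 + (z $ (?N + q))\<^sup>2))"
    using tensor_diagonal_form[OF one_carrier_mat sx(1,2) B0(1,2) z z]
    by (simp add: power2_eq_square)
  finally have trac: "(Tu S *\<^sub>v u) \<bullet>\<^sub>v (Hx S *\<^sub>v (Tu S *\<^sub>v u)) = \<dots>" .
  have "hy S $$ (0, 0) * ((Tu S *\<^sub>v u) \<bullet>\<^sub>v (Hx S *\<^sub>v (Tu S *\<^sub>v u)))
      \<le> (\<Sum>q<?N. ?h q * (?chi * ?e q))"
    unfolding trac sum_distrib_left
  proof (rule sum_mono)
    fix q assume "q \<in> {..<?N}"
    then have q: "q < ?N" by simp
    let ?z = "(z $ q)\<^sup>2 + (z $ (?N + q))\<^sup>2"
    note dm = div_mod_less[OF q]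
    have "hy S $$ (0, 0) * B_first n $$ (q mod n, q mod n) \<le> hy S $$ (q mod n, q mod n)"
      using dm sy(3)[of "q mod n"] by (auto simp: B_first_def)
    moreover have "0 \<le> hx S $$ (q div n, q div n)" using sx(3)[OF dm(1)] by simp
    ultimately have "(hx S $$ (q div n, q div n) * (hy S $$ (0, 0) * B_first n $$ (q mod n, q mod n))) * ?z
        \<le> ?h q * ?z"
      by (intro mult_right_mono mult_left_mono) auto
    also have "\<dots> \<le> ?h q * (?chi * ?e q)"
      using plane_strain_traction_bound[OF pos, of "b $ q" "a $ (?N + q)" "b $ (?N + q)" "a $ q"]
        sx(3)[OF dm(1)] sy(3)[OF dm(2)]
      by (intro mult_left_mono) (auto simp: zq[OF q])
    finally show "hy S $$ (0, 0) * (hx S $$ (q div n, q div n) * B_first n $$ (q mod n, q mod n) * ?z)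
        \<le> ?h q * (?chi * ?e q)"
      by (simp add: mult.assoc mult.left_commute)
  qed
  also have "\<dots> = ?chi * (\<Sum>q<?N. ?h q * ?e q)"
    unfolding sum_distrib_left by (intro sum.cong refl) (simp only: mult.left_commute)
  also have "\<dots> \<le> ?chi * fd_energy S Rx Ry u u"
  proof (rule mult_left_mono)
    have l1: "\<And>i. i < 2 \<Longrightarrow> 0 \<le> ell1 S $$ (i, i)" "diagonal_mat (ell1 S)"
      using pos by (auto simp: ell1_def less_2_cases_iff diagonal_mat_def mat22_def)
    have l3: "\<And>i. i < 2 \<Longrightarrow> 0 \<le> ell3 S $$ (i, i)" "diagonal_mat (ell3 S)"
      using pos by (auto simp: ell3_def less_2_cases_iff diagonal_mat_def mat22_def)
    have hn: "\<And>i. i < m \<Longrightarrow> 0 \<le> hx S $$ (i, i)" "\<And>i. i < n \<Longrightarrow> 0 \<le> hy S $$ (i, i)"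
      using sx(3) sy(3) by (auto intro: less_imp_le)
    have lr: "ell1 S \<otimes>\<^sub>k Rx \<in> carrier_mat (2 * m) (2 * m)" "ell3 S \<otimes>\<^sub>k hx S \<in> carrier_mat (2 * m) (2 * m)"
      by (intro kron_carrier ell_carrier Rc sx)+
    have r1: "0 \<le> u \<bullet>\<^sub>v (tensor (ell1 S) Rx (hy S) *\<^sub>v u)"
      unfolding tensor_def
    proof (rule kron_diag_psd[OF sy(1,2) hn(2) lr(1) _ u])
      show "0 \<le> x \<bullet>\<^sub>v ((ell1 S \<otimes>\<^sub>k Rx) *\<^sub>v x)" if "x \<in> carrier_vec (2 * m)" for x
        by (rule diag_kron_psd[OF ell_carrier(1) l1(2,1) Rc(1,3) that])
    qed
    note ell3_dims = carrier_matD[OF ell_carrier(3)[of S]]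
    have lh: "0 \<le> (ell3 S \<otimes>\<^sub>k hx S) $$ (i, i)" if "i < 2 * m" for i
      using that div_mod_less[OF that] ell_carrier(3)[of S] sx(1) l3(1) hn(1)
      by (subst kron_index) (auto simp: ell3_dims intro!: mult_nonneg_nonneg)
    have r2: "0 \<le> u \<bullet>\<^sub>v (tensor (ell3 S) (hx S) Ry *\<^sub>v u)"
      unfolding tensor_def
      by (rule diag_kron_psd[OF lr(2) kron_diagonal[OF ell_carrier(3) l3(2) sx(1,2)] lh Rc(2,4) u])
    show "(\<Sum>q<?N. ?h q * ?e q) \<le> fd_energy S Rx Ry u u"
      unfolding fd_energy_def a_def[symmetric] b_def[symmetric] bulk using r1 r2 by simp
  qed (use pos in simp)
  finally show ?thesis .
qed

section \<open>Polynomial fields on the elements\<close>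

definition pdiff :: "(real^2 \<Rightarrow> real) \<Rightarrow> 2 \<Rightarrow> real^2 \<Rightarrow> real" where
  "pdiff f d x = frechet_derivative f (at x) (axis d 1)"

text \<open>Lowering the degree of a monomial by differentiation keeps it within the degree bound, so the
gradient of a shape function is again a line polynomial of the same degree.\<close>

lemma poly_le_smooth:
  assumes "poly_le q f"
  shows "line_poly q f" "continuous_on UNIV f" "\<And>d. line_poly q (pdiff f d)"
    "\<And>d. continuous_on UNIV (pdiff f d)"
    "\<And>x. (f has_derivative (\<lambda>h. \<Sum>d\<in>UNIV. pdiff f d x * h $h d)) (at x)"
proof -
  obtain a where "\<And>x. f x = (\<Sum>i\<le>q. \<Sum>j\<le>q - i. a i j * (x $h 1) ^ i * (x $h 2) ^ j)"
    using assms by (auto simp: poly_le_def)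
  then have f: "f = (\<lambda>x. \<Sum>i\<le>q. \<Sum>j\<le>q - i. a i j * ((x $h 1) ^ i * (x $h 2) ^ j))"
    by (auto simp: mult.assoc)
  let ?f1 = "\<lambda>x. \<Sum>i\<le>q. \<Sum>j\<le>q - i. (a i j * real i) * ((x $h 1) ^ (i - 1) * (x $h 2) ^ j)"
  let ?f2 = "\<lambda>x. \<Sum>i\<le>q. \<Sum>j\<le>q - i. (a i j * real j) * ((x $h 1) ^ i * (x $h 2) ^ (j - 1))"
  have cf: "\<And>k. continuous_on UNIV (\<lambda>x :: real^2. x $h k)"
    by (intro continuous_intros)
  show "line_poly q f" unfolding f
    by (intro line_poly_sum line_poly_scale line_poly_monomial) auto
  show "continuous_on UNIV f" unfolding f by (intro continuous_intros cf)
  have lin: "((\<lambda>x :: real^2. x $h k) has_derivative (\<lambda>h. h $h k)) (at x)" for k x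
    by (rule bounded_linear_imp_has_derivative[OF bounded_linear_vec_nth])
  have d: "(f has_derivative (\<lambda>h. ?f1 x * h $h 1 + ?f2 x * h $h 2)) (at x)" for x
  proof -
    have "(f has_derivative (\<lambda>h. \<Sum>i\<le>q. \<Sum>j\<le>q - i.
        a i j * ((x $h 1) ^ i * (real j * (h $h 2) * (x $h 2) ^ (j - 1))
          + (real i * (h $h 1) * (x $h 1) ^ (i - 1)) * (x $h 2) ^ j))) (at x)"
      unfolding f
      by (intro has_derivative_sum has_derivative_mult_right has_derivative_mult has_derivative_power lin)
    also have "(\<lambda>h. \<Sum>i\<le>q. \<Sum>j\<le>q - i.
        a i j * ((x $h 1) ^ i * (real j * (h $h 2) * (x $h 2) ^ (j - 1))
          + (real i * (h $h 1) * (x $h 1) ^ (i - 1)) * (x $h 2) ^ j))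
      = (\<lambda>h. ?f1 x * h $h 1 + ?f2 x * h $h 2)"
      unfolding sum_distrib_right sum.distrib[symmetric]
      by (intro ext sum.cong refl) (simp add: algebra_simps)
    finally show ?thesis .
  qed
  have p: "pdiff f 1 = ?f1" "pdiff f 2 = ?f2"
    by (rule ext, simp add: pdiff_def frechet_derivative_at[OF d, symmetric] axis_def)+
  have "line_poly q ?f1" "line_poly q ?f2" "continuous_on UNIV ?f1" "continuous_on UNIV ?f2"
    by (intro line_poly_sum line_poly_scale line_poly_monomial continuous_intros cf; simp)+
  then show "line_poly q (pdiff f d)" "continuous_on UNIV (pdiff f d)" for d
    using exhaust_2[of d] p by auto
  show "(f has_derivative (\<lambda>h. \<Sum>d\<in>UNIV. pdiff f d x * h $h d)) (at x)" for x
    using d[of x] by (simp add: sum_2 p)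
qed

definition nodal :: "fd_dg \<Rightarrow> real vec \<Rightarrow> nat \<Rightarrow> 2 \<Rightarrow> real" where
  "nodal S v j i = v $ (if i = 1 then j else N_v S + j)"

lemma nodal_vector: "vector [v $ j, v $ (N_v S + j)] = (vec_lambda (\<lambda>i. nodal S v j i))"
  by (simp add: Finite_Cartesian_Product.vec_eq_iff forall_2 nodal_def)

lemma nodal_linear:
  assumes "v \<in> carrier_vec (2 * N_v S)" "w \<in> carrier_vec (2 * N_v S)" "j < N_v S"
  shows "nodal S (v + w) j i = nodal S v j i + nodal S w j i" "nodal S (r \<cdot>\<^sub>v v) j i = r * nodal S v j i"
    "nodal S (v - w) j i = nodal S v j i - nodal S w j i"
  using assms by (auto simp: nodal_def)

lemma nodal_basis_shape: "nodal_basis S \<Longrightarrow> j < N_v S \<Longrightarrow> poly_le (deg_q S) (shape S j)"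
  by (simp add: nodal_basis_def)

abbreviation elt_dofs :: "fd_dg \<Rightarrow> (real^2) set \<Rightarrow> nat set" where
  "elt_dofs S K \<equiv> {j. j < N_v S \<and> elt S j = K}"

lemma dg_fun_component: "dg_fun S v K x $h i = (\<Sum>j\<in>elt_dofs S K. nodal S v j i * shape S j x)"
  unfolding dg_fun_def nodal_vector by (simp add: mult.commute)

lemma dg_grad_entry:
  assumes "nodal_basis S"
  shows "dg_grad S v K x $h i $h d = (\<Sum>j\<in>elt_dofs S K. nodal S v j i * pdiff (shape S j) d x)"
proof -
  have "(dg_fun S v K has_derivative (\<lambda>h. \<Sum>j\<in>elt_dofs S K.
      (\<Sum>d\<in>UNIV. pdiff (shape S j) d x * h $h d) *\<^sub>R vec_lambda (\<lambda>i. nodal S v j i))) (at x)"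
    unfolding dg_fun_def[abs_def] nodal_vector
    by (intro has_derivative_sum has_derivative_scaleR_left poly_le_smooth(5)[OF nodal_basis_shape[OF assms]]) auto
  note fd = frechet_derivative_at[OF this, symmetric]
  have "dg_grad S v K x $h i $h d = (\<Sum>j\<in>elt_dofs S K.
      (\<Sum>d'\<in>UNIV. pdiff (shape S j) d' x * (axis d 1 :: real^2) $h d') *\<^sub>R vec_lambda (\<lambda>i. nodal S v j i)) $h i"
    by (simp add: dg_grad_def jacobian_def matrix_def fd)
  also have "\<dots> = (\<Sum>j\<in>elt_dofs S K. nodal S v j i * pdiff (shape S j) d x)"
    using exhaust_2[of d] by (auto simp: axis_def sum_2 mult.commute)
  finally show ?thesis .
qed

lemma dg_strain_entry:
  "dg_strain S v K x $h i $h d = 1 / 2 * (dg_grad S v K x $h i $h d + dg_grad S v K x $h d $h i)"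
  by (simp add: dg_strain_def transpose_def)

lemma dg_div_entries: "dg_div S v K x = (\<Sum>d\<in>UNIV. dg_grad S v K x $h d $h d)"
  by (simp add: dg_div_def trace_def)

text \<open>A field on the plane depending linearly on a coefficient vector; its \<open>L\<^sup>2\<close> products are symmetric bilinear
forms because continuity makes all integrals over compact sets additive.\<close>

definition lin_field :: "nat \<Rightarrow> (real vec \<Rightarrow> real^2 \<Rightarrow> 'a::euclidean_space) \<Rightarrow> bool" where
  "lin_field n F \<longleftrightarrow> (\<forall>v\<in>carrier_vec n. continuous_on UNIV (F v)) \<and>
     (\<forall>v\<in>carrier_vec n. \<forall>w\<in>carrier_vec n. \<forall>x. F (v + w) x = F v x + F w x) \<and>
     (\<forall>r. \<forall>v\<in>carrier_vec n. \<forall>x. F (r \<cdot>\<^sub>v v) x = r *\<^sub>R F v x)"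

lemma lin_field_sym_bilinear:
  assumes F: "lin_field n F" and K: "compact K"
  shows "sym_bilinear n (\<lambda>v w. integral K (\<lambda>x. inner (F v x) (F w x)))"
proof -
  have i: "(\<lambda>x. inner (F v x) (F w x)) integrable_on K" if "v \<in> carrier_vec n" "w \<in> carrier_vec n" for v w
    using F that by (intro integrable_on_compact continuous_intros K) (auto simp: lin_field_def)
  show ?thesis
    unfolding sym_bilinear_def
  proof (intro conjI ballI allI)
    fix v w :: "real vec" and r
    assume v: "v \<in> carrier_vec n" "w \<in> carrier_vec n"
    show "integral K (\<lambda>x. inner (F v x) (F w x)) = integral K (\<lambda>x. inner (F w x) (F v x))"
      by (simp add: inner_commute)
    show "integral K (\<lambda>x. inner (F (r \<cdot>\<^sub>v v) x) (F w x)) = r * integral K (\<lambda>x. inner (F v x) (F w x))"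
      using F v by (simp add: lin_field_def)
    fix z :: "real vec" assume z: "z \<in> carrier_vec n"
    show "integral K (\<lambda>x. inner (F (v + w) x) (F z x))
        = integral K (\<lambda>x. inner (F v x) (F z x)) + integral K (\<lambda>x. inner (F w x) (F z x))"
      using F v z i by (simp add: lin_field_def inner_add_left integral_add)
  qed
qed

lemma lin_field_vec:
  fixes F :: "real vec \<Rightarrow> real^2 \<Rightarrow> 'a::euclidean_space ^ 'n::finite"
  assumes "\<And>i. lin_field n (\<lambda>v x. F v x $h i)"
  shows "lin_field n F"
  unfolding lin_field_def
proof (intro conjI ballI allI)
  fix v :: "real vec" assume "v \<in> carrier_vec n"
  then have "continuous_on UNIV (\<lambda>x. vec_lambda (\<lambda>i. F v x $h i))"
    using assms by (intro continuous_on_vec_lambda) (auto simp: lin_field_def)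
  then show "continuous_on UNIV (F v)" by simp
qed (use assms in \<open>auto simp: lin_field_def Finite_Cartesian_Product.vec_eq_iff\<close>)

lemma lin_field_lincomb:
  assumes "nodal_basis S" "J \<subseteq> {..<N_v S}" "\<And>j. j \<in> J \<Longrightarrow> continuous_on UNIV (g j)"
  shows "lin_field (2 * N_v S) (\<lambda>v x. \<Sum>j\<in>J. nodal S v j i * g j x)"
proof -
  have J: "j < N_v S" if "j \<in> J" for j using that assms(2) by auto
  show ?thesis
    unfolding lin_field_def
    by (auto simp: nodal_linear J sum.distrib[symmetric] sum_distrib_left algebra_simps
        intro!: continuous_intros assms(3) sum.cong)
qed

lemma lin_field_add: "lin_field n F \<Longrightarrow> lin_field n G \<Longrightarrow> lin_field n (\<lambda>v x. F v x + G v x)"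
  by (auto simp: lin_field_def algebra_simps intro!: continuous_intros)

lemma lin_field_scale: "lin_field n F \<Longrightarrow> lin_field n (\<lambda>v x. c *\<^sub>R F v x)"
  by (auto simp: lin_field_def algebra_simps intro!: continuous_intros)

lemma dg_lin_fields:
  assumes "nodal_basis S"
  shows "lin_field (2 * N_v S) (\<lambda>v. dg_fun S v K)" "lin_field (2 * N_v S) (\<lambda>v. dg_div S v K)"
    "lin_field (2 * N_v S) (\<lambda>v. dg_strain S v K)"
    "lin_field (2 * N_v S) (\<lambda>v x. dg_grad S v K x $h i $h d)"
proof -
  show "lin_field (2 * N_v S) (\<lambda>v. dg_fun S v K)"
    by (rule lin_field_vec, subst dg_fun_component, rule lin_field_lincomb[OF assms])
      (auto intro!: poly_le_smooth(2) nodal_basis_shape[OF assms])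
  show g: "lin_field (2 * N_v S) (\<lambda>v x. dg_grad S v K x $h i $h d)" for i d
    unfolding dg_grad_entry[OF assms]
    by (rule lin_field_lincomb[OF assms]) (auto intro!: poly_le_smooth(4) nodal_basis_shape[OF assms])
  show "lin_field (2 * N_v S) (\<lambda>v. dg_div S v K)"
    using lin_field_add[OF g[of 1 1] g[of 2 2]] by (simp add: dg_div_entries[abs_def] sum_2)
  show "lin_field (2 * N_v S) (\<lambda>v. dg_strain S v K)"
    by (rule lin_field_vec, rule lin_field_vec, unfold dg_strain_entry)
      (use lin_field_scale[OF lin_field_add[OF g g], of "1/2"] in simp)
qed

lemma dg_line_polys:
  assumes "nodal_basis S"
  shows "line_poly (deg_q S) (\<lambda>x. dg_grad S v K x $h i $h d)" "line_poly (deg_q S) (dg_div S v K)"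
    "line_poly (deg_q S) (\<lambda>x. dg_strain S v K x $h i $h d)"
proof -
  show g: "line_poly (deg_q S) (\<lambda>x. dg_grad S v K x $h i $h d)" for i d
    unfolding dg_grad_entry[OF assms]
    by (intro line_poly_sum line_poly_scale poly_le_smooth(3) nodal_basis_shape[OF assms]) auto
  show "line_poly (deg_q S) (dg_div S v K)"
    unfolding dg_div_entries[abs_def] by (intro line_poly_sum g) auto
  show "line_poly (deg_q S) (\<lambda>x. dg_strain S v K x $h i $h d)"
    unfolding dg_strain_entry by (intro line_poly_scale line_poly_add g)
qed

section \<open>Geometry of the edges on the interface\<close>

lemma simplex2_facts:
  assumes "2 simplex (K :: (real^2) set)"
  shows "convex K" "compact K" "aff_dim K = 2"
  using assms by (auto intro: convex_simplex compact_simplex simp: aff_dim_simplex)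

lemma aff_dim_horizontal_line: "aff_dim {x :: real^2. x $h 2 = y} = 1"
proof -
  have "{x :: real^2. x $h 2 = y} = {x. inner (axis 2 1) x = y}"
    by (simp add: inner_axis')
  then show ?thesis by (simp add: aff_dim_hyperplane axis_eq_0_iff)
qed

text \<open>A convex set with a horizontal top segment and a point \<open>P\<close> below contains the triangle that they span,
hence a short vertical segment under the midpoint.\<close>

lemma below_midpoint:
  fixes K :: "(real^2) set"
  assumes K: "convex K" and top: "\<And>s. s \<in> {a..b} \<Longrightarrow> vector [s, y] \<in> K" and ab: "a < b"
    and P: "P \<in> K" "P $h 2 < y"
  shows "\<exists>e0>0. \<forall>e. 0 < e \<and> e \<le> e0 \<longrightarrow> vector [(a + b) / 2, y - e] \<in> K"
proof -
  define H where "H = y - P $h 2"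
  define m where "m = (a + b) / 2"
  define D where "D = \<bar>m - P $h 1\<bar> + 1"
  define t0 where "t0 = min (1 / 2) ((b - a) / (4 * D))"
  have pos: "0 < H" "1 \<le> D" using P by (auto simp: H_def D_def)
  have t0: "0 < t0" using pos ab by (simp add: t0_def)
  have "vector [m, y - e] \<in> K" if e: "0 < e" "e \<le> H * t0" for e
  proof -
    define t where "t = e / H"
    have "t \<le> t0" using e pos by (simp add: t_def pos_divide_le_eq mult.commute)
    then have t: "0 < t" "t \<le> 1 / 2" "t \<le> (b - a) / (4 * D)" "t * H = e"
      using e pos by (auto simp: t_def t0_def)
    \<comment> \<open>The line from \<open>P\<close> through the target point meets the top at abscissa \<open>s\<close>.\<close>
    define s where "s = m + t / (1 - t) * (m - P $h 1)"
    have "\<bar>t / (1 - t) * (m - P $h 1)\<bar> \<le> (2 * t) * D"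
    proof -
      have "t / (1 - t) \<le> 2 * t" using t by (simp add: field_simps)
      then have "\<bar>t / (1 - t)\<bar> * \<bar>m - P $h 1\<bar> \<le> (2 * t) * D"
        using t by (intro mult_mono) (auto simp: D_def)
      then show ?thesis by (simp add: abs_mult)
    qed
    also have "\<dots> \<le> (b - a) / 2"
      using t(3) pos by (simp add: field_simps)
    finally have "\<bar>s - m\<bar> \<le> (b - a) / 2" by (simp add: s_def)
    then have "- ((b - a) / 2) \<le> s - m" "s - m \<le> (b - a) / 2" by linarith+
    then have s: "s \<in> {a..b}" by (auto simp: m_def field_simps)
    have "(1 - t) * s = m - t * P $h 1"
      using t by (simp add: s_def field_simps)
    then have "vector [m, y - e] = (1 - t) *\<^sub>R vector [s, y] + t *\<^sub>R P"
      using t(4) by (simp add: Finite_Cartesian_Product.vec_eq_iff forall_2 H_def algebra_simps)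
    then show ?thesis using convexD_alt[OF K top[OF s] P(1), of t] t by simp
  qed
  then show ?thesis using pos t0 by (intro exI[of _ "H * t0"]) (auto simp: m_def)
qed

lemma edge_segment:
  fixes K :: "(real^2) set"
  assumes K: "2 simplex K" and g: "\<gamma> edge_of K" and line: "\<And>x. x \<in> \<gamma> \<Longrightarrow> x $h 2 = y"
  obtains a b where "a < b" "(\<lambda>x. x $h 1) ` \<gamma> = {a..b}" "\<gamma> = (\<lambda>s. vector [s, y]) ` {a..b}"
proof -
  have f: "\<gamma> face_of K" "aff_dim \<gamma> = 1" using g by (auto simp: edge_of_def)
  have c: "convex \<gamma>" "compact \<gamma>"
    using f(1) simplex2_facts[OF K] by (auto intro: face_of_imp_convex face_of_imp_compact)
  have lin: "continuous_on \<gamma> (\<lambda>x. x $h 1)" by (intro continuous_intros)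
  have "connected ((\<lambda>x. x $h 1) ` \<gamma>)" "compact ((\<lambda>x. x $h 1) ` \<gamma>)"
    using lin c by (auto intro: connected_continuous_image convex_connected compact_continuous_image)
  then obtain a b where ab: "(\<lambda>x. x $h 1) ` \<gamma> = {a..b}"
    using connected_compact_interval_1 by meson
  have pt: "x = vector [x $h 1, y]" if "x \<in> \<gamma>" for x
    using line[OF that] by (simp add: Finite_Cartesian_Product.vec_eq_iff forall_2)
  have g': "\<gamma> = (\<lambda>s. vector [s, y]) ` {a..b}"
    unfolding ab[symmetric] image_image using pt by force
  have "a < b"
  proof (rule ccontr)
    assume "\<not> a < b"
    then have "\<gamma> = {} \<or> \<gamma> = {vector [a, y]}" unfolding g' by (cases "a = b") auto
    then show False using f(2) by auto
  qed
  with ab g' show thesis using that by blast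
qed

lemma simplex_leaves_line:
  fixes K :: "(real^2) set"
  assumes "2 simplex K" "\<And>x. x \<in> K \<Longrightarrow> x $h 2 \<le> y"
  obtains P where "P \<in> K" "P $h 2 < y"
proof -
  have "\<not> K \<subseteq> {x. x $h 2 = y}"
    using aff_dim_subset[of K "{x. x $h 2 = y}"] simplex2_facts[OF assms(1)] by (auto simp: aff_dim_horizontal_line)
  then show thesis using that assms(2) by (force simp: less_le)
qed

text \<open>A triangle below a line meets it in a set of dimension at most one, and the edge is a face of that set
with the same dimension.\<close>

lemma edge_on_line_unique:
  fixes K :: "(real^2) set"
  assumes K: "2 simplex K" "\<And>x. x \<in> K \<Longrightarrow> x $h 2 \<le> y"
    and g: "\<gamma> edge_of K" "\<And>x. x \<in> \<gamma> \<Longrightarrow> x $h 2 = y"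
  shows "\<gamma> = K \<inter> {x. x $h 2 = y}"
proof (rule ccontr)
  let ?L = "{x :: real^2. x $h 2 = y}"
  assume ne: "\<gamma> \<noteq> K \<inter> ?L"
  have "convex ?L"
  proof -
    have "?L = {x. inner (axis 2 1) x = y}" by (simp add: inner_axis')
    then show ?thesis by (simp add: convex_hyperplane)
  qed
  then have c: "convex (K \<inter> ?L)" using simplex2_facts[OF K(1)] by (simp add: convex_Int)
  have sub: "\<gamma> \<subseteq> K \<inter> ?L" using g edge_of_imp_subset[OF g(1)] by auto
  have "\<gamma> face_of K \<inter> ?L"
    using g(1) sub by (auto simp: edge_of_def intro: face_of_subset)
  from face_of_aff_dim_lt[OF c this ne] g(1) have "1 < aff_dim (K \<inter> ?L)" by (simp add: edge_of_def)
  moreover have "aff_dim (K \<inter> ?L) \<le> 1"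
    using aff_dim_subset[of "K \<inter> ?L" ?L] by (simp add: aff_dim_horizontal_line)
  ultimately show False by simp
qed

text \<open>Both triangles lie on the same side of the edge, so they share points off the edge. Their
intersection is then a common face of dimension two.\<close>

lemma top_edge_element_unique:
  fixes K K' :: "(real^2) set"
  assumes K: "2 simplex K" "\<And>x. x \<in> K \<Longrightarrow> x $h 2 \<le> y"
    and K': "2 simplex K'" "\<And>x. x \<in> K' \<Longrightarrow> x $h 2 \<le> y"
    and faces: "(K \<inter> K') face_of K" "(K \<inter> K') face_of K'"
    and g: "\<gamma> edge_of K" "\<gamma> edge_of K'" "\<And>x. x \<in> \<gamma> \<Longrightarrow> x $h 2 = y"
  shows "K = K'"
proof -
  obtain a b where ab: "a < b" "\<gamma> = (\<lambda>s. vector [s, y]) ` {a..b}"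
    using edge_segment[OF K(1) g(1,3)] by metis
  have sub: "\<gamma> \<subseteq> K" "\<gamma> \<subseteq> K'" using g by (auto dest: edge_of_imp_subset)
  obtain P where P: "P \<in> K" "P $h 2 < y" using simplex_leaves_line[OF K] by blast
  obtain P' where P': "P' \<in> K'" "P' $h 2 < y" using simplex_leaves_line[OF K'] by blast
  have top: "vector [s, y] \<in> K" "vector [s, y] \<in> K'" if "s \<in> {a..b}" for s
    using sub that ab(2) by auto
  obtain e1 where e1: "e1 > 0" "\<And>e. 0 < e \<Longrightarrow> e \<le> e1 \<Longrightarrow> vector [(a + b) / 2, y - e] \<in> K"
    using below_midpoint[OF simplex2_facts(1)[OF K(1)] top(1) ab(1) P] by blast
  obtain e2 where e2: "e2 > 0" "\<And>e. 0 < e \<Longrightarrow> e \<le> e2 \<Longrightarrow> vector [(a + b) / 2, y - e] \<in> K'"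
    using below_midpoint[OF simplex2_facts(1)[OF K'(1)] top(2) ab(1) P'] by blast
  define z :: "real^2" where "z = vector [(a + b) / 2, y - min e1 e2]"
  have z: "z \<in> K \<inter> K'" "z \<notin> \<gamma>"
  proof -
    have "0 < min e1 e2" "min e1 e2 \<le> e1" "min e1 e2 \<le> e2" using e1(1) e2(1) by simp_all
    then show "z \<in> K \<inter> K'" unfolding z_def using e1(2) e2(2) by blast
    have "z $h 2 = y - min e1 e2" by (simp add: z_def)
    with \<open>0 < min e1 e2\<close> g(3)[of z] show "z \<notin> \<gamma>" by linarith
  qed
  have cF: "convex (K \<inter> K')" using simplex2_facts(1)[OF K(1)] simplex2_facts(1)[OF K'(1)] by (rule convex_Int)
  have f: "\<gamma> face_of K \<inter> K'"
    using g(1) sub by (auto simp: edge_of_def intro: face_of_subset)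
  have "\<gamma> \<noteq> K \<inter> K'" using z by blast
  from face_of_aff_dim_lt[OF cF f this] g(1) have F: "1 < aff_dim (K \<inter> K')"
    by (simp add: edge_of_def)
  have "A = K \<inter> K'" if "2 simplex A" "(K \<inter> K') face_of A" for A
  proof (rule ccontr)
    assume "A \<noteq> K \<inter> K'"
    from face_of_aff_dim_lt[OF simplex2_facts(1)[OF that(1)] that(2) this[symmetric]] F
    show False by (simp add: simplex2_facts(3)[OF that(1)])
  qed
  from this[OF K(1) faces(1)] this[OF K'(1) faces(2)] show ?thesis by simp
qed

section \<open>Traces, tractions and the interface mass matrix\<close>

lemma mesh_element:
  assumes "geometry S" "dg_setting S" "K \<in> mesh S"
  shows "2 simplex K" "\<And>x. x \<in> K \<Longrightarrow> x $h 2 \<le> y_Gam S"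
  using assms by (auto simp: geometry_def dg_setting_def triangle_mesh_def)

lemma interface_height:
  assumes "geometry S" "\<gamma> \<in> edges_Gam S" "x \<in> \<gamma>"
  shows "x $h 2 = y_Gam S"
  using assms by (auto simp: geometry_def edges_Gam_def)

text \<open>By \<open>top_edge_element_unique\<close>, the definite description in \<^const>\<open>elt_at\<close> denotes an element.\<close>

lemma elt_at_edge:
  assumes S: "geometry S" "dg_setting S" and g: "\<gamma> \<in> edges_Gam S"
  shows "elt_at S \<gamma> \<in> mesh S" "\<gamma> edge_of elt_at S \<gamma>"
proof -
  have "\<exists>!K. K \<in> mesh S \<and> \<gamma> edge_of K"
  proof (rule ex_ex1I)
    show "\<exists>K. K \<in> mesh S \<and> \<gamma> edge_of K" using g by (auto simp: edges_Gam_def)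
    fix K K' assume K: "K \<in> mesh S \<and> \<gamma> edge_of K" "K' \<in> mesh S \<and> \<gamma> edge_of K'"
    have tri: "(A \<inter> B) face_of A" if "A \<in> mesh S" "B \<in> mesh S" for A B
      using S(2) that by (auto simp: dg_setting_def triangle_mesh_def triangulation_def)
    have faces: "(K \<inter> K') face_of K" "(K \<inter> K') face_of K'"
      using tri[of K K'] tri[of K' K] K by (auto simp: Int_commute)
    show "K = K'"
      by (rule top_edge_element_unique[where y = "y_Gam S" and \<gamma> = \<gamma>])
        (use K faces mesh_element[OF S] interface_height[OF S(1) g] in auto)
  qed
  from theI'[OF this] show "elt_at S \<gamma> \<in> mesh S" "\<gamma> edge_of elt_at S \<gamma>"
    by (simp_all add: elt_at_def)
qed

lemma interface_edge_segment:
  assumes S: "geometry S" "dg_setting S" and g: "\<gamma> \<in> edges_Gam S"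
  obtains a b where "a < b" "(\<lambda>x. x $h 1) ` \<gamma> = {a..b}" "\<gamma> = (\<lambda>s. vector [s, y_Gam S]) ` {a..b}"
  by (rule edge_segment[where y = "y_Gam S" and \<gamma> = \<gamma>])
    (use that mesh_element(1)[OF S elt_at_edge(1)[OF S g]] elt_at_edge(2)[OF S g]
      interface_height[OF S(1) g] in auto)

lemma elt_at_inj:
  assumes S: "geometry S" "dg_setting S"
  shows "inj_on (elt_at S) (edges_Gam S)"
proof (rule inj_onI)
  fix \<gamma> \<delta> assume g: "\<gamma> \<in> edges_Gam S" "\<delta> \<in> edges_Gam S" and e: "elt_at S \<gamma> = elt_at S \<delta>"
  have u: "\<zeta> = elt_at S \<zeta> \<inter> {x. x $h 2 = y_Gam S}" if "\<zeta> \<in> edges_Gam S" for \<zeta>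
    by (rule edge_on_line_unique)
      (use mesh_element[OF S elt_at_edge(1)[OF S that]] elt_at_edge(2)[OF S that]
        interface_height[OF S(1) that] in auto)
  show "\<gamma> = \<delta>" using u[OF g(1)] u[OF g(2)] e by simp
qed

text \<open>Both sides are polynomials of degree at most \<open>q\<close> in \<open>s\<close> and agree at the \<open>q + 1\<close> nodes of the edge.\<close>

lemma edge_interpolation:
  assumes S: "geometry S" "dg_setting S" and g: "\<gamma> \<in> edges_Gam S" and f: "line_poly (deg_q S) f"
  shows "f (vector [s, y_Gam S]) = (\<Sum>j\<in>edge_dofs S \<gamma>. f (node S j) * shape S j (vector [s, y_Gam S]))"
proof -
  have nb: "nodal_basis S" using S by (simp add: dg_setting_def)
  let ?q = "deg_q S" and ?J = "edge_dofs S \<gamma>"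
  have card: "card ?J = ?q + 1"
    using nb elt_at_edge[OF S g] by (auto simp: nodal_basis_def edge_dofs_def)
  then have fin: "finite ?J" by (metis Suc_eq_plus1 card.infinite nat.distinct(1))
  have J: "j < N_v S" "elt S j = elt_at S \<gamma>" "node S j \<in> \<gamma>" if "j \<in> ?J" for j
    using that by (auto simp: edge_dofs_def)
  have delta: "shape S j (node S k) = (if j = k then 1 else 0)" if "j \<in> ?J" "k \<in> ?J" for j k
    using nb J[OF that(1)] J[OF that(2)] by (auto simp: nodal_basis_def)
  have pt: "node S j = vector [node S j $h 1, y_Gam S]" if "j \<in> ?J" for j
    using interface_height[OF S(1) g J(3)[OF that]]
    by (simp add: Finite_Cartesian_Product.vec_eq_iff forall_2)
  have on_line: "\<exists>p. degree p \<le> ?q \<and> (\<forall>s. f (vector [s, y_Gam S]) = poly p s)" if lp: "line_poly ?q f" for f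
  proof -
    obtain p where "degree p \<le> ?q" "\<And>s. f (vector [0, y_Gam S] + s *\<^sub>R vector [1, 0]) = poly p s"
      using lp unfolding line_poly_def by meson
    moreover have "vector [0, y_Gam S] + s *\<^sub>R vector [1, 0] = (vector [s, y_Gam S] :: real^2)" for s
      by (simp add: Finite_Cartesian_Product.vec_eq_iff forall_2)
    ultimately show ?thesis by auto
  qed
  obtain p where p: "degree p \<le> ?q" "\<And>s. f (vector [s, y_Gam S]) = poly p s"
    using on_line[OF f] by blast
  have "\<forall>j\<in>?J. \<exists>p. degree p \<le> ?q \<and> (\<forall>s. shape S j (vector [s, y_Gam S]) = poly p s)"
    using on_line poly_le_smooth(1)[OF nodal_basis_shape[OF nb]] J by blast
  then obtain r where r: "\<And>j. j \<in> ?J \<Longrightarrow> degree (r j) \<le> ?q"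
    "\<And>j s. j \<in> ?J \<Longrightarrow> shape S j (vector [s, y_Gam S]) = poly (r j) s" by metis
  define R where "R = (\<Sum>j\<in>?J. Polynomial.smult (f (node S j)) (r j))"
  have R: "poly R s = (\<Sum>j\<in>?J. f (node S j) * shape S j (vector [s, y_Gam S]))" for s
    by (simp add: R_def poly_sum r)
  have inj: "inj_on (\<lambda>j. node S j $h 1) ?J"
  proof (rule inj_onI)
    fix j k assume jk: "j \<in> ?J" "k \<in> ?J" and e: "node S j $h 1 = node S k $h 1"
    then have "node S j = node S k" using pt by metis
    with delta[OF jk] delta[OF jk(1,1)] show "j = k" by (auto split: if_splits)
  qed
  have "p = R"
  proof (rule poly_eqI_degree)
    show "degree p < card ((\<lambda>j. node S j $h 1) ` ?J)"
      using p(1) card by (simp add: card_image[OF inj])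
    have "degree R \<le> ?q"
      unfolding R_def by (intro degree_sum_le fin order_trans[OF degree_smult_le] r)
    then show "degree R < card ((\<lambda>j. node S j $h 1) ` ?J)"
      using card by (simp add: card_image[OF inj])
    fix x assume "x \<in> (\<lambda>j. node S j $h 1) ` ?J"
    then obtain k where k: "k \<in> ?J" "x = node S k $h 1" by auto
    have "poly R x = (\<Sum>j\<in>?J. f (node S j) * (if j = k then 1 else 0))"
      unfolding R k(2) pt[OF k(1), symmetric] by (intro sum.cong refl) (simp add: delta k)
    also have "\<dots> = f (node S k)" using k fin by (simp add: if_distrib cong: if_cong)
    also have "\<dots> = poly p x" using p(2)[of x] pt[OF k(1)] k(2) by simp
    finally show "poly p x = poly R x" by simp
  qed
  with p(2) R show ?thesis by simp
qed

lemma edge_poly_component: "edge_poly S \<gamma> c x $h i = (\<Sum>j\<in>edge_dofs S \<gamma>. nodal S c j i * shape S j x)"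
  unfolding edge_poly_def nodal_vector by (simp add: mult.commute)

text \<open>Shape functions of nodes off the edge vanish at all nodes on the edge, hence on the whole edge.\<close>

lemma dg_trace_edge_poly:
  assumes S: "geometry S" "dg_setting S" and g: "\<gamma> \<in> edges_Gam S"
  shows "dg_trace S \<gamma> v (vector [s, y_Gam S]) = edge_poly S \<gamma> (restrict_Gam S v) (vector [s, y_Gam S])"
proof -
  have nb: "nodal_basis S" using S by (simp add: dg_setting_def)
  let ?K = "elt_at S \<gamma>" and ?X = "vector [s, y_Gam S] :: real^2"
  have sub: "edge_dofs S \<gamma> \<subseteq> elt_dofs S ?K" by (auto simp: edge_dofs_def)
  have zero: "shape S j ?X = 0" if j: "j \<in> elt_dofs S ?K - edge_dofs S \<gamma>" for j
  proof -
    have "shape S j (node S k) = 0" if "k \<in> edge_dofs S \<gamma>" for k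
      using nb j that by (auto simp: nodal_basis_def edge_dofs_def)
    then show ?thesis
      using edge_interpolation[OF S g poly_le_smooth(1)[OF nodal_basis_shape[OF nb]], of j s] j by simp
  qed
  have "dg_trace S \<gamma> v ?X $h i = edge_poly S \<gamma> (restrict_Gam S v) ?X $h i" for i
  proof -
    have "dg_trace S \<gamma> v ?X $h i = (\<Sum>j\<in>edge_dofs S \<gamma>. nodal S v j i * shape S j ?X)"
      unfolding dg_trace_def dg_fun_component
      by (rule sum.mono_neutral_right[OF _ sub]) (auto simp: zero)
    also have "\<dots> = edge_poly S \<gamma> (restrict_Gam S v) ?X $h i"
      unfolding edge_poly_component
    proof (intro sum.cong refl)
      fix j assume j: "j \<in> edge_dofs S \<gamma>"
      then have "j < N_v S" "j \<in> interface_dofs S" using g by (auto simp: edge_dofs_def interface_dofs_def)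
      then show "nodal S v j i * shape S j ?X = nodal S (restrict_Gam S v) j i * shape S j ?X"
        by (simp add: nodal_def restrict_Gam_def)
    qed
    finally show ?thesis .
  qed
  then show ?thesis by (simp add: Finite_Cartesian_Product.vec_eq_iff)
qed

lemma dg_traction_component:
  "(dg_stress S v K x *v vector [0, 1]) $h i
    = 2 * mu_v S * dg_strain S v K x $h i $h 2 + (if i = 2 then lam_v S * dg_div S v K x else 0)"
  using exhaust_2[of i]
  by (auto simp: dg_stress_def matrix_vector_mult_def sum_2 Finite_Cartesian_Product.mat_def)

text \<open>The traction is a polynomial of degree at most \<open>q\<close> along the edge, so no information is lost in
passing to the nodal vector \<^term>\<open>Tv S v\<close>.\<close>

lemma dg_traction_edge_poly:
  assumes S: "geometry S" "dg_setting S" and g: "\<gamma> \<in> edges_Gam S"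
  shows "dg_traction S \<gamma> v (vector [s, y_Gam S]) = edge_poly S \<gamma> (Tv S v) (vector [s, y_Gam S])"
proof -
  have nb: "nodal_basis S" using S by (simp add: dg_setting_def)
  let ?K = "elt_at S \<gamma>"
  have "dg_traction S \<gamma> v (vector [s, y_Gam S]) $h i = edge_poly S \<gamma> (Tv S v) (vector [s, y_Gam S]) $h i" for i
  proof -
    have "line_poly (deg_q S) (\<lambda>x. (dg_stress S v ?K x *v vector [0, 1]) $h i)"
      unfolding dg_traction_component
      using line_poly_add[OF line_poly_scale[OF dg_line_polys(3)[OF nb]] line_poly_scale[OF dg_line_polys(2)[OF nb]],
          of "2 * mu_v S" v ?K i 2 "if i = 2 then lam_v S else 0" v ?K]
      by (simp split: if_splits)
    from edge_interpolation[OF S g this, of s]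
    have "dg_traction S \<gamma> v (vector [s, y_Gam S]) $h i = (\<Sum>j\<in>edge_dofs S \<gamma>.
        (dg_stress S v ?K (node S j) *v vector [0, 1]) $h i * shape S j (vector [s, y_Gam S]))"
      by (simp add: dg_traction_def)
    also have "\<dots> = edge_poly S \<gamma> (Tv S v) (vector [s, y_Gam S]) $h i"
      unfolding edge_poly_component
    proof (intro sum.cong refl)
      fix j assume j: "j \<in> edge_dofs S \<gamma>"
      then have "j < N_v S" "j \<in> interface_dofs S" "elt S j = ?K"
        using g by (auto simp: edge_dofs_def interface_dofs_def)
      then have "nodal S (Tv S v) j i = (dg_stress S v ?K (node S j) *v vector [0, 1]) $h i"
        using exhaust_2[of i] by (auto simp: nodal_def Tv_def Let_def)
      then show "(dg_stress S v ?K (node S j) *v vector [0, 1]) $h i * shape S j (vector [s, y_Gam S])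
          = nodal S (Tv S v) j i * shape S j (vector [s, y_Gam S])" by simp
    qed
    finally show ?thesis .
  qed
  then show ?thesis by (simp add: Finite_Cartesian_Product.vec_eq_iff)
qed

lemma lin_map_Tv:
  assumes "nodal_basis S"
  shows "lin_map (2 * N_v S) (2 * N_v S) (Tv S)"
proof -
  let ?n = "2 * N_v S"
  have e: "(dg_stress S (v + w) K x *v vector [0, 1]) $h i
      = (dg_stress S v K x *v vector [0, 1]) $h i + (dg_stress S w K x *v vector [0, 1]) $h i"
    "(dg_stress S (r \<cdot>\<^sub>v v) K x *v vector [0, 1]) $h i = r * (dg_stress S v K x *v vector [0, 1]) $h i"
    if "v \<in> carrier_vec ?n" "w \<in> carrier_vec ?n" for v w r K x i
    using dg_lin_fields(2,3)[OF assms, of K] that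
    by (simp_all add: dg_traction_component lin_field_def algebra_simps)
  show ?thesis
    unfolding lin_map_def
  proof (intro conjI ballI allI)
    fix x :: "real vec" assume "x \<in> carrier_vec ?n" then show "Tv S x \<in> carrier_vec ?n" by (simp add: Tv_def)
  next
    fix x y :: "real vec" assume "x \<in> carrier_vec ?n" "y \<in> carrier_vec ?n"
    then show "Tv S (x + y) = Tv S x + Tv S y"
      by (intro eq_vecI) (auto simp: Tv_def Let_def e)
  next
    fix r and x :: "real vec" assume "x \<in> carrier_vec ?n"
    then show "Tv S (r \<cdot>\<^sub>v x) = r \<cdot>\<^sub>v Tv S x"
      by (intro eq_vecI) (auto simp: Tv_def Let_def e)
  qed
qed

lemma lin_map_restrict: "lin_map (2 * N_v S) (2 * N_v S) (restrict_Gam S)"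
  by (auto simp: lin_map_def restrict_Gam_def intro!: eq_vecI)

lemma shape_continuous: "nodal_basis S \<Longrightarrow> j < N_v S \<Longrightarrow> continuous_on UNIV (shape S j)"
  by (rule poly_le_smooth(2)[OF nodal_basis_shape])

lemma inner_edge_poly:
  assumes S: "geometry S" "dg_setting S" and g: "\<gamma> \<in> edges_Gam S"
  shows "inner_edge S \<gamma> (edge_poly S \<gamma> c) (edge_poly S \<gamma> d) = (\<Sum>i\<in>edge_dofs S \<gamma>. \<Sum>j\<in>edge_dofs S \<gamma>.
    inner_edge S \<gamma> (shape S i) (shape S j) * (\<Sum>k\<in>UNIV. nodal S c i k * nodal S d j k))"
proof -
  have nb: "nodal_basis S" using S by (simp add: dg_setting_def)
  let ?J = "edge_dofs S \<gamma>"
  have fin: "finite ?J" by (rule finite_subset[of _ "{..<N_v S}"]) (auto simp: edge_dofs_def)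
  obtain a b where ab: "(\<lambda>x. x $h 1) ` \<gamma> = {a..b}" using interface_edge_segment[OF S g] by metis
  have cont: "continuous_on UNIV (\<lambda>s. shape S j (vector [s, y_Gam S]))" if "j \<in> ?J" for j
    by (rule continuous_on_compose2[OF shape_continuous[OF nb]])
      (use that in \<open>auto simp: edge_dofs_def intro!: continuous_intros\<close>)
  have int: "(\<lambda>s. shape S i (vector [s, y_Gam S]) * shape S j (vector [s, y_Gam S]) * r) integrable_on {a..b}"
    if "i \<in> ?J" "j \<in> ?J" for i j r
    by (intro integrable_continuous_interval continuous_intros continuous_on_subset[OF cont] that) auto
  have "inner (edge_poly S \<gamma> c x) (edge_poly S \<gamma> d x)
      = (\<Sum>i\<in>?J. \<Sum>j\<in>?J. shape S i x * shape S j x * (\<Sum>k\<in>UNIV. nodal S c i k * nodal S d j k))" for x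
    by (simp add: inner_vec_def edge_poly_component sum_product sum_2 sum.distrib[symmetric] algebra_simps)
  then have "inner_edge S \<gamma> (edge_poly S \<gamma> c) (edge_poly S \<gamma> d) = integral {a..b} (\<lambda>s. \<Sum>i\<in>?J. \<Sum>j\<in>?J.
      shape S i (vector [s, y_Gam S]) * shape S j (vector [s, y_Gam S]) * (\<Sum>k\<in>UNIV. nodal S c i k * nodal S d j k))"
    by (simp add: inner_edge_def ab)
  also have "\<dots> = (\<Sum>i\<in>?J. \<Sum>j\<in>?J. integral {a..b} (\<lambda>s.
      shape S i (vector [s, y_Gam S]) * shape S j (vector [s, y_Gam S]) * (\<Sum>k\<in>UNIV. nodal S c i k * nodal S d j k)))"
    by (subst integral_sum[OF fin], (intro integrable_sum fin int; assumption), intro sum.cong refl,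
        subst integral_sum[OF fin]) (auto intro!: int)
  also have "\<dots> = (\<Sum>i\<in>?J. \<Sum>j\<in>?J. inner_edge S \<gamma> (shape S i) (shape S j) * (\<Sum>k\<in>UNIV. nodal S c i k * nodal S d j k))"
    by (simp add: inner_edge_def ab)
  finally show ?thesis .
qed

lemma MGam_carrier [simp]: "MGam S \<in> carrier_mat (2 * N_v S) (2 * N_v S)"
  by (auto simp: MGam_def M_Gam_def intro: kron_carrier)

lemma MGam_symmetric: "transpose_mat (MGam S) = MGam S"
proof -
  have "inner_edge S \<gamma> (shape S i) (shape S j) = inner_edge S \<gamma> (shape S j) (shape S i)" for \<gamma> i j
    by (simp add: inner_edge_def mult.commute)
  then have "transpose_mat (M_Gam S) = M_Gam S"
    by (intro eq_matI) (auto simp: M_Gam_def intro!: sum.cong)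
  then show ?thesis by (simp add: MGam_def kron_transpose)
qed

text \<open>This translates the edge integrals of the DG scheme into the matrix products of the finite difference
scheme.\<close>

lemma MGam_form:
  assumes S: "geometry S" "dg_setting S"
    and c: "c \<in> carrier_vec (2 * N_v S)" and d: "d \<in> carrier_vec (2 * N_v S)"
  shows "c \<bullet>\<^sub>v (MGam S *\<^sub>v d) = (\<Sum>\<gamma>\<in>edges_Gam S. inner_edge S \<gamma> (edge_poly S \<gamma> c) (edge_poly S \<gamma> d))"
proof -
  let ?N = "N_v S"
  let ?nn = "\<lambda>i j. \<Sum>k\<in>UNIV. nodal S c i k * nodal S d j k"
  have "c \<bullet>\<^sub>v (MGam S *\<^sub>v d) = (\<Sum>p<2. \<Sum>i<?N. \<Sum>p'<2. \<Sum>j<?N.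
      c $ (p * ?N + i) * (1\<^sub>m 2 $$ (p, p') * M_Gam S $$ (i, j)) * d $ (p' * ?N + j))"
    unfolding MGam_def by (rule kron_form[OF _ _ c d]) (simp_all add: M_Gam_def)
  also have "\<dots> = (\<Sum>i<?N. \<Sum>j<?N. M_Gam S $$ (i, j) * ?nn i j)"
    by (simp add: two_sum sum_2 nodal_def sum.distrib[symmetric] algebra_simps)
  also have "\<dots> = (\<Sum>i<?N. \<Sum>j<?N. \<Sum>\<gamma>\<in>edges_Gam S. if i \<in> edge_dofs S \<gamma> then if j \<in> edge_dofs S \<gamma>
      then inner_edge S \<gamma> (shape S i) (shape S j) * ?nn i j else 0 else 0)"
    by (intro sum.cong refl) (simp add: M_Gam_def sum_distrib_right if_distrib[of "\<lambda>z. z * _"] cong: if_cong sum.cong,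
      intro sum.cong refl, simp)
  also have "\<dots> = (\<Sum>\<gamma>\<in>edges_Gam S. \<Sum>i<?N. \<Sum>j<?N. if i \<in> edge_dofs S \<gamma> then if j \<in> edge_dofs S \<gamma>
      then inner_edge S \<gamma> (shape S i) (shape S j) * ?nn i j else 0 else 0)"
    by (subst sum.swap[of _ "edges_Gam S"], subst (2) sum.swap) (rule refl)
  also have "\<dots> = (\<Sum>\<gamma>\<in>edges_Gam S. inner_edge S \<gamma> (edge_poly S \<gamma> c) (edge_poly S \<gamma> d))"
  proof (intro sum.cong refl)
    fix \<gamma> assume g: "\<gamma> \<in> edges_Gam S"
    let ?J = "edge_dofs S \<gamma>"
    have J: "?J = {..<?N} \<inter> ?J" by (auto simp: edge_dofs_def)
    have r: "(\<Sum>i<?N. if i \<in> ?J then h i else 0) = sum h ?J" for h :: "nat \<Rightarrow> real"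
      by (subst J) (simp add: sum.inter_restrict)
    have "(\<Sum>i<?N. \<Sum>j<?N. if i \<in> ?J then if j \<in> ?J
        then inner_edge S \<gamma> (shape S i) (shape S j) * ?nn i j else 0 else 0)
      = (\<Sum>i<?N. if i \<in> ?J then \<Sum>j<?N. if j \<in> ?J
        then inner_edge S \<gamma> (shape S i) (shape S j) * ?nn i j else 0 else 0)"
      by (intro sum.cong refl) simp
    then show "(\<Sum>i<?N. \<Sum>j<?N. if i \<in> ?J then if j \<in> ?J
        then inner_edge S \<gamma> (shape S i) (shape S j) * ?nn i j else 0 else 0)
      = inner_edge S \<gamma> (edge_poly S \<gamma> c) (edge_poly S \<gamma> d)"
      unfolding inner_edge_poly[OF S g] r by simp
  qed
  finally show ?thesis .
qed

section \<open>The DG energy controls the traction\<close>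

lemma mesh_finite: "dg_setting S \<Longrightarrow> finite (mesh S)"
  by (auto simp: dg_setting_def triangle_mesh_def triangulation_def)

lemma mesh_nonempty:
  assumes "geometry S" "dg_setting S"
  shows "mesh S \<noteq> {}"
proof -
  have "vector [x_W S, y_Gam S] \<in> Gam S" using assms by (auto simp: geometry_def)
  then have "edges_Gam S \<noteq> {}" using assms by (auto simp: dg_setting_def)
  then show ?thesis by (auto simp: edges_Gam_def)
qed

text \<open>The bottom point of the inscribed disc lies at least one disc diameter below the interface, since
the top point of the disc is not above it.\<close>

lemma inscribed_disc_depth:
  assumes S: "geometry S" "dg_setting S" and qu: "quasi_uniform \<kappa> (mesh S)" and kap: "0 < \<kappa>"
  shows "0 < h_v S" "\<And>K. K \<in> mesh S \<Longrightarrow> \<exists>P\<in>K. P $h 2 < y_Gam S \<and> h_v S \<le> \<kappa> * (y_Gam S - P $h 2)"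
proof -
  have fin: "finite (diameter ` mesh S)" "diameter ` mesh S \<noteq> {}"
    using mesh_finite[OF S(2)] mesh_nonempty[OF S] by auto
  have ball: "\<exists>x r. 0 < r \<and> x + r *\<^sub>R axis 2 1 \<in> K \<and> x - r *\<^sub>R axis 2 1 \<in> K \<and> x \<in> K
      \<and> dist x (x + r *\<^sub>R axis 2 1) = r \<and> diameter K \<le> \<kappa> * (2 * r)" if K: "K \<in> mesh S" for K
  proof -
    obtain x r where xr: "0 < r" "cball x r \<subseteq> K" "diameter K \<le> \<kappa> * (2 * r)"
      using qu K unfolding quasi_uniform_def by blast
    have "x + r *\<^sub>R axis 2 1 \<in> cball x r" "x - r *\<^sub>R axis 2 1 \<in> cball x r" "x \<in> cball x r"
      "dist x (x + r *\<^sub>R axis 2 1) = r"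
      using xr(1) by (simp_all add: dist_norm)
    with xr show ?thesis by blast
  qed
  have "0 < diameter K" if K: "K \<in> mesh S" for K
  proof -
    obtain x r where "0 < r" "x + r *\<^sub>R axis 2 1 \<in> K" "x \<in> K" "dist x (x + r *\<^sub>R axis 2 1) = r"
      using ball[OF K] by blast
    moreover have "bounded K" using simplex2_facts(2)[OF mesh_element(1)[OF S K]] by (rule compact_imp_bounded)
    ultimately show ?thesis using diameter_bounded_bound[of K x "x + r *\<^sub>R axis 2 1"] by simp
  qed
  then show "0 < h_v S" using fin by (simp add: h_v_def)
  fix K assume K: "K \<in> mesh S"
  obtain x r where xr: "0 < r" "x + r *\<^sub>R axis 2 1 \<in> K" "x - r *\<^sub>R axis 2 1 \<in> K" "diameter K \<le> \<kappa> * (2 * r)"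
    using ball[OF K] by blast
  have "x $h 2 + r \<le> y_Gam S" using mesh_element(2)[OF S K xr(2)] by (simp add: axis_def)
  then have d: "2 * r \<le> y_Gam S - (x - r *\<^sub>R axis 2 1) $h 2" by (simp add: axis_def)
  have "h_v S \<le> diameter K" unfolding h_v_def using fin K by (intro Min_le) auto
  also have "\<dots> \<le> \<kappa> * (2 * r)" by (rule xr)
  also have "\<dots> \<le> \<kappa> * (y_Gam S - (x - r *\<^sub>R axis 2 1) $h 2)" using d kap by (intro mult_left_mono) auto
  finally show "\<exists>P\<in>K. P $h 2 < y_Gam S \<and> h_v S \<le> \<kappa> * (y_Gam S - P $h 2)"
    using xr d by (intro bexI[of _ "x - r *\<^sub>R axis 2 1"]) auto
qed

definition dg_energy :: "fd_dg \<Rightarrow> real vec \<Rightarrow> real vec \<Rightarrow> real" where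
  "dg_energy S v w = 2 * mu_v S * inner_Omega_v S (dg_strain S v) (dg_strain S w)
     + lam_v S * inner_Omega_v S (dg_div S v) (dg_div S w)"

lemma inner_Omega_v_sym_bilinear:
  assumes S: "geometry S" "dg_setting S"
  shows "sym_bilinear (2 * N_v S) (\<lambda>v w. inner_Omega_v S (dg_fun S v) (dg_fun S w))"
    "sym_bilinear (2 * N_v S) (dg_energy S)"
proof -
  have nb: "nodal_basis S" using S by (simp add: dg_setting_def)
  note lf = lin_field_sym_bilinear[OF dg_lin_fields(1)[OF nb]] lin_field_sym_bilinear[OF dg_lin_fields(2)[OF nb]]
    lin_field_sym_bilinear[OF dg_lin_fields(3)[OF nb]]
  note K = simplex2_facts(2)[OF mesh_element(1)[OF S]]
  show "sym_bilinear (2 * N_v S) (\<lambda>v w. inner_Omega_v S (dg_fun S v) (dg_fun S w))"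
    unfolding inner_Omega_v_def by (intro sym_bilinear_sum lf K)
  have "sym_bilinear (2 * N_v S) (\<lambda>v w. dg_energy S v w)"
    unfolding dg_energy_def inner_Omega_v_def
    by (intro sym_bilinear_add sym_bilinear_scale sym_bilinear_sum lf K)
  then show "sym_bilinear (2 * N_v S) (dg_energy S)" .
qed

text \<open>The continuous counterpart of \<open>plane_strain_traction_bound\<close>.\<close>

lemma dg_traction_bound:
  assumes pos: "0 < mu_v S" "0 < lam_v S"
  shows "inner (dg_stress S v K x *v vector [0, 1]) (dg_stress S v K x *v vector [0, 1])
    \<le> (2 * mu_v S + lam_v S) * (2 * mu_v S * inner (dg_strain S v K x) (dg_strain S v K x)
        + lam_v S * inner (dg_div S v K x) (dg_div S v K x))"
proof -
  define e11 e12 e22 d where "e11 = dg_strain S v K x $h 1 $h 1" and "e12 = dg_strain S v K x $h 1 $h 2"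
    and "e22 = dg_strain S v K x $h 2 $h 2" and "d = dg_div S v K x"
  have e21: "dg_strain S v K x $h 2 $h 1 = e12" by (simp add: e12_def dg_strain_entry)
  have "0 \<le> 2 * mu_v S * lam_v S * (e22 - d)\<^sup>2 + (2 * mu_v S + lam_v S) * (2 * mu_v S * e11\<^sup>2)
      + 4 * mu_v S * (mu_v S + lam_v S) * e12\<^sup>2"
    using pos by (intro add_nonneg_nonneg mult_nonneg_nonneg) auto
  then show ?thesis
    unfolding inner_vec_def sum_2 dg_traction_component e21 e11_def[symmetric] e12_def[symmetric]
      e22_def[symmetric] d_def[symmetric]
    by (simp add: power2_eq_square algebra_simps)
qed

text \<open>On each edge, the trace inequality is applied to the strain and the divergence on the adjacent element.
Distinct edges have distinct adjacent elements, so the element energies add up to at most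
the total.\<close>

lemma dg_traction_energy_bound:
  assumes S: "geometry S" "dg_setting S" and qu: "quasi_uniform \<kappa> (mesh S)" and kap: "0 < \<kappa>"
    and c: "trace_const (deg_q S) c" and pos: "0 < mu_v S" "0 < lam_v S"
    and v: "v \<in> carrier_vec (2 * N_v S)"
  shows "h_v S / (c * \<kappa>) * (Tv S v \<bullet>\<^sub>v (MGam S *\<^sub>v Tv S v)) \<le> (2 * mu_v S + lam_v S) * dg_energy S v v"
proof -
  have nb: "nodal_basis S" using S by (simp add: dg_setting_def)
  let ?chi = "2 * mu_v S + lam_v S" and ?y = "y_Gam S"
  have hv: "0 < h_v S" using inscribed_disc_depth[OF S qu kap] by blast
  have c0: "0 < c" using c by (simp add: trace_const_def)
  define E where "E K = 2 * mu_v S * integral K (\<lambda>x. inner (dg_strain S v K x) (dg_strain S v K x))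
      + lam_v S * integral K (\<lambda>x. inner (dg_div S v K x) (dg_div S v K x))" for K
  have cs: "continuous_on UNIV (dg_strain S v K)" "continuous_on UNIV (dg_div S v K)" for K
    using dg_lin_fields(2,3)[OF nb] v by (auto simp: lin_field_def)
  have cs': "continuous_on UNIV (\<lambda>s. dg_strain S v K (vector [s, ?y]))"
    "continuous_on UNIV (\<lambda>s. dg_div S v K (vector [s, ?y]))" for K
    by (rule continuous_on_compose2[OF cs(1)] continuous_on_compose2[OF cs(2)]; auto intro!: continuous_intros)+
  have E0: "0 \<le> E K" for K
    unfolding E_def using pos
    by (intro add_nonneg_nonneg mult_nonneg_nonneg integral_nonneg_always) auto
  have edge: "inner_edge S \<gamma> (edge_poly S \<gamma> (Tv S v)) (edge_poly S \<gamma> (Tv S v)) \<le> ?chi * (c * \<kappa> / h_v S) * E (elt_at S \<gamma>)"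
    if g: "\<gamma> \<in> edges_Gam S" for \<gamma>
  proof -
    let ?K = "elt_at S \<gamma>"
    note Km = elt_at_edge(1)[OF S g] and Ke = elt_at_edge(2)[OF S g]
    note Kf = simplex2_facts[OF mesh_element(1)[OF S Km]]
    obtain a b where ab: "(\<lambda>x. x $h 1) ` \<gamma> = {a..b}" "\<gamma> = (\<lambda>s. vector [s, ?y]) ` {a..b}"
      using interface_edge_segment[OF S g] by metis
    have top: "vector [s, ?y] \<in> ?K" if "s \<in> {a..b}" for s
      using edge_of_imp_subset[OF Ke] that ab(2) by auto
    obtain P where P: "P \<in> ?K" "P $h 2 < ?y" "h_v S \<le> \<kappa> * (?y - P $h 2)"
      using inscribed_disc_depth(2)[OF S qu kap Km] by blast
    let ?tau = "\<lambda>s. dg_stress S v ?K (vector [s, ?y]) *v vector [0, 1]"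
    let ?eps = "\<lambda>s. dg_strain S v ?K (vector [s, ?y])" and ?div = "\<lambda>s. dg_div S v ?K (vector [s, ?y])"
    have ct: "continuous_on UNIV (\<lambda>s. ?tau s $h i)" for i
      unfolding dg_traction_component by (cases "i = 2") (auto intro!: continuous_intros cs')
    have i: "(\<lambda>s. inner (?tau s) (?tau s)) integrable_on {a..b}"
      "(\<lambda>s. inner (?eps s) (?eps s)) integrable_on {a..b}" "(\<lambda>s. inner (?div s) (?div s)) integrable_on {a..b}"
      unfolding inner_vec_def[of "?tau _"]
      by (intro integrable_continuous_interval continuous_intros continuous_on_subset[OF ct]
          continuous_on_subset[OF cs'(1)] continuous_on_subset[OF cs'(2)]; simp)+
    have "inner_edge S \<gamma> (edge_poly S \<gamma> (Tv S v)) (edge_poly S \<gamma> (Tv S v)) = integral {a..b} (\<lambda>s. inner (?tau s) (?tau s))"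
      unfolding inner_edge_def ab(1) dg_traction_edge_poly[OF S g, symmetric] dg_traction_def ..
    also have "\<dots> \<le> integral {a..b} (\<lambda>s. ?chi * (2 * mu_v S * inner (?eps s) (?eps s) + lam_v S * inner (?div s) (?div s)))"
      using i by (intro integral_le dg_traction_bound pos integrable_on_mult_right integrable_add) auto
    also have "\<dots> = ?chi * (2 * mu_v S * integral {a..b} (\<lambda>s. inner (?eps s) (?eps s))
        + lam_v S * integral {a..b} (\<lambda>s. inner (?div s) (?div s)))"
      using i by (simp add: integral_add integrable_on_mult_right del: inner_real_def)
    also have "\<dots> \<le> ?chi * (2 * mu_v S * (c / (?y - P $h 2) * integral ?K (\<lambda>x. inner (dg_strain S v ?K x) (dg_strain S v ?K x)))
        + lam_v S * (c / (?y - P $h 2) * integral ?K (\<lambda>x. inner (dg_div S v ?K x) (dg_div S v ?K x))))"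
    proof (intro mult_left_mono add_mono)
      show "integral {a..b} (\<lambda>s. inner (?eps s) (?eps s))
          \<le> c / (?y - P $h 2) * integral ?K (\<lambda>x. inner (dg_strain S v ?K x) (dg_strain S v ?K x))"
        by (rule trace_inequality_euclidean[OF c _ cs(1) Kf(2,1) top P(1,2)])
          (auto simp: Basis_vec_def inner_axis intro!: dg_line_polys nb)
      show "integral {a..b} (\<lambda>s. inner (?div s) (?div s))
          \<le> c / (?y - P $h 2) * integral ?K (\<lambda>x. inner (dg_div S v ?K x) (dg_div S v ?K x))"
        by (rule trace_inequality_euclidean[OF c _ cs(2) Kf(2,1) top P(1,2)])
          (auto intro!: dg_line_polys nb)
    qed (use pos in auto)
    also have "\<dots> = ?chi * (c / (?y - P $h 2) * E ?K)"
      unfolding E_def by (simp add: algebra_simps)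
    also have "\<dots> \<le> ?chi * (c * \<kappa> / h_v S * E ?K)"
    proof (intro mult_left_mono mult_right_mono E0)
      show "c / (?y - P $h 2) \<le> c * \<kappa> / h_v S"
        using mult_left_mono[OF P(3), of c] P hv c0 by (simp add: field_simps)
    qed (use pos in auto)
    finally show ?thesis by (simp add: mult.assoc)
  qed
  have Tvc: "Tv S v \<in> carrier_vec (2 * N_v S)" by (simp add: Tv_def)
  have "Tv S v \<bullet>\<^sub>v (MGam S *\<^sub>v Tv S v) \<le> (\<Sum>\<gamma>\<in>edges_Gam S. ?chi * (c * \<kappa> / h_v S) * E (elt_at S \<gamma>))"
    unfolding MGam_form[OF S Tvc Tvc] by (intro sum_mono edge)
  also have "\<dots> = ?chi * (c * \<kappa> / h_v S) * (\<Sum>K\<in>elt_at S ` edges_Gam S. E K)"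
    by (simp add: sum.reindex[OF elt_at_inj[OF S]] sum_distrib_left)
  also have "\<dots> \<le> ?chi * (c * \<kappa> / h_v S) * (\<Sum>K\<in>mesh S. E K)"
    using elt_at_edge(1)[OF S] pos c0 kap hv
    by (intro mult_left_mono sum_mono2 mesh_finite[OF S(2)] E0) auto
  also have "(\<Sum>K\<in>mesh S. E K) = dg_energy S v v"
    by (simp add: E_def dg_energy_def inner_Omega_v_def sum.distrib sum_distrib_left)
  finally show ?thesis using c0 kap hv by (simp add: field_simps)
qed

lemma edge_poly_diff:
  assumes "c \<in> carrier_vec (2 * N_v S)" "d \<in> carrier_vec (2 * N_v S)"
  shows "edge_poly S \<gamma> (c - d) x = edge_poly S \<gamma> c x - edge_poly S \<gamma> d x"
proof -
  have "nodal S (c - d) j i = nodal S c j i - nodal S d j i" if "j \<in> edge_dofs S \<gamma>" for i j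
    using that by (intro nodal_linear(3) assms) (simp add: edge_dofs_def)
  then show ?thesis
    by (simp add: Finite_Cartesian_Product.vec_eq_iff edge_poly_component sum_subtractf[symmetric] left_diff_distrib)
qed

lemma dg_rhs_form:
  fixes S :: fd_dg and u v \<phi> :: "real vec"
  assumes S: "geometry S" "dg_setting S"
    and v: "v \<in> carrier_vec (2 * N_v S)" and phi: "\<phi> \<in> carrier_vec (2 * N_v S)"
    and P: "PPg_u2v S \<in> carrier_mat (2 * N_v S) (2 * N_u S)" "PPb_u2v S \<in> carrier_mat (2 * N_v S) (2 * N_u S)"
      "PPg_v2u S \<in> carrier_mat (2 * N_u S) (2 * N_v S)"
    and B: "BGam S \<in> carrier_mat (2 * N_u S) (2 * N_u S)" "Tu S \<in> carrier_mat (2 * N_u S) (2 * N_u S)"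
    and u: "u \<in> carrier_vec (2 * N_u S)"
  defines "uG \<equiv> BGam S *\<^sub>v u" and "vG \<equiv> restrict_Gam S v" and "fG \<equiv> restrict_Gam S \<phi>"
  shows "dg_rhs S u v \<phi> = - dg_energy S v \<phi>
     + 1 / 2 * ((vG - PPg_u2v S *\<^sub>v uG) \<bullet>\<^sub>v (MGam S *\<^sub>v Tv S \<phi>))
     + 1 / 2 * ((Tv S v - PPb_u2v S *\<^sub>v (Tu S *\<^sub>v u)) \<bullet>\<^sub>v (MGam S *\<^sub>v fG))
     - chi1 S * alpha_v S / h_v S * ((vG - PPg_u2v S *\<^sub>v uG) \<bullet>\<^sub>v (MGam S *\<^sub>v fG))
     - chi2 S * beta_v S / h_u S
        * ((PPb_u2v S *\<^sub>v (PPg_v2u S *\<^sub>v vG) - PPb_u2v S *\<^sub>v uG) \<bullet>\<^sub>v (MGam S *\<^sub>v fG))"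
proof -
  let ?n = "2 * N_v S"
  have c: "vG \<in> carrier_vec ?n" "fG \<in> carrier_vec ?n" "Tv S v \<in> carrier_vec ?n" "Tv S \<phi> \<in> carrier_vec ?n"
    "uG \<in> carrier_vec (2 * N_u S)" "PPg_u2v S *\<^sub>v uG \<in> carrier_vec ?n"
    "PPb_u2v S *\<^sub>v (Tu S *\<^sub>v u) \<in> carrier_vec ?n" "PPb_u2v S *\<^sub>v (PPg_v2u S *\<^sub>v vG) \<in> carrier_vec ?n"
    "PPb_u2v S *\<^sub>v uG \<in> carrier_vec ?n"
    using P B u v by (auto simp: vG_def fG_def uG_def restrict_Gam_def Tv_def intro!: mult_mat_vec_carrier)
  have form: "(\<Sum>\<gamma>\<in>edges_Gam S. inner_edge S \<gamma> (f \<gamma>) (g \<gamma>)) = a \<bullet>\<^sub>v (MGam S *\<^sub>v b)"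
    if "a \<in> carrier_vec ?n" "b \<in> carrier_vec ?n"
      "\<And>\<gamma> s. \<gamma> \<in> edges_Gam S \<Longrightarrow> f \<gamma> (vector [s, y_Gam S]) = edge_poly S \<gamma> a (vector [s, y_Gam S])"
      "\<And>\<gamma> s. \<gamma> \<in> edges_Gam S \<Longrightarrow> g \<gamma> (vector [s, y_Gam S]) = edge_poly S \<gamma> b (vector [s, y_Gam S])"
    for f g a b
    unfolding MGam_form[OF S that(1,2)] by (intro sum.cong refl) (simp add: inner_edge_def that(3,4))
  note tr = dg_trace_edge_poly[OF S] dg_traction_edge_poly[OF S] edge_poly_diff
  have 1: "(\<Sum>\<gamma>\<in>edges_Gam S. inner_edge S \<gamma>
      (\<lambda>x. dg_trace S \<gamma> v x - edge_poly S \<gamma> (PPg_u2v S *\<^sub>v uG) x) (dg_traction S \<gamma> \<phi>))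
    = (vG - PPg_u2v S *\<^sub>v uG) \<bullet>\<^sub>v (MGam S *\<^sub>v Tv S \<phi>)"
    using c by (intro form) (simp_all add: tr vG_def)
  have 2: "(\<Sum>\<gamma>\<in>edges_Gam S. inner_edge S \<gamma>
      (\<lambda>x. dg_traction S \<gamma> v x - edge_poly S \<gamma> (PPb_u2v S *\<^sub>v (Tu S *\<^sub>v u)) x) (dg_trace S \<gamma> \<phi>))
    = (Tv S v - PPb_u2v S *\<^sub>v (Tu S *\<^sub>v u)) \<bullet>\<^sub>v (MGam S *\<^sub>v fG)"
    using c by (intro form) (simp_all add: tr fG_def)
  have 3: "(\<Sum>\<gamma>\<in>edges_Gam S. inner_edge S \<gamma>
      (\<lambda>x. dg_trace S \<gamma> v x - edge_poly S \<gamma> (PPg_u2v S *\<^sub>v uG) x) (dg_trace S \<gamma> \<phi>))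
    = (vG - PPg_u2v S *\<^sub>v uG) \<bullet>\<^sub>v (MGam S *\<^sub>v fG)"
    using c by (intro form) (simp_all add: tr vG_def fG_def)
  have 4: "(\<Sum>\<gamma>\<in>edges_Gam S. inner_edge S \<gamma>
      (\<lambda>x. edge_poly S \<gamma> (PPb_u2v S *\<^sub>v (PPg_v2u S *\<^sub>v vG)) x - edge_poly S \<gamma> (PPb_u2v S *\<^sub>v uG) x) (dg_trace S \<gamma> \<phi>))
    = (PPb_u2v S *\<^sub>v (PPg_v2u S *\<^sub>v vG) - PPb_u2v S *\<^sub>v uG) \<bullet>\<^sub>v (MGam S *\<^sub>v fG)"
    using c by (intro form) (simp_all add: tr fG_def)
  show ?thesis
    unfolding dg_rhs_def Let_def uG_def[symmetric] vG_def[symmetric] 1 2 3 4 dg_energy_def by simp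
qed

section \<open>The coupled energy\<close>

text \<open>The two schemes see the jump of the displacement in their own degrees of freedom: here at grid points,
and in \<open>jump_v\<close> at DG nodes.\<close>

definition jump_u :: "fd_dg \<Rightarrow> real vec \<Rightarrow> real vec \<Rightarrow> real vec" where
  "jump_u S u v = BGam S *\<^sub>v u - PPg_v2u S *\<^sub>v restrict_Gam S v"

definition jump_v :: "fd_dg \<Rightarrow> real vec \<Rightarrow> real vec \<Rightarrow> real vec" where
  "jump_v S u v = restrict_Gam S v - PPg_u2v S *\<^sub>v (BGam S *\<^sub>v u)"

definition hform :: "fd_dg \<Rightarrow> real vec \<Rightarrow> real vec \<Rightarrow> real" where
  "hform S x y = x \<bullet>\<^sub>v (Hx S *\<^sub>v y)"

definition mform :: "fd_dg \<Rightarrow> real vec \<Rightarrow> real vec \<Rightarrow> real" where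
  "mform S x y = x \<bullet>\<^sub>v (MGam S *\<^sub>v y)"

text \<open>On the diagonal this is twice the potential energy of the discretization. The polarized form is needed
because the rate of change of the energy pairs the displacements with the velocities.\<close>

definition coupled_form ::
  "fd_dg \<Rightarrow> real mat \<Rightarrow> real mat \<Rightarrow> real vec \<Rightarrow> real vec \<Rightarrow> real vec \<Rightarrow> real vec \<Rightarrow> real" where
  "coupled_form S Rx Ry u v w \<phi> =
     (fd_energy S Rx Ry u w
      + (- 1 / 2) * (hform S (jump_u S u v) (Tu S *\<^sub>v w) + hform S (jump_u S w \<phi>) (Tu S *\<^sub>v u))
      + chi2 S * beta_v S / h_u S * hform S (jump_u S u v) (jump_u S w \<phi>))
   + (dg_energy S v \<phi>
      + (- 1 / 2) * (mform S (jump_v S u v) (Tv S \<phi>) + mform S (jump_v S w \<phi>) (Tv S v))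
      + chi1 S * alpha_v S / h_v S * mform S (jump_v S u v) (jump_v S w \<phi>))"

lemma projection_carrier:
  assumes "projections S"
  shows "PPg_u2v S \<in> carrier_mat (2 * N_v S) (2 * N_u S)" "PPb_u2v S \<in> carrier_mat (2 * N_v S) (2 * N_u S)"
    "PPg_v2u S \<in> carrier_mat (2 * N_u S) (2 * N_v S)" "PPb_v2u S \<in> carrier_mat (2 * N_u S) (2 * N_v S)"
  using assms
  by (auto simp: projections_def embedded_u2v_def embedded_v2u_def PPg_u2v_def PPb_u2v_def PPg_v2u_def PPb_v2u_def
      intro!: kron_carrier)

lemma grid_dim: "2 * grid_m S * grid_n S = 2 * N_u S"
  by (simp add: N_u_def)

lemma hform_sym_bilinear: "fd_setting S \<Longrightarrow> sym_bilinear (2 * N_u S) (hform S)"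
  using sym_bilinear_mat[OF fd_operator_carrier(3) fd_H_symmetric] by (simp add: hform_def[abs_def] grid_dim)

lemma mform_sym_bilinear: "sym_bilinear (2 * N_v S) (mform S)"
  using sym_bilinear_mat[OF MGam_carrier MGam_symmetric] by (simp add: mform_def[abs_def])

lemma hform_nonneg:
  assumes fd: "fd_setting S" and x: "x \<in> carrier_vec (2 * N_u S)"
  shows "0 \<le> hform S x x"
proof -
  note s = sbp_facts[OF fd_sbp(1)[OF fd]]
  have x': "x \<in> carrier_vec (2 * grid_m S * grid_n S)" using x by (simp add: grid_dim)
  have one: "diagonal_mat (1\<^sub>m (grid_n S) :: real mat)" by (auto simp: diagonal_mat_def)
  have "hform S x x = (\<Sum>q<grid_m S * grid_n S. hx S $$ (q div grid_n S, q div grid_n S)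
      * 1\<^sub>m (grid_n S) $$ (q mod grid_n S, q mod grid_n S)
      * ((x $ q)\<^sup>2 + (x $ (grid_m S * grid_n S + q))\<^sup>2))"
    unfolding hform_def Hx_def full_tensor
      tensor_diagonal_form[OF one_carrier_mat s(1,2) one_carrier_mat one x' x']
    by (simp add: power2_eq_square)
  also have "\<dots> \<ge> 0"
    using s(3) by (intro sum_nonneg mult_nonneg_nonneg) (auto simp: div_mod_less less_imp_le)
  finally show ?thesis .
qed

lemma mform_nonneg:
  assumes "geometry S" "dg_setting S" "x \<in> carrier_vec (2 * N_v S)"
  shows "0 \<le> mform S x x"
  unfolding mform_def MGam_form[OF assms(1,2,3,3)] inner_edge_def
  by (intro sum_nonneg integral_nonneg_always) simp

text \<open>Norm compatibility says that \<open>\<Pi>\<^sup>b\<^sub>v\<^sub>2\<^sub>u\<close> is the adjoint of \<open>\<Pi>\<^sup>g\<^sub>u\<^sub>2\<^sub>v\<close>, and \<open>\<Pi>\<^sup>g\<^sub>v\<^sub>2\<^sub>u\<close> that of \<open>\<Pi>\<^sup>b\<^sub>u\<^sub>2\<^sub>v\<close>, for the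
products given by \<open>\<H>\<^sub>x\<close> and \<open>\<M>\<^sub>\<Gamma>\<close>.\<close>

lemma norm_compatible_forms:
  assumes P: "projections S" and nc: "norm_compatible S" and fd: "fd_setting S"
    and x: "x \<in> carrier_vec (2 * N_u S)" and z: "z \<in> carrier_vec (2 * N_v S)"
  shows "hform S x (PPb_v2u S *\<^sub>v z) = mform S (PPg_u2v S *\<^sub>v x) z"
    "mform S (PPb_u2v S *\<^sub>v x) z = hform S x (PPg_v2u S *\<^sub>v z)"
proof -
  let ?nu = "2 * N_u S" and ?nv = "2 * N_v S"
  note p = projection_carrier[OF P]
  have H: "Hx S \<in> carrier_mat ?nu ?nu" using fd_operator_carrier(3)[OF fd] by (simp add: grid_dim)
  have core: "x \<bullet>\<^sub>v (Hx S *\<^sub>v (P1 *\<^sub>v z)) = (P2 *\<^sub>v x) \<bullet>\<^sub>v (MGam S *\<^sub>v z)"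
    if p1: "P1 \<in> carrier_mat ?nu ?nv" and p2: "P2 \<in> carrier_mat ?nv ?nu"
      and e: "MGam S * P2 = transpose_mat (Hx S * P1)" for P1 P2
  proof -
    have hp: "Hx S * P1 \<in> carrier_mat ?nu ?nv" using H p1 by simp
    have "x \<bullet>\<^sub>v (Hx S *\<^sub>v (P1 *\<^sub>v z)) = x \<bullet>\<^sub>v ((Hx S * P1) *\<^sub>v z)"
      using H p1 z by simp
    also have "\<dots> = (transpose_mat (Hx S * P1) *\<^sub>v x) \<bullet>\<^sub>v z"
      using adjoint_scalar_prod[of "transpose_mat (Hx S * P1)" ?nv ?nu x z] hp x z by simp
    also have "\<dots> = (MGam S *\<^sub>v (P2 *\<^sub>v x)) \<bullet>\<^sub>v z"
      unfolding e[symmetric] using p2 x by (simp add: assoc_mult_mat_vec[OF MGam_carrier])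
    also have "\<dots> = (P2 *\<^sub>v x) \<bullet>\<^sub>v (MGam S *\<^sub>v z)"
      using adjoint_scalar_prod[OF MGam_carrier, of "P2 *\<^sub>v x" S z] p2 x z by (simp add: MGam_symmetric)
    finally show ?thesis .
  qed
  show "hform S x (PPb_v2u S *\<^sub>v z) = mform S (PPg_u2v S *\<^sub>v x) z"
    unfolding hform_def mform_def using nc by (intro core p) (simp add: norm_compatible_def)
  show "mform S (PPb_u2v S *\<^sub>v x) z = hform S x (PPg_v2u S *\<^sub>v z)"
    unfolding hform_def mform_def using nc by (intro core[symmetric] p) (simp add: norm_compatible_def)
qed

text \<open>The traction is supported on \<open>\<Gamma>\<close>, and the restriction to \<open>\<Gamma>\<close> commutes with the norm in \<open>x\<close>.\<close>

lemma BGam_facts: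
  assumes fd: "fd_setting S"
  shows "transpose_mat (BGam S) = BGam S" "BGam S * (Hx S * Tu S) = Hx S * Tu S"
proof -
  let ?m = "grid_m S" and ?n = "grid_n S" and ?N = "2 * grid_m S * grid_n S"
  note c = fd_operator_carrier[OF fd]
  note B0 = B_carrier(1)[of ?n] B_first_diagonal[of ?n] and B2 = B_first_idem[of ?n]
  show "transpose_mat (BGam S) = BGam S"
    by (simp add: BGam_def full_tensor tensor_transpose diagonal_transpose[OF B0])
  have hxc: "hx S \<in> carrier_mat ?m ?m" using sbp_facts(1)[OF fd_sbp(1)[OF fd]] .
  have "BGam S * Hx S * BGam S = Hx S * BGam S"
    using hxc B0(1) by (simp add: BGam_def Hx_def full_tensor tensor_mult[of _ _ _ ?m _ _ ?n]
        right_mult_one_mat[OF B0(1)] left_mult_one_mat[OF B0(1)] left_mult_one_mat[OF hxc] right_mult_one_mat[OF hxc] B2)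
  then have "BGam S * Hx S * BGam S * Ty S = Hx S * BGam S * Ty S" by simp
  then have "BGam S * (Hx S * (BGam S * Ty S)) = Hx S * (BGam S * Ty S)"
    using c by (simp add: assoc_mult_mat[of _ ?N ?N _ ?N _ ?N])
  moreover have neg: "A * - X = - (A * X)" if "A \<in> carrier_mat ?N ?N" "X \<in> carrier_mat ?N ?N" for A X :: "real mat"
    using that by simp
  ultimately show "BGam S * (Hx S * Tu S) = Hx S * Tu S"
    unfolding Tu_def using c by (simp add: neg)
qed

text \<open>Summation by parts produces the full work of the traction on \<open>\<Gamma>\<close>; the flux of the scheme subtracts half
of it, and the other half pairs with the transposed flux. Moving all projections to one side by
\<open>norm_compatible_forms\<close> matches the remaining terms with those of the DG scheme.\<close>

lemma coupled_weak_form: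
  assumes S: "coupled_setting S" and nc: "norm_compatible S"
    and par: "alpha_u S = alpha_v S" "beta_u S = beta_v S"
    and Rx: "sym_psd (grid_m S) Rx" "opA (sbp_x S) = transpose_mat (dx S) * hx S * dx S + Rx"
    and Ry: "sym_psd (grid_n S) Ry"
      "opD2 (sbp_y S) = minv (hy S)
         * (- (transpose_mat (dy S) * hy S * dy S) - Ry + B_both (grid_n S) * dy S)"
    and u: "u \<in> carrier_vec (2 * N_u S)" and w: "w \<in> carrier_vec (2 * N_u S)"
    and v: "v \<in> carrier_vec (2 * N_v S)" and phi: "\<phi> \<in> carrier_vec (2 * N_v S)"
  shows "w \<bullet>\<^sub>v (Hfull S *\<^sub>v fd_rhs S u v) + dg_rhs S u v \<phi> = - coupled_form S Rx Ry u v w \<phi>"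
proof -
  have geo: "geometry S" "dg_setting S" and fd: "fd_setting S" and pr: "projections S"
    using S by (auto simp: coupled_setting_def)
  let ?nu = "2 * N_u S" and ?nv = "2 * N_v S"
  note c = fd_operator_carrier[OF fd, unfolded grid_dim]
  note p = projection_carrier[OF pr]
  have Rc: "Rx \<in> carrier_mat (grid_m S) (grid_m S)" "Ry \<in> carrier_mat (grid_n S) (grid_n S)"
    using Rx Ry by (auto simp: sym_psd_def)
  define uG vG wG fG where "uG = BGam S *\<^sub>v u" and "vG = restrict_Gam S v" and "wG = BGam S *\<^sub>v w"
    and "fG = restrict_Gam S \<phi>"
  define T where "T = Tu S *\<^sub>v u"
  have vc: "uG \<in> carrier_vec ?nu" "wG \<in> carrier_vec ?nu" "vG \<in> carrier_vec ?nv" "fG \<in> carrier_vec ?nv"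
    "Tv S v \<in> carrier_vec ?nv" "Tv S \<phi> \<in> carrier_vec ?nv" "T \<in> carrier_vec ?nu" "Tu S *\<^sub>v w \<in> carrier_vec ?nu"
    using c u w by (auto simp: uG_def vG_def wG_def fG_def T_def restrict_Gam_def Tv_def intro!: mult_mat_vec_carrier)
  have pc: "PPg_u2v S *\<^sub>v uG \<in> carrier_vec ?nv" "PPg_u2v S *\<^sub>v wG \<in> carrier_vec ?nv" "PPg_v2u S *\<^sub>v vG \<in> carrier_vec ?nu"
    "PPg_v2u S *\<^sub>v fG \<in> carrier_vec ?nu" "PPb_v2u S *\<^sub>v Tv S v \<in> carrier_vec ?nu" "PPb_u2v S *\<^sub>v T \<in> carrier_vec ?nv"
    "PPb_u2v S *\<^sub>v uG \<in> carrier_vec ?nv" "PPb_u2v S *\<^sub>v (PPg_v2u S *\<^sub>v vG) \<in> carrier_vec ?nv"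
    using p vc by (auto intro!: mult_mat_vec_carrier)
  let ?h = "hform S" and ?M = "mform S"
  note hb = hform_sym_bilinear[OF fd] and mb = mform_sym_bilinear[of S]
  note diff = sym_bilinear_diff[OF hb] sym_bilinear_diff[OF mb]
  have hs: "?h a b = ?h b a" if "a \<in> carrier_vec ?nu" "b \<in> carrier_vec ?nu" for a b
    using hb that unfolding sym_bilinear_def by blast
  have ms: "?M a b = ?M b a" if "a \<in> carrier_vec ?nv" "b \<in> carrier_vec ?nv" for a b
    using mb that unfolding sym_bilinear_def by blast
  \<comment> \<open>The norm is diagonal with positive entries, so it cancels the inverse in front of the penalties.\<close>
  have Hdiag: "diagonal_mat (Hfull S)" "\<And>i. i < ?nu \<Longrightarrow> Hfull S $$ (i, i) \<noteq> 0"
  proof -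
    note sx = sbp_facts[OF fd_sbp(1)[OF fd]] and sy = sbp_facts[OF fd_sbp(2)[OF fd]]
    have e: "Hfull S = 1\<^sub>m 2 \<otimes>\<^sub>k hx S \<otimes>\<^sub>k hy S"
      using sx sy by (simp add: Hfull_def Hx_def Hy_def full_tensor tensor_mult[of _ _ _ "grid_m S" _ _ "grid_n S"])
        (simp add: tensor_def)
    have d1: "diagonal_mat (1\<^sub>m 2 :: real mat)" by (auto simp: diagonal_mat_def)
    have k: "1\<^sub>m 2 \<otimes>\<^sub>k hx S \<in> carrier_mat (2 * grid_m S) (2 * grid_m S)" by (intro kron_carrier sx) simp
    show "diagonal_mat (Hfull S)"
      unfolding e by (intro kron_diagonal[OF k _ sy(1,2)] kron_diagonal[OF _ d1 sx(1,2)]) auto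
    fix i assume "i < ?nu"
    then have i: "i < 2 * grid_m S * grid_n S" by (simp add: grid_dim)
    note d = div_mod_less[OF i] div_mod_less[OF div_mod_less(1)[OF i]]
    have "Hfull S $$ (i, i) = hx S $$ ((i div grid_n S) mod grid_m S, (i div grid_n S) mod grid_m S)
        * hy S $$ (i mod grid_n S, i mod grid_n S)"
      unfolding e using i d sx(1) sy(1) k by (simp add: kron_index)
    also have "\<dots> > 0" using sx(3)[OF d(4)] sy(3)[OF d(2)] by simp
    finally show "Hfull S $$ (i, i) \<noteq> 0" by simp
  qed
  note inv = diagonal_minv[OF c(5) Hdiag]
  have Hinv: "w \<bullet>\<^sub>v (Hfull S *\<^sub>v (minv (Hfull S) *\<^sub>v z)) = w \<bullet>\<^sub>v z" if "z \<in> carrier_vec ?nu" for z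
    using that c inv by (simp add: assoc_mult_mat_vec[of _ ?nu ?nu _ ?nu, symmetric])
  have ic: "minv (Hfull S) *\<^sub>v z \<in> carrier_vec ?nu" if "z \<in> carrier_vec ?nu" for z
    using inv(1) that by (rule mult_mat_vec_carrier)
  define q0 q1 q2 where "q0 = outer_penalty S *\<^sub>v u"
    and "q1 = (- (1 / 2)) \<cdot>\<^sub>v ((BGam S * Hx S) *\<^sub>v (T + PPb_v2u S *\<^sub>v Tv S v))
            + (1 / 2) \<cdot>\<^sub>v ((transpose_mat (Tu S) * Hx S) *\<^sub>v (uG - PPg_v2u S *\<^sub>v vG))"
    and "q2 = (chi1 S * alpha_v S / h_v S) \<cdot>\<^sub>v ((BGam S * Hx S * PPb_v2u S) *\<^sub>v (PPg_u2v S *\<^sub>v uG - vG))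
            + (chi2 S * beta_v S / h_u S) \<cdot>\<^sub>v ((BGam S * Hx S) *\<^sub>v (uG - PPg_v2u S *\<^sub>v vG))"
  have BH: "BGam S * Hx S \<in> carrier_mat ?nu ?nu" "transpose_mat (Tu S) * Hx S \<in> carrier_mat ?nu ?nu"
    "BGam S * Hx S * PPb_v2u S \<in> carrier_mat ?nu ?nv"
    using c p by auto
  have zc: "T + PPb_v2u S *\<^sub>v Tv S v \<in> carrier_vec ?nu" "uG - PPg_v2u S *\<^sub>v vG \<in> carrier_vec ?nu"
    "PPg_u2v S *\<^sub>v uG - vG \<in> carrier_vec ?nv"
    using vc pc by auto
  have qp: "(BGam S * Hx S) *\<^sub>v (T + PPb_v2u S *\<^sub>v Tv S v) \<in> carrier_vec ?nu"
    "(transpose_mat (Tu S) * Hx S) *\<^sub>v (uG - PPg_v2u S *\<^sub>v vG) \<in> carrier_vec ?nu"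
    "(BGam S * Hx S * PPb_v2u S) *\<^sub>v (PPg_u2v S *\<^sub>v uG - vG) \<in> carrier_vec ?nu"
    "(BGam S * Hx S) *\<^sub>v (uG - PPg_v2u S *\<^sub>v vG) \<in> carrier_vec ?nu"
    by (intro mult_mat_vec_carrier[OF BH(1)] mult_mat_vec_carrier[OF BH(2)] mult_mat_vec_carrier[OF BH(3)] zc)+
  have qc: "q0 \<in> carrier_vec ?nu" "q1 \<in> carrier_vec ?nu" "q2 \<in> carrier_vec ?nu"
    using qp c u by (auto simp: q0_def q1_def q2_def intro!: mult_mat_vec_carrier)
  define a1 a2 a3 where "a1 = (L1 S * Dxx S) *\<^sub>v u" and "a2 = (L3 S * Dyy S) *\<^sub>v u"
    and "a3 = ((L2 S + transpose_mat (L2 S)) * Dxy S) *\<^sub>v u"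
  have am: "L1 S * Dxx S \<in> carrier_mat ?nu ?nu" "L3 S * Dyy S \<in> carrier_mat ?nu ?nu"
    "(L2 S + transpose_mat (L2 S)) * Dxy S \<in> carrier_mat ?nu ?nu"
    using c by (auto intro!: mult_carrier_mat[of _ ?nu ?nu] add_carrier_mat)
  have ac: "a1 \<in> carrier_vec ?nu" "a2 \<in> carrier_vec ?nu" "a3 \<in> carrier_vec ?nu"
    unfolding a1_def a2_def a3_def by (intro mult_mat_vec_carrier[OF am(1) u] mult_mat_vec_carrier[OF am(2) u]
        mult_mat_vec_carrier[OF am(3) u])+
  have rhs: "fd_rhs S u v = a1 + a2 + a3 + minv (Hfull S) *\<^sub>v q0 + minv (Hfull S) *\<^sub>v q1 - minv (Hfull S) *\<^sub>v q2"
    unfolding fd_rhs_def Let_def uG_def[symmetric] vG_def[symmetric] T_def[symmetric] par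
      a1_def[symmetric] a2_def[symmetric] a3_def[symmetric] q0_def[symmetric] q1_def[symmetric] q2_def[symmetric] ..
  let ?f = "\<lambda>z. w \<bullet>\<^sub>v (Hfull S *\<^sub>v z)"
  have fadd: "?f (x + y) = ?f x + ?f y" "?f (x - y) = ?f x - ?f y" if "x \<in> carrier_vec ?nu" "y \<in> carrier_vec ?nu" for x y
    using that c(5) w
    by (simp_all add: mult_add_distrib_mat_vec[of _ ?nu ?nu] mult_minus_distrib_mat_vec[of _ ?nu ?nu]
        scalar_prod_add_distrib[of _ ?nu] scalar_prod_minus_distrib[of _ ?nu])
  have F: "?f (fd_rhs S u v) = ?f a1 + ?f a2 + ?f a3 + w \<bullet>\<^sub>v q0 + w \<bullet>\<^sub>v q1 - w \<bullet>\<^sub>v q2"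
    unfolding rhs using ac qc ic[OF qc(1)] ic[OF qc(2)] ic[OF qc(3)]
    by (simp add: fadd Hinv)
  have u': "u \<in> carrier_vec (2 * grid_m S * grid_n S)" "w \<in> carrier_vec (2 * grid_m S * grid_n S)"
    using u w by (simp_all add: grid_dim)
  have I: "?f a1 + ?f a2 + ?f a3 + w \<bullet>\<^sub>v q0 = - fd_energy S Rx Ry w u + w \<bullet>\<^sub>v ((Hx S * Tu S) *\<^sub>v u)"
    using fd_interior_form[OF fd Rc(1) Rx(2) Rc(2) Ry(2) u'(2,1)]
    unfolding a1_def a2_def a3_def q0_def
      assoc_mult_mat_vec[OF c(5) am(1) u] assoc_mult_mat_vec[OF c(5) am(2) u] assoc_mult_mat_vec[OF c(5) am(3) u] .
  have toG: "w \<bullet>\<^sub>v ((BGam S * Hx S) *\<^sub>v z) = ?h wG z" if "z \<in> carrier_vec ?nu" for z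
  proof -
    have hz: "Hx S *\<^sub>v z \<in> carrier_vec ?nu" using c that by auto
    have "w \<bullet>\<^sub>v ((BGam S * Hx S) *\<^sub>v z) = w \<bullet>\<^sub>v (BGam S *\<^sub>v (Hx S *\<^sub>v z))"
      using c that by (simp add: assoc_mult_mat_vec[of _ ?nu ?nu _ ?nu])
    also have "\<dots> = wG \<bullet>\<^sub>v (Hx S *\<^sub>v z)"
      unfolding wG_def using adjoint_scalar_prod[OF c(6) w hz] BGam_facts(1)[OF fd] by simp
    finally show ?thesis by (simp add: hform_def)
  qed
  have TT: "w \<bullet>\<^sub>v ((Hx S * Tu S) *\<^sub>v u) = ?h wG T"
  proof -
    have "w \<bullet>\<^sub>v ((Hx S * Tu S) *\<^sub>v u) = w \<bullet>\<^sub>v ((BGam S * (Hx S * Tu S)) *\<^sub>v u)"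
      by (simp only: BGam_facts(2)[OF fd])
    also have "(BGam S * (Hx S * Tu S)) *\<^sub>v u = (BGam S * Hx S) *\<^sub>v T"
      unfolding T_def using c u by (simp add: assoc_mult_mat_vec[of _ ?nu ?nu _ ?nu] assoc_mult_mat[of _ ?nu ?nu _ ?nu _ ?nu])
    finally show ?thesis using toG[OF vc(7)] by simp
  qed
  have q1a: "w \<bullet>\<^sub>v ((transpose_mat (Tu S) * Hx S) *\<^sub>v z) = ?h (Tu S *\<^sub>v w) z" if "z \<in> carrier_vec ?nu" for z
  proof -
    have hz: "Hx S *\<^sub>v z \<in> carrier_vec ?nu" using c that by auto
    have "w \<bullet>\<^sub>v ((transpose_mat (Tu S) * Hx S) *\<^sub>v z) = w \<bullet>\<^sub>v (transpose_mat (Tu S) *\<^sub>v (Hx S *\<^sub>v z))"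
      using c that by (simp add: assoc_mult_mat_vec[of _ ?nu ?nu _ ?nu])
    also have "\<dots> = ?h (Tu S *\<^sub>v w) z"
      unfolding hform_def using adjoint_scalar_prod[OF c(14) w hz] by simp
    finally show ?thesis .
  qed
  have q2a: "w \<bullet>\<^sub>v ((BGam S * Hx S * PPb_v2u S) *\<^sub>v z) = ?h wG (PPb_v2u S *\<^sub>v z)" if "z \<in> carrier_vec ?nv" for z
  proof -
    have "(BGam S * Hx S * PPb_v2u S) *\<^sub>v z = (BGam S * Hx S) *\<^sub>v (PPb_v2u S *\<^sub>v z)"
      by (rule assoc_mult_mat_vec[OF BH(1) p(4) that])
    then show ?thesis using toG[of "PPb_v2u S *\<^sub>v z"] mult_mat_vec_carrier[OF p(4) that] by simp
  qed
  have wadd: "w \<bullet>\<^sub>v (x + y) = w \<bullet>\<^sub>v x + w \<bullet>\<^sub>v y" if "x \<in> carrier_vec ?nu" "y \<in> carrier_vec ?nu" for x y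
    using that w by (simp add: scalar_prod_add_distrib[of _ ?nu])
  have wsm: "w \<bullet>\<^sub>v (r \<cdot>\<^sub>v x) = r * (w \<bullet>\<^sub>v x)" if "x \<in> carrier_vec ?nu" for r x
    using that w by (simp add: scalar_prod_smult_distrib[of _ ?nu])
  have hadd: "?h wG (x + y) = ?h wG x + ?h wG y" if "x \<in> carrier_vec ?nu" "y \<in> carrier_vec ?nu" for x y
    using that vc c by (simp add: hform_def mult_add_distrib_mat_vec[of _ ?nu ?nu] scalar_prod_add_distrib[of _ ?nu])
  note N = norm_compatible_forms[OF pr nc fd]
  have Q1: "w \<bullet>\<^sub>v q1 = - 1 / 2 * (?h wG T + ?M (PPg_u2v S *\<^sub>v wG) (Tv S v)) + 1 / 2 * ?h (Tu S *\<^sub>v w) (uG - PPg_v2u S *\<^sub>v vG)"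
    unfolding q1_def using qp zc vc pc by (simp add: wadd wsm toG q1a hadd N(1))
  have Q2: "w \<bullet>\<^sub>v q2 = chi1 S * alpha_v S / h_v S * ?M (PPg_u2v S *\<^sub>v wG) (PPg_u2v S *\<^sub>v uG - vG)
      + chi2 S * beta_v S / h_u S * ?h wG (uG - PPg_v2u S *\<^sub>v vG)"
    unfolding q2_def using qp zc vc pc by (simp add: wadd wsm toG q2a N(1))
  have D: "dg_rhs S u v \<phi> = - dg_energy S v \<phi> + 1 / 2 * ?M (vG - PPg_u2v S *\<^sub>v uG) (Tv S \<phi>)
     + 1 / 2 * ?M (Tv S v - PPb_u2v S *\<^sub>v T) fG
     - chi1 S * alpha_v S / h_v S * ?M (vG - PPg_u2v S *\<^sub>v uG) fG
     - chi2 S * beta_v S / h_u S * ?M (PPb_u2v S *\<^sub>v (PPg_v2u S *\<^sub>v vG) - PPb_u2v S *\<^sub>v uG) fG"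
    using dg_rhs_form[OF geo v phi p(1-3) c(6,14) u]
    unfolding mform_def uG_def vG_def fG_def T_def .
  have sw: "fd_energy S Rx Ry w u = fd_energy S Rx Ry u w"
    using fd_energy_sym_bilinear[OF fd Rx(1) Ry(1)] u' unfolding sym_bilinear_def by blast
  have J: "jump_u S u v = uG - PPg_v2u S *\<^sub>v vG" "jump_u S w \<phi> = wG - PPg_v2u S *\<^sub>v fG"
    "jump_v S u v = vG - PPg_u2v S *\<^sub>v uG" "jump_v S w \<phi> = fG - PPg_u2v S *\<^sub>v wG"
    by (simp_all add: jump_u_def jump_v_def uG_def vG_def wG_def fG_def)
  have gap: "uG - PPg_v2u S *\<^sub>v vG \<in> carrier_vec ?nu" "vG - PPg_u2v S *\<^sub>v uG \<in> carrier_vec ?nv"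
    using vc pc by auto
  have X1: "?h (uG - PPg_v2u S *\<^sub>v vG) (Tu S *\<^sub>v w) = ?h (Tu S *\<^sub>v w) (uG - PPg_v2u S *\<^sub>v vG)"
    by (rule hs[OF gap(1) vc(8)])
  have X2: "?h (wG - PPg_v2u S *\<^sub>v fG) T = ?h wG T - ?M (PPb_u2v S *\<^sub>v T) fG"
    unfolding diff(1)[OF vc(2) pc(4) vc(7)] N(2)[OF vc(7,4)] hs[OF pc(4) vc(7)] ..
  have X3: "?M (fG - PPg_u2v S *\<^sub>v wG) (Tv S v) = ?M (Tv S v) fG - ?M (PPg_u2v S *\<^sub>v wG) (Tv S v)"
    unfolding diff(3)[OF vc(4) pc(2) vc(5)] ms[OF vc(4,5)] ..
  have X4: "?M (Tv S v - PPb_u2v S *\<^sub>v T) fG = ?M (Tv S v) fG - ?M (PPb_u2v S *\<^sub>v T) fG"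
    by (rule diff(3)[OF vc(5) pc(6) vc(4)])
  have X5: "?M (PPb_u2v S *\<^sub>v (PPg_v2u S *\<^sub>v vG) - PPb_u2v S *\<^sub>v uG) fG
      = ?h (PPg_v2u S *\<^sub>v vG) (PPg_v2u S *\<^sub>v fG) - ?h uG (PPg_v2u S *\<^sub>v fG)"
    unfolding diff(3)[OF pc(8,7) vc(4)] N(2)[OF pc(3) vc(4)] N(2)[OF vc(1,4)] ..
  have X6: "?h (uG - PPg_v2u S *\<^sub>v vG) (wG - PPg_v2u S *\<^sub>v fG) = ?h wG (uG - PPg_v2u S *\<^sub>v vG)
      - (?h uG (PPg_v2u S *\<^sub>v fG) - ?h (PPg_v2u S *\<^sub>v vG) (PPg_v2u S *\<^sub>v fG))"
    unfolding diff(2)[OF vc(2) pc(4) gap(1)] diff(1)[OF vc(1) pc(3) pc(4)] hs[OF gap(1) vc(2)] ..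
  have X7: "?M (vG - PPg_u2v S *\<^sub>v uG) (fG - PPg_u2v S *\<^sub>v wG)
      = ?M (vG - PPg_u2v S *\<^sub>v uG) fG + ?M (PPg_u2v S *\<^sub>v wG) (PPg_u2v S *\<^sub>v uG - vG)"
    unfolding diff(4)[OF vc(4) pc(2) gap(2)] diff(3)[OF vc(3) pc(1) pc(2)] diff(4)[OF pc(1) vc(3) pc(2)]
      ms[OF vc(3) pc(2)] ms[OF pc(1) pc(2)] by simp
  have collect: "- K + A + (- 1 / 2 * (A + B) + 1 / 2 * C) - (k1 * G + k2 * L)
      + (- E + 1 / 2 * P + 1 / 2 * (X - Y) - k1 * R - k2 * (Z - Z'))
    = - (K + (- 1 / 2) * (C + (A - Y)) + k2 * (L - (Z' - Z))
      + (E + (- 1 / 2) * (P + (X - B)) + k1 * (R + G)))"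
    for K A B C k1 k2 G L E P X Y R Z Z' :: real
    by (simp add: algebra_simps add_divide_distrib diff_divide_distrib)
  show ?thesis
    unfolding F I TT Q1 Q2 D coupled_form_def J sw T_def[symmetric] X1 X2 X3 X4 X5 X6 X7
    by (rule collect)
qed

text \<open>The finite difference and the DG part are non-negative separately; each is an instance of
\<open>penalty_absorbs_flux\<close> with its traction bound as the hypothesis on the bulk energy.\<close>

lemma coupled_form_nonneg:
  assumes S: "coupled_setting S"
    and pos: "0 < mu_u S" "0 < lam_u S" "0 < mu_v S" "0 < lam_v S"
    and chi: "chi1 S = 2 * mu_v S + lam_v S" "chi2 S = 2 * mu_u S + lam_u S"
    and R: "sym_psd (grid_m S) Rx" "sym_psd (grid_n S) Ry"
    and qu: "quasi_uniform \<kappa> (mesh S)" and kap: "0 < \<kappa>" and c: "trace_const (deg_q S) c"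
    and alpha: "c * \<kappa> / 4 \<le> alpha_v S" and beta: "h_u S / (4 * hy S $$ (0, 0)) \<le> beta_v S"
    and u: "u \<in> carrier_vec (2 * N_u S)" and v: "v \<in> carrier_vec (2 * N_v S)"
  shows "0 \<le> coupled_form S Rx Ry u v u v"
proof -
  have geo: "geometry S" "dg_setting S" and fd: "fd_setting S" and pr: "projections S"
    using S by (auto simp: coupled_setting_def)
  note o = fd_operator_carrier[OF fd, unfolded grid_dim]
  note p = projection_carrier[OF pr]
  have vG: "restrict_Gam S v \<in> carrier_vec (2 * N_v S)" "Tv S v \<in> carrier_vec (2 * N_v S)"
    by (simp_all add: restrict_Gam_def Tv_def)
  have j: "jump_u S u v \<in> carrier_vec (2 * N_u S)" "jump_v S u v \<in> carrier_vec (2 * N_v S)"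
    "Tu S *\<^sub>v u \<in> carrier_vec (2 * N_u S)"
    using o p u v vG unfolding jump_u_def jump_v_def
    by (auto intro!: minus_carrier_vec mult_mat_vec_carrier)
  have n0: "0 < grid_n S" "2 \<le> grid_m S" using fd by (auto simp: fd_setting_def)
  have hy0: "0 < hy S $$ (0, 0)" using sbp_facts(3)[OF fd_sbp(2)[OF fd] n0(1)] .
  have hu: "0 < h_u S" using geo n0 by (simp add: h_u_def geometry_def)
  have hv: "0 < h_v S" using inscribed_disc_depth(1)[OF geo qu kap] .
  have c0: "0 < c" using c by (simp add: trace_const_def)
  have u': "u \<in> carrier_vec (2 * grid_m S * grid_n S)" using u by (simp add: grid_dim)
  have fdb: "hy S $$ (0, 0) * hform S (Tu S *\<^sub>v u) (Tu S *\<^sub>v u) \<le> chi2 S * fd_energy S Rx Ry u u"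
    using fd_traction_bound[OF fd R pos(1,2) u'] by (simp add: hform_def chi)
  have 1: "0 \<le> fd_energy S Rx Ry u u - hform S (jump_u S u v) (Tu S *\<^sub>v u)
      + chi2 S * beta_v S / h_u S * hform S (jump_u S u v) (jump_u S u v)"
    using hy0 hu pos chi
    by (intro penalty_absorbs_flux[OF hform_sym_bilinear[OF fd] hform_nonneg[OF fd] j(1,3) _ _ hy0 fdb beta]) auto
  have g: "0 < h_v S / (c * \<kappa>)" using hv c0 kap by simp
  have al: "h_v S / (4 * (h_v S / (c * \<kappa>))) \<le> alpha_v S" using alpha hv c0 kap by simp
  have dgb: "h_v S / (c * \<kappa>) * mform S (Tv S v) (Tv S v) \<le> chi1 S * dg_energy S v v"
    using dg_traction_energy_bound[OF geo qu kap c pos(3,4) v] by (simp add: mform_def chi)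
  have 2: "0 \<le> dg_energy S v v - mform S (jump_v S u v) (Tv S v)
      + chi1 S * alpha_v S / h_v S * mform S (jump_v S u v) (jump_v S u v)"
    using hv pos chi
    by (intro penalty_absorbs_flux[OF mform_sym_bilinear mform_nonneg[OF geo] j(2) vG(2) _ _ g dgb al]) auto
  from 1 2 show ?thesis by (simp add: coupled_form_def)
qed

definition pair_form :: "fd_dg \<Rightarrow> real mat \<Rightarrow> real mat \<Rightarrow> real vec \<Rightarrow> real vec \<Rightarrow> real" where
  "pair_form S Rx Ry x y = coupled_form S Rx Ry (vec_first x (2 * N_u S)) (vec_last x (2 * N_v S))
     (vec_first y (2 * N_u S)) (vec_last y (2 * N_v S))"

lemma pair_form_sym_bilinear:
  assumes S: "coupled_setting S" and R: "sym_psd (grid_m S) Rx" "sym_psd (grid_n S) Ry"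
  shows "sym_bilinear (2 * N_u S + 2 * N_v S) (pair_form S Rx Ry)"
proof -
  have geo: "geometry S" "dg_setting S" and fd: "fd_setting S" and pr: "projections S"
    using S by (auto simp: coupled_setting_def)
  let ?nu = "2 * N_u S" and ?nv = "2 * N_v S"
  let ?n = "?nu + ?nv" and ?u = "\<lambda>x. vec_first x ?nu" and ?v = "\<lambda>x. vec_last x ?nv"
  note o = fd_operator_carrier[OF fd, unfolded grid_dim]
  note p = projection_carrier[OF pr]
  have nb: "nodal_basis S" using geo by (simp add: dg_setting_def)
  note U = lin_map_first[of ?nu ?nv] and V = lin_map_last[of ?nu ?nv]
  note BU = lin_map_comp[OF U lin_map_mat[OF o(6)]] and GV = lin_map_comp[OF V lin_map_restrict]
  have JU: "lin_map ?n ?nu (\<lambda>x. jump_u S (?u x) (?v x))"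
    unfolding jump_u_def by (intro lin_map_diff BU lin_map_comp[OF GV lin_map_mat[OF p(3)]])
  have JV: "lin_map ?n ?nv (\<lambda>x. jump_v S (?u x) (?v x))"
    unfolding jump_v_def by (intro lin_map_diff GV lin_map_comp[OF BU lin_map_mat[OF p(1)]])
  note TU = lin_map_comp[OF U lin_map_mat[OF o(14)]] and TV = lin_map_comp[OF V lin_map_Tv[OF nb]]
  note hb = hform_sym_bilinear[OF fd] and mb = mform_sym_bilinear[of S]
  have "sym_bilinear ?n (\<lambda>x y. pair_form S Rx Ry x y)"
    unfolding pair_form_def coupled_form_def
    by (intro sym_bilinear_cross[OF hb JU TU] sym_bilinear_cross[OF mb JV TV]
        sym_bilinear_pullback[OF hb JU] sym_bilinear_pullback[OF mb JV]
        sym_bilinear_pullback[OF fd_energy_sym_bilinear[OF fd R, unfolded grid_dim] U]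
        sym_bilinear_pullback[OF inner_Omega_v_sym_bilinear(2)[OF geo] V]
        sym_bilinear_scale sym_bilinear_add)
  then show ?thesis .
qed

text \<open>The velocities are the test pair in \<open>coupled_weak_form\<close>.\<close>

lemma energy_identity:
  assumes S: "coupled_setting S" and nc: "norm_compatible S"
    and par: "alpha_u S = alpha_v S" "beta_u S = beta_v S"
    and Rx: "sym_psd (grid_m S) Rx" "opA (sbp_x S) = transpose_mat (dx S) * hx S * dx S + Rx"
    and Ry: "sym_psd (grid_n S) Ry"
      "opD2 (sbp_y S) = minv (hy S)
         * (- (transpose_mat (dy S) * hy S * dy S) - Ry + B_both (grid_n S) * dy S)"
    and Q: "\<And>x. x \<in> carrier_vec (2 * N_u S + 2 * N_v S) \<Longrightarrow> quad_form Q x = pair_form S Rx Ry x x"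
    and sol: "solution S T u ut utt v vt vtt" and t: "t \<in> {0<..T}"
  shows "((\<lambda>s. rho_u S * quad_form (Hfull S) (ut s)
             + rho_v S * inner_Omega_v S (dg_fun S (vt s)) (dg_fun S (vt s))
             + quad_form Q (u s @\<^sub>v v s)) has_real_derivative 0) (at t within {0<..T})"
proof -
  have geo: "geometry S" "dg_setting S" and fd: "fd_setting S"
    using S by (auto simp: coupled_setting_def)
  let ?nu = "2 * N_u S" and ?nv = "2 * N_v S"
  let ?b = "\<lambda>x y. x \<bullet>\<^sub>v (Hfull S *\<^sub>v y)" and ?m = "\<lambda>x y. inner_Omega_v S (dg_fun S x) (dg_fun S y)"
  note H = fd_operator_carrier(5)[OF fd, unfolded grid_dim]
  have "transpose_mat (Hfull S) = Hfull S"
  proof -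
    note sx = sbp_facts[OF fd_sbp(1)[OF fd]] and sy = sbp_facts[OF fd_sbp(2)[OF fd]]
    have "Hfull S = tensor (1\<^sub>m 2) (hx S) (hy S)"
      using sx(1) sy(1) by (simp add: Hfull_def Hx_def Hy_def full_tensor tensor_mult[of _ _ _ "grid_m S" _ _ "grid_n S"])
    then show ?thesis by (simp add: tensor_transpose sx(8) sy(8))
  qed
  note b = sym_bilinear_mat[OF H this]
  note m = inner_Omega_v_sym_bilinear(1)[OF geo]
  note pf = pair_form_sym_bilinear[OF S Rx(1) Ry(1)]
  have td: "time_deriv ?nu T u ut" "time_deriv ?nu T ut utt" "time_deriv ?nv T v vt" "time_deriv ?nv T vt vtt"
    using sol by (auto simp: solution_def)
  have c: "u s \<in> carrier_vec ?nu" "ut s \<in> carrier_vec ?nu" "utt s \<in> carrier_vec ?nu"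
    "v s \<in> carrier_vec ?nv" "vt s \<in> carrier_vec ?nv" "vtt s \<in> carrier_vec ?nv" if "s \<in> {0<..T}" for s
    using td that by (auto simp: time_deriv_def)
  have eqs: "rho_u S \<cdot>\<^sub>v utt t = fd_rhs S (u t) (v t)"
    "rho_v S * ?m (vtt t) (vt t) = dg_rhs S (u t) (v t) (vt t)"
    using sol t c[OF t] by (auto simp: solution_def)
  have "((\<lambda>s. rho_u S * ?b (ut s) (ut s) + rho_v S * ?m (vt s) (vt s)
      + pair_form S Rx Ry (u s @\<^sub>v v s) (u s @\<^sub>v v s)) has_real_derivative
      (rho_u S * (2 * ?b (ut t) (utt t)) + rho_v S * (2 * ?m (vt t) (vtt t))
      + 2 * pair_form S Rx Ry (u t @\<^sub>v v t) (ut t @\<^sub>v vt t))) (at t within {0<..T})"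
    by (intro DERIV_add DERIV_cmult sym_bilinear_has_derivative[OF b td(2) t]
        sym_bilinear_has_derivative[OF m td(4) t]
        sym_bilinear_has_derivative[OF pf time_deriv_append[OF td(1,3)] t])
  also have "rho_u S * (2 * ?b (ut t) (utt t)) + rho_v S * (2 * ?m (vt t) (vtt t))
      + 2 * pair_form S Rx Ry (u t @\<^sub>v v t) (ut t @\<^sub>v vt t) = 0"
  proof -
    have "rho_u S * ?b (ut t) (utt t) = ?b (ut t) (rho_u S \<cdot>\<^sub>v utt t)"
      using H c[OF t] by (simp add: mult_mat_vec[of _ ?nu ?nu] scalar_prod_smult_distrib[of _ ?nu])
    moreover have "?m (vt t) (vtt t) = ?m (vtt t) (vt t)"
      using m c[OF t] unfolding sym_bilinear_def by blast
    moreover have "pair_form S Rx Ry (u t @\<^sub>v v t) (ut t @\<^sub>v vt t) = coupled_form S Rx Ry (u t) (v t) (ut t) (vt t)"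
      using c[OF t] by (simp add: pair_form_def append_parts)
    ultimately show ?thesis
      using coupled_weak_form[OF S nc par Rx Ry c(1,2,4,5)[OF t]] eqs by simp
  qed
  finally have "((\<lambda>s. rho_u S * ?b (ut s) (ut s) + rho_v S * ?m (vt s) (vt s)
      + pair_form S Rx Ry (u s @\<^sub>v v s) (u s @\<^sub>v v s)) has_real_derivative 0) (at t within {0<..T})" .
  then show ?thesis
    by (rule has_field_derivative_transform_within[where d = 1])
      (use t c in \<open>auto simp: Q quad_form_def[of "Hfull S"]\<close>)
qed

theorem theorem3p1:
  shows "\<exists>(C :: nat \<Rightarrow> real \<Rightarrow> real) (C' :: nat \<Rightarrow> real \<Rightarrow> real \<Rightarrow> real).
    (\<forall>q \<kappa>. 1 \<le> q \<and> 0 < \<kappa> \<longrightarrow> 0 < C q \<kappa>) \<and>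
    (\<forall>p \<theta> r. 1 \<le> p \<and> 0 < \<theta> \<and> 0 < r \<longrightarrow> 0 < C' p \<theta> r) \<and>
    (\<forall>(S :: fd_dg) (\<kappa> :: real).
       coupled_setting S \<and>
       0 < rho_u S \<and> 0 < rho_v S \<and>
       0 < mu_u S \<and> 0 < lam_u S \<and> 0 < mu_v S \<and> 0 < lam_v S \<and>
       chi1 S = 2 * mu_v S + lam_v S \<and> chi2 S = 2 * mu_u S + lam_u S \<and>
       0 < \<kappa> \<and> quasi_uniform \<kappa> (mesh S) \<and>
       compatible (grid_m S) (sbp_x S) \<and>
       fully_compatible (grid_n S) (sbp_y S) \<and>
       norm_compatible S \<and>
       alpha_u S = alpha_v S \<and> alpha_v S \<ge> 1 / (4 * C (deg_q S) \<kappa>) \<and>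
       beta_u S = beta_v S \<and>
       beta_v S \<ge> 1 / (4 * C' (sbp_p S) (quadH (sbp_y S) $$ (0, 0) / h_y S) (h_y S / h_u S))
       \<longrightarrow> energy_conserving S)"
proof -
  obtain c where c: "\<And>q. trace_const q (c q)" using trace_inequality by metis
  have c0: "0 < c q" for q using c[of q] by (simp add: trace_const_def)
  \<comment> \<open>\<open>?C'\<close> is \<open>\<H>\<^sub>y(0, 0) / h\<^sub>u\<close>, written as the product of \<open>\<H>\<^sub>y(0, 0) / h\<^sub>y\<close> and \<open>h\<^sub>y / h\<^sub>u\<close>.\<close>
  let ?C = "\<lambda>q \<kappa>. 1 / (c q * \<kappa>)" and ?C' = "\<lambda>(p :: nat) \<theta> r :: real. \<theta> * r"
  have "energy_conserving S"
    if S: "coupled_setting S" and pos: "0 < mu_u S" "0 < lam_u S" "0 < mu_v S" "0 < lam_v S"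
      and chi: "chi1 S = 2 * mu_v S + lam_v S" "chi2 S = 2 * mu_u S + lam_u S"
      and kap: "0 < \<kappa>" and qu: "quasi_uniform \<kappa> (mesh S)"
      and comp: "compatible (grid_m S) (sbp_x S)" "fully_compatible (grid_n S) (sbp_y S)"
      and nc: "norm_compatible S"
      and alpha: "alpha_u S = alpha_v S" "alpha_v S \<ge> 1 / (4 * ?C (deg_q S) \<kappa>)"
      and beta: "beta_u S = beta_v S"
        "beta_v S \<ge> 1 / (4 * ?C' (sbp_p S) (hy S $$ (0, 0) / h_y S) (h_y S / h_u S))"
    for S :: fd_dg and \<kappa> :: real
  proof -
    have geo: "geometry S" and fd: "fd_setting S" using S by (auto simp: coupled_setting_def)
    obtain Rx where Rx: "sym_psd (grid_m S) Rx" "opA (sbp_x S) = transpose_mat (dx S) * hx S * dx S + Rx"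
      using comp(1) by (auto simp: compatible_def)
    obtain Ry where Ry: "sym_psd (grid_n S) Ry" "opD2 (sbp_y S) = minv (hy S)
         * (- (transpose_mat (dy S) * hy S * dy S) - Ry + B_both (grid_n S) * dy S)"
      using comp(2) by (auto simp: fully_compatible_def)
    have "0 < h_y S" using geo fd by (simp add: h_y_def geometry_def fd_setting_def)
    then have beta': "h_u S / (4 * hy S $$ (0, 0)) \<le> beta_v S" using beta(2) by simp
    have alpha': "c (deg_q S) * \<kappa> / 4 \<le> alpha_v S" using alpha(2) by simp
    have nonneg: "0 \<le> pair_form S Rx Ry x x" for x
      unfolding pair_form_def
      by (rule coupled_form_nonneg[OF S pos chi Rx(1) Ry(1) qu kap c alpha' beta']) simp_all
    obtain Q where Q: "sym_psd (2 * N_u S + 2 * N_v S) Q"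
      "\<And>x. x \<in> carrier_vec (2 * N_u S + 2 * N_v S) \<Longrightarrow> quad_form Q x = pair_form S Rx Ry x x"
      using sym_bilinear_matrix[OF pair_form_sym_bilinear[OF S Rx(1) Ry(1)] nonneg] by blast
    show ?thesis
      unfolding energy_conserving_def
      using Q(1) energy_identity[OF S nc alpha(1) beta(1) Rx Ry Q(2)] by blast
  qed
  moreover have "\<forall>q \<kappa>. 1 \<le> q \<and> 0 < \<kappa> \<longrightarrow> 0 < ?C q \<kappa>" using c0 by simp
  moreover have "\<forall>(p :: nat) \<theta> r. 1 \<le> p \<and> 0 < \<theta> \<and> 0 < r \<longrightarrow> 0 < ?C' p \<theta> r" by simp
  ultimately show ?thesis
    by (intro exI[of _ ?C] exI[of _ ?C']) blast
qed

end
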